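(* Let $K$ be an arbitrary field, let $V$ be a $K$-vector space of dimension $d+1$, and let $\mathcal{A}=\{H_0,\ldots,H_n\}$ be a hyperplane arrangement in $V$ that is essential and connected. Let $\Omega_{\mathcal{A}}$ be its complement in $\mathbb{P}(V)$. Then every dominant morphism $f:\Omega_{\mathcal{A}}\to\Omega_{\mathcal{A}}$ is finite.
   Context: All morphisms are morphisms of $K$-schemes. A hyperplane arrangement in $V$ is a finite set $\mathcal{A}=\{H_0,\ldots,H_n\}$ of $n+1$ (distinct) linear hyperplanes of $V$; it is essential if $\bigcap_{i=0}^n H_i=\{0\}$. Choose $l_i\in V^*$ with $H_i=\ker l_i$. The matroid $M_{\mathcal{A}}$ of $\mathcal{A}$ is the matroid on $\{0,\ldots,n\}$ whose independent sets are the index sets of linearly independent subsets of $\{l_0,\ldots,l_n\}$. The arrangement is connected if $M_{\mathcal{A}}$ is a connected matroid (any two distinct elements lie in a common circuit). $\mathbb{P}(V)=\operatorname{Proj}\operatorname{Sym}V^*$ is the projective space of lines in $V$, and $\Omega_{\mathcal{A}}$ is the complement in $\mathbb{P}(V)$ of the union of the hyperplanes in $\mathcal{A}$, an integral affine $K$-scheme. *)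

theory Defs
  imports
    "HOL-Analysis.Abstract_Topology"
    "HOL-Library.Poly_Mapping"
    "HOL-Library.Function_Algebras"
    "HOL-Algebra.Algebraic_Closure_Type"
begin

no_notation var (\<open>X\<index>\<close>)

section \<open>Locally ringed spaces\<close>

record ('p, 's) ringed_space =
  space_of :: "'p topology"
  sheaf :: "'p set \<Rightarrow> 's ring"
  restr :: "'p set \<Rightarrow> 'p set \<Rightarrow> 's \<Rightarrow> 's"  \<comment> \<open>\<open>restr X U V\<close> maps sections on \<open>U\<close> to sections on \<open>V \<subseteq> U\<close>\<close>

abbreviation points :: "('p, 's) ringed_space \<Rightarrow> 'p set" where
  "points X \<equiv> topspace (space_of X)"

definition open_subspace :: "('p, 's) ringed_space \<Rightarrow> 'p set \<Rightarrow> ('p, 's) ringed_space" where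
  "open_subspace X U = X\<lparr>space_of := subtopology (space_of X) U\<rparr>"

definition germ :: "('p, 's) ringed_space \<Rightarrow> 'p \<Rightarrow> 'p set \<Rightarrow> 's \<Rightarrow> ('p set \<times> 's) set" where
  "germ X x U s = {(W, t). openin (space_of X) W \<and> x \<in> W \<and> t \<in> carrier (sheaf X W) \<and>
     (\<exists>Z. openin (space_of X) Z \<and> x \<in> Z \<and> Z \<subseteq> U \<inter> W \<and> restr X U Z s = restr X W Z t)}"

definition stalk :: "('p, 's) ringed_space \<Rightarrow> 'p \<Rightarrow> ('p set \<times> 's) set ring" where
  "stalk X x = \<lparr>
     carrier = {germ X x U s | U s. openin (space_of X) U \<and> x \<in> U \<and> s \<in> carrier (sheaf X U)},
     monoid.mult = (\<lambda>a b. \<Union>(U, s)\<in>a. \<Union>(W, t)\<in>b. germ X x (U \<inter> W)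
        (restr X U (U \<inter> W) s \<otimes>\<^bsub>sheaf X (U \<inter> W)\<^esub> restr X W (U \<inter> W) t)),
     one = germ X x (points X) \<one>\<^bsub>sheaf X (points X)\<^esub>,
     ring.zero = germ X x (points X) \<zero>\<^bsub>sheaf X (points X)\<^esub>,
     add = (\<lambda>a b. \<Union>(U, s)\<in>a. \<Union>(W, t)\<in>b. germ X x (U \<inter> W)
        (restr X U (U \<inter> W) s \<oplus>\<^bsub>sheaf X (U \<inter> W)\<^esub> restr X W (U \<inter> W) t))\<rparr>"

text \<open>A morphism \<open>f : X \<rightarrow> Y\<close> is a pair of a map on points and a family of maps
  \<open>\<O>\<^sub>Y(V) \<rightarrow> \<O>\<^sub>X(f\<^sup>-\<^sup>1 V)\<close>.\<close>

type_synonym ('p, 's, 'q, 't) mor = "('p \<Rightarrow> 'q) \<times> ('q set \<Rightarrow> 't \<Rightarrow> 's)"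

definition preim :: "('p, 's) ringed_space \<Rightarrow> ('p, 's, 'q, 't) mor \<Rightarrow> 'q set \<Rightarrow> 'p set" where
  "preim X f V = {x \<in> points X. fst f x \<in> V}"

definition stalk_map ::
  "('p, 's) ringed_space \<Rightarrow> ('p, 's, 'q, 't) mor \<Rightarrow> 'p \<Rightarrow> ('q set \<times> 't) set \<Rightarrow> ('p set \<times> 's) set" where
  "stalk_map X f x g = (\<Union>(V, s)\<in>g. germ X x (preim X f V) (snd f V s))"

definition ringed_space_morphism ::
  "('p, 's) ringed_space \<Rightarrow> ('q, 't) ringed_space \<Rightarrow> ('p, 's, 'q, 't) mor \<Rightarrow> bool" where
  "ringed_space_morphism X Y f \<longleftrightarrow>
     continuous_map (space_of X) (space_of Y) (fst f) \<and>
     (\<forall>V. openin (space_of Y) V \<longrightarrow> snd f V \<in> ring_hom (sheaf Y V) (sheaf X (preim X f V))) \<and>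
     (\<forall>V W. openin (space_of Y) V \<longrightarrow> openin (space_of Y) W \<longrightarrow> W \<subseteq> V \<longrightarrow>
        (\<forall>s\<in>carrier (sheaf Y V).
           snd f W (restr Y V W s) = restr X (preim X f V) (preim X f W) (snd f V s)))"

text \<open>The maximal ideal of a local ring is its set of non-units, so a homomorphism of local rings
  is local iff it maps non-units to non-units.\<close>

definition local_morphism ::
  "('p, 's) ringed_space \<Rightarrow> ('q, 't) ringed_space \<Rightarrow> ('p, 's, 'q, 't) mor \<Rightarrow> bool" where
  "local_morphism X Y f \<longleftrightarrow> ringed_space_morphism X Y f \<and>
     (\<forall>x\<in>points X. \<forall>g\<in>carrier (stalk Y (fst f x)).
        g \<notin> Units (stalk Y (fst f x)) \<longrightarrow> stalk_map X f x g \<notin> Units (stalk X x))"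

definition lrs_isomorphism ::
  "('p, 's) ringed_space \<Rightarrow> ('q, 't) ringed_space \<Rightarrow> ('p, 's, 'q, 't) mor \<Rightarrow> bool" where
  "lrs_isomorphism X Y f \<longleftrightarrow> local_morphism X Y f \<and>
     homeomorphic_map (space_of X) (space_of Y) (fst f) \<and>
     (\<forall>V. openin (space_of Y) V \<longrightarrow> snd f V \<in> ring_iso (sheaf Y V) (sheaf X (preim X f V)))"

definition comp_mor ::
  "('q, 't) ringed_space \<Rightarrow> ('q, 't, 'r, 'u) mor \<Rightarrow> ('p, 's, 'q, 't) mor \<Rightarrow> ('p, 's, 'r, 'u) mor" where
  "comp_mor Y g f = (fst g \<circ> fst f, \<lambda>W. snd f (preim Y g W) \<circ> snd g W)"

definition same_mor ::
  "('p, 's) ringed_space \<Rightarrow> ('q, 't) ringed_space \<Rightarrow> ('p, 's, 'q, 't) mor \<Rightarrow> ('p, 's, 'q, 't) mor \<Rightarrow> bool" where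
  "same_mor X Y f g \<longleftrightarrow> (\<forall>x\<in>points X. fst f x = fst g x) \<and>
     (\<forall>V. openin (space_of Y) V \<longrightarrow> (\<forall>s\<in>carrier (sheaf Y V). snd f V s = snd g V s))"

definition morphism_over ::
  "('r, 'u) ringed_space \<Rightarrow> ('p, 's) ringed_space \<Rightarrow> ('p, 's, 'r, 'u) mor \<Rightarrow>
   ('q, 't) ringed_space \<Rightarrow> ('q, 't, 'r, 'u) mor \<Rightarrow> ('p, 's, 'q, 't) mor \<Rightarrow> bool" where
  "morphism_over S X \<pi>X Y \<pi>Y f \<longleftrightarrow> local_morphism X Y f \<and> same_mor X S (comp_mor Y \<pi>Y f) \<pi>X"

definition restrict_mor ::
  "('p, 's) ringed_space \<Rightarrow> 'p set \<Rightarrow> ('p, 's, 'q, 't) mor \<Rightarrow> ('p, 's, 'q, 't) mor" where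
  "restrict_mor X U f = (fst f, \<lambda>V s. restr X (preim X f V) (preim X f V \<inter> U) (snd f V s))"

section \<open>Spec and Proj\<close>

text \<open>
  Both constructions are instances of one, for a ring \<open>A\<close>, a collection \<open>\<G>\<close> of subsets of \<open>A\<close>
  and a set \<open>P\<close> of prime ideals: the closed sets are the \<open>{p \<in> P. E \<subseteq> p}\<close> with \<open>E \<subseteq> \<Union>\<G>\<close>, and
  the fractions \<open>a/b\<close> that are allowed are those where \<open>a\<close> and \<open>b\<close> lie in the same member of \<open>\<G>\<close>.
  For \<open>Spec A\<close> take \<open>\<G> = {A}\<close>; for \<open>Proj\<close> of a graded ring let \<open>\<G>\<close> consist of the graded pieces,
  so that \<open>\<Union>\<G>\<close> is the set of homogeneous elements and the local ring at \<open>p\<close> is the degree-zero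
  part of the localization at the homogeneous elements outside \<open>p\<close>.\<close>

definition zariski :: "'a set set \<Rightarrow> 'a set set \<Rightarrow> 'a set topology" where
  "zariski \<G> P = topology (\<lambda>U. \<exists>E\<subseteq>\<Union>\<G>. U = {p \<in> P. \<not> E \<subseteq> p})"

lemma istopology_zariski:
  assumes P: "\<And>p. p \<in> P \<Longrightarrow> primeideal p A"
    and G: "\<Union>\<G> \<subseteq> carrier A" "\<And>a b. a \<in> \<Union>\<G> \<Longrightarrow> b \<in> \<Union>\<G> \<Longrightarrow> a \<otimes>\<^bsub>A\<^esub> b \<in> \<Union>\<G>"
  shows "istopology (\<lambda>U. \<exists>E\<subseteq>\<Union>\<G>. U = {p \<in> P. \<not> E \<subseteq> p})"
  unfolding istopology_def
proof (intro conjI allI impI)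
  fix U V
  assume "\<exists>E\<subseteq>\<Union>\<G>. U = {p \<in> P. \<not> E \<subseteq> p}" "\<exists>E\<subseteq>\<Union>\<G>. V = {p \<in> P. \<not> E \<subseteq> p}"
  then obtain E F where E: "E \<subseteq> \<Union>\<G>" "U = {p \<in> P. \<not> E \<subseteq> p}"
    and F: "F \<subseteq> \<Union>\<G>" "V = {p \<in> P. \<not> F \<subseteq> p}" by blast
  define M where "M = {a \<otimes>\<^bsub>A\<^esub> b | a b. a \<in> E \<and> b \<in> F}"
  have M: "M \<subseteq> \<Union>\<G>" using G(2) E(1) F(1) unfolding M_def by blast
  have "\<not> E \<subseteq> p \<and> \<not> F \<subseteq> p \<longleftrightarrow> \<not> M \<subseteq> p" if "p \<in> P" for p
  proof -
    interpret primeideal p A by (rule P[OF that])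
    have *: "a \<otimes>\<^bsub>A\<^esub> b \<in> p \<longleftrightarrow> a \<in> p \<or> b \<in> p" if "a \<in> E" "b \<in> F" for a b
    proof -
      have "a \<in> carrier A" "b \<in> carrier A" using that E F G by auto
      then show ?thesis using I_prime I_l_closed I_r_closed by blast
    qed
    show ?thesis
    proof
      assume "\<not> E \<subseteq> p \<and> \<not> F \<subseteq> p"
      then obtain a b where "a \<in> E" "a \<notin> p" "b \<in> F" "b \<notin> p" by blast
      then show "\<not> M \<subseteq> p" using * unfolding M_def by blast
    next
      assume "\<not> M \<subseteq> p"
      then show "\<not> E \<subseteq> p \<and> \<not> F \<subseteq> p" using * unfolding M_def by blast
    qed
  qed
  then have "U \<inter> V = {p \<in> P. \<not> M \<subseteq> p}" using E F by blast
  then show "\<exists>E\<subseteq>\<Union>\<G>. U \<inter> V = {p \<in> P. \<not> E \<subseteq> p}" using M by blast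
next
  fix \<K>
  assume "\<forall>K\<in>\<K>. \<exists>E\<subseteq>\<Union>\<G>. K = {p \<in> P. \<not> E \<subseteq> p}"
  then obtain e where e: "\<And>K. K \<in> \<K> \<Longrightarrow> e K \<subseteq> \<Union>\<G> \<and> K = {p \<in> P. \<not> e K \<subseteq> p}" by metis
  have "\<Union>\<K> = {p \<in> P. \<not> (\<Union>K\<in>\<K>. e K) \<subseteq> p}"
  proof (rule Set.set_eqI)
    fix p
    have "p \<in> K \<longleftrightarrow> p \<in> P \<and> \<not> e K \<subseteq> p" if "K \<in> \<K>" for K using e[OF that] by blast
    then show "p \<in> \<Union>\<K> \<longleftrightarrow> p \<in> {p \<in> P. \<not> (\<Union>K\<in>\<K>. e K) \<subseteq> p}" by blast
  qed
  moreover have "(\<Union>K\<in>\<K>. e K) \<subseteq> \<Union>\<G>" using e by blast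
  ultimately show "\<exists>E\<subseteq>\<Union>\<G>. \<Union>\<K> = {p \<in> P. \<not> E \<subseteq> p}" by blast
qed

definition fractions :: "'a set set \<Rightarrow> 'a set \<Rightarrow> ('a \<times> 'a) set" where
  "fractions \<G> p = {(a, b). \<exists>G\<in>\<G>. a \<in> G \<and> b \<in> G \<and> b \<notin> p}"

text \<open>The element \<open>a/b\<close> of the local ring at \<open>p\<close>, as the class of all pairs representing it.\<close>

definition loc_frac :: "('a, 'm) ring_scheme \<Rightarrow> 'a set set \<Rightarrow> 'a set \<Rightarrow> 'a \<Rightarrow> 'a \<Rightarrow> ('a \<times> 'a) set" where
  "loc_frac A \<G> p a b = {(c, e) \<in> fractions \<G> p. \<exists>u\<in>\<Union>\<G> - p. u \<otimes>\<^bsub>A\<^esub> (a \<otimes>\<^bsub>A\<^esub> e) = u \<otimes>\<^bsub>A\<^esub> (c \<otimes>\<^bsub>A\<^esub> b)}"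

definition local_ring :: "('a, 'm) ring_scheme \<Rightarrow> 'a set set \<Rightarrow> 'a set \<Rightarrow> ('a \<times> 'a) set ring" where
  "local_ring A \<G> p = \<lparr>
     carrier = {loc_frac A \<G> p a b | a b. (a, b) \<in> fractions \<G> p},
     monoid.mult = (\<lambda>x y. \<Union>(a, b)\<in>x. \<Union>(c, e)\<in>y. loc_frac A \<G> p (a \<otimes>\<^bsub>A\<^esub> c) (b \<otimes>\<^bsub>A\<^esub> e)),
     one = loc_frac A \<G> p \<one>\<^bsub>A\<^esub> \<one>\<^bsub>A\<^esub>,
     ring.zero = loc_frac A \<G> p \<zero>\<^bsub>A\<^esub> \<one>\<^bsub>A\<^esub>,
     add = (\<lambda>x y. \<Union>(a, b)\<in>x. \<Union>(c, e)\<in>y.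
        loc_frac A \<G> p (a \<otimes>\<^bsub>A\<^esub> e \<oplus>\<^bsub>A\<^esub> c \<otimes>\<^bsub>A\<^esub> b) (b \<otimes>\<^bsub>A\<^esub> e))\<rparr>"

definition regular_sections ::
  "('a, 'm) ring_scheme \<Rightarrow> 'a set set \<Rightarrow> 'a set set \<Rightarrow> 'a set set \<Rightarrow> ('a set \<Rightarrow> ('a \<times> 'a) set) set" where
  "regular_sections A \<G> P U = {s \<in> extensional U. \<forall>p\<in>U. \<exists>W a b.
     openin (zariski \<G> P) W \<and> p \<in> W \<and> W \<subseteq> U \<and>
     (\<forall>q\<in>W. (a, b) \<in> fractions \<G> q \<and> s q = loc_frac A \<G> q a b)}"

definition prime_space ::
  "('a, 'm) ring_scheme \<Rightarrow> 'a set set \<Rightarrow> 'a set set \<Rightarrow> ('a set, 'a set \<Rightarrow> ('a \<times> 'a) set) ringed_space" where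
  "prime_space A \<G> P = \<lparr>
     space_of = zariski \<G> P,
     sheaf = (\<lambda>U. \<lparr>
        carrier = regular_sections A \<G> P U,
        monoid.mult = (\<lambda>s t. \<lambda>p\<in>U. s p \<otimes>\<^bsub>local_ring A \<G> p\<^esub> t p),
        one = (\<lambda>p\<in>U. \<one>\<^bsub>local_ring A \<G> p\<^esub>),
        ring.zero = (\<lambda>p\<in>U. \<zero>\<^bsub>local_ring A \<G> p\<^esub>),
        add = (\<lambda>s t. \<lambda>p\<in>U. s p \<oplus>\<^bsub>local_ring A \<G> p\<^esub> t p)\<rparr>),
     restr = (\<lambda>U V s. restrict s V)\<rparr>"

definition Spec :: "('a, 'm) ring_scheme \<Rightarrow> ('a set, 'a set \<Rightarrow> ('a \<times> 'a) set) ringed_space" where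
  "Spec A = prime_space A {carrier A} {p. primeideal p A}"

text \<open>Graded rings are given by a ring \<open>S\<close> and the family \<open>gr\<close> of its graded pieces.\<close>

definition homogeneous_ideal :: "('a, 'm) ring_scheme \<Rightarrow> (nat \<Rightarrow> 'a set) \<Rightarrow> 'a set \<Rightarrow> bool" where
  "homogeneous_ideal S gr I \<longleftrightarrow> ideal I S \<and> I = Idl\<^bsub>S\<^esub> (I \<inter> (\<Union>k. gr k))"

definition Proj_points :: "('a, 'm) ring_scheme \<Rightarrow> (nat \<Rightarrow> 'a set) \<Rightarrow> 'a set set" where
  "Proj_points S gr = {p. primeideal p S \<and> homogeneous_ideal S gr p \<and>
     \<not> Idl\<^bsub>S\<^esub> (\<Union>k\<in>{0<..}. gr k) \<subseteq> p}"

definition Proj ::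
  "('a, 'm) ring_scheme \<Rightarrow> (nat \<Rightarrow> 'a set) \<Rightarrow> ('a set, 'a set \<Rightarrow> ('a \<times> 'a) set) ringed_space" where
  "Proj S gr = prime_space S (range gr) (Proj_points S gr)"

text \<open>The morphism \<open>Proj S \<rightarrow> Spec B\<close> induced by a ring homomorphism \<open>h\<close> from \<open>B\<close> to the
  degree-zero part of \<open>S\<close>.\<close>

definition Proj_struct ::
  "('b, 'n) ring_scheme \<Rightarrow> ('b \<Rightarrow> 'a) \<Rightarrow> ('a, 'm) ring_scheme \<Rightarrow> (nat \<Rightarrow> 'a set) \<Rightarrow>
   ('a set, 'a set \<Rightarrow> ('a \<times> 'a) set, 'b set, 'b set \<Rightarrow> ('b \<times> 'b) set) mor" where
  "Proj_struct B h S gr =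
     (let \<pi> = (\<lambda>p. {c \<in> carrier B. h c \<in> p}) in
      (\<pi>, \<lambda>W t. \<lambda>p\<in>{p \<in> Proj_points S gr. \<pi> p \<in> W}.
            \<Union>(c, e)\<in>t (\<pi> p). loc_frac S (range gr) p (h c) (h e)))"

section \<open>Affine schemes, finite and dominant morphisms\<close>

text \<open>In \<open>affine_scheme\<close> it is no restriction that \<open>A\<close> lives on the type of sections of \<open>X\<close>, because
  \<open>X \<cong> Spec A\<close> forces \<open>A\<close> to be isomorphic to the ring of global sections of \<open>X\<close>.\<close>

definition affine_scheme :: "('p, 's) ringed_space \<Rightarrow> bool" where
  "affine_scheme X \<longleftrightarrow> (\<exists>(A :: 's ring) f. cring A \<and> lrs_isomorphism X (Spec A) f)"

definition finite_ring_hom :: "('b, 'm) ring_scheme \<Rightarrow> ('a, 'n) ring_scheme \<Rightarrow> ('b \<Rightarrow> 'a) \<Rightarrow> bool" where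
  "finite_ring_hom B A h \<longleftrightarrow> (\<exists>F. finite F \<and> F \<subseteq> carrier A \<and>
     (\<forall>a\<in>carrier A. \<exists>c\<in>F \<rightarrow> carrier B. a = (\<Oplus>\<^bsub>A\<^esub>x\<in>F. h (c x) \<otimes>\<^bsub>A\<^esub> x)))"

text \<open>Finite in the sense of Hartshorne: over some affine open cover of the target the morphism has
  affine preimages and module-finite rings of sections.\<close>

definition finite_morphism ::
  "('p, 's) ringed_space \<Rightarrow> ('q, 't) ringed_space \<Rightarrow> ('p, 's, 'q, 't) mor \<Rightarrow> bool" where
  "finite_morphism X Y f \<longleftrightarrow> (\<exists>\<V>. \<Union>\<V> = points Y \<and> (\<forall>V\<in>\<V>. openin (space_of Y) V \<and>
     affine_scheme (open_subspace Y V) \<and> affine_scheme (open_subspace X (preim X f V)) \<and>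
     finite_ring_hom (sheaf Y V) (sheaf X (preim X f V)) (snd f V)))"

definition dominant ::
  "('p, 's) ringed_space \<Rightarrow> ('q, 't) ringed_space \<Rightarrow> ('p, 's, 'q, 't) mor \<Rightarrow> bool" where
  "dominant X Y f \<longleftrightarrow> space_of Y closure_of (fst f ` points X) = points Y"

section \<open>The symmetric algebra\<close>

text \<open>The symmetric algebra of a subspace \<open>W\<close> of a vector space with scalar multiplication \<open>sc\<close> is
  the polynomial ring on a set of indeterminates indexed by \<open>W\<close>, modulo the relations
  \<open>X\<^sub>u\<^sub>+\<^sub>v = X\<^sub>u + X\<^sub>v\<close> and \<open>X\<^sub>c\<^sub>u = c X\<^sub>u\<close>.\<close>

type_synonym ('w, 'k) mpoly = "('w \<Rightarrow>\<^sub>0 nat) \<Rightarrow>\<^sub>0 'k"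

definition mpoly_var :: "'w \<Rightarrow> ('w, 'k::comm_ring_1) mpoly" where
  "mpoly_var w = Poly_Mapping.single (Poly_Mapping.single w 1) 1"

definition mpoly_const :: "'k \<Rightarrow> ('w, 'k::comm_ring_1) mpoly" where
  "mpoly_const c = Poly_Mapping.single 0 c"

definition mpoly_ring :: "'w set \<Rightarrow> ('w, 'k::comm_ring_1) mpoly ring" where
  "mpoly_ring W = ring_of_type_algebra
     \<lparr>carrier := {p. \<forall>m\<in>Poly_Mapping.keys p. Poly_Mapping.keys m \<subseteq> W}\<rparr>"

definition mpoly_homogeneous :: "nat \<Rightarrow> ('w, 'k::comm_ring_1) mpoly \<Rightarrow> bool" where
  "mpoly_homogeneous k p \<longleftrightarrow>
     (\<forall>m\<in>Poly_Mapping.keys p. (\<Sum>w\<in>Poly_Mapping.keys m. Poly_Mapping.lookup m w) = k)"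

definition sym_ideal ::
  "('k::comm_ring_1 \<Rightarrow> 'w \<Rightarrow> 'w) \<Rightarrow> 'w::ab_group_add set \<Rightarrow> ('w, 'k) mpoly set" where
  "sym_ideal sc W = Idl\<^bsub>mpoly_ring W\<^esub>
     ({mpoly_var (u + v) - (mpoly_var u + mpoly_var v) | u v. u \<in> W \<and> v \<in> W} \<union>
      {mpoly_var (sc c u) - mpoly_const c * mpoly_var u | c u. u \<in> W})"

definition Sym ::
  "('k::comm_ring_1 \<Rightarrow> 'w \<Rightarrow> 'w) \<Rightarrow> 'w::ab_group_add set \<Rightarrow> ('w, 'k) mpoly set ring" where
  "Sym sc W = mpoly_ring W Quot sym_ideal sc W"

definition sym_class ::
  "('k::comm_ring_1 \<Rightarrow> 'w \<Rightarrow> 'w) \<Rightarrow> 'w::ab_group_add set \<Rightarrow> ('w, 'k) mpoly \<Rightarrow> ('w, 'k) mpoly set" where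
  "sym_class sc W p = sym_ideal sc W +>\<^bsub>mpoly_ring W\<^esub> p"

definition Sym_grade ::
  "('k::comm_ring_1 \<Rightarrow> 'w \<Rightarrow> 'w) \<Rightarrow> 'w::ab_group_add set \<Rightarrow> nat \<Rightarrow> ('w, 'k) mpoly set set" where
  "Sym_grade sc W k = sym_class sc W ` {p \<in> carrier (mpoly_ring W). mpoly_homogeneous k p}"

section \<open>Hyperplane arrangements\<close>

definition dual_scale :: "'k::field \<Rightarrow> ('v \<Rightarrow> 'k) \<Rightarrow> ('v \<Rightarrow> 'k)" where
  "dual_scale c \<phi> = (\<lambda>v. c * \<phi> v)"

definition dual_space :: "('k::field \<Rightarrow> 'v \<Rightarrow> 'v) \<Rightarrow> ('v::ab_group_add \<Rightarrow> 'k) set" where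
  "dual_space scale = {\<phi>. Vector_Spaces.linear scale (*) \<phi>}"

abbreviation SymDual ::
  "('k::field \<Rightarrow> 'v \<Rightarrow> 'v) \<Rightarrow> ('v::ab_group_add \<Rightarrow> 'k, 'k) mpoly set ring" where
  "SymDual scale \<equiv> Sym dual_scale (dual_space scale)"

abbreviation SymDual_grade ::
  "('k::field \<Rightarrow> 'v \<Rightarrow> 'v) \<Rightarrow> nat \<Rightarrow> ('v::ab_group_add \<Rightarrow> 'k, 'k) mpoly set set" where
  "SymDual_grade scale \<equiv> Sym_grade dual_scale (dual_space scale)"

definition linear_form ::
  "('k::field \<Rightarrow> 'v \<Rightarrow> 'v) \<Rightarrow> ('v::ab_group_add \<Rightarrow> 'k) \<Rightarrow> ('v \<Rightarrow> 'k, 'k) mpoly set" where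
  "linear_form scale \<phi> = sym_class dual_scale (dual_space scale) (mpoly_var \<phi>)"

definition proj_space where
  "proj_space scale = Proj (SymDual scale) (SymDual_grade scale)"

definition Spec_field where
  "Spec_field (_ :: 'k::field itself) = Spec (ring_of_type_algebra :: 'k ring)"

definition proj_space_struct where
  "proj_space_struct (scale :: 'k::field \<Rightarrow> 'v::ab_group_add \<Rightarrow> 'v) =
     Proj_struct (ring_of_type_algebra :: 'k ring)
       (\<lambda>c. sym_class dual_scale (dual_space scale) (mpoly_const c))
       (SymDual scale) (SymDual_grade scale)"

text \<open>\<open>\<P>(W) \<subseteq> \<P>(V)\<close> is the zero locus of the linear forms that vanish on \<open>W\<close>.\<close>

definition proj_subspace where
  "proj_subspace scale W = {p \<in> points (proj_space scale).
     \<forall>\<phi>\<in>dual_space scale. (\<forall>v\<in>W. \<phi> v = 0) \<longrightarrow> linear_form scale \<phi> \<in> p}"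

definition hyperplane :: "('k::field \<Rightarrow> 'v \<Rightarrow> 'v) \<Rightarrow> 'v::ab_group_add set \<Rightarrow> bool" where
  "hyperplane scale W \<longleftrightarrow> (\<exists>\<phi>\<in>dual_space scale. \<phi> \<noteq> (\<lambda>_. 0) \<and> W = {v. \<phi> v = 0})"

definition arrangement ::
  "('k::field \<Rightarrow> 'v \<Rightarrow> 'v) \<Rightarrow> nat \<Rightarrow> (nat \<Rightarrow> 'v::ab_group_add set) \<Rightarrow> bool" where
  "arrangement scale n H \<longleftrightarrow> (\<forall>i\<le>n. hyperplane scale (H i)) \<and> inj_on H {..n}"

definition essential :: "nat \<Rightarrow> (nat \<Rightarrow> 'v::zero set) \<Rightarrow> bool" where
  "essential n H \<longleftrightarrow> (\<Inter>i\<le>n. H i) = {0}"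

definition compl_points where
  "compl_points scale n H = points (proj_space scale) - (\<Union>i\<le>n. proj_subspace scale (H i))"

definition arr_compl where
  "arr_compl scale n H = open_subspace (proj_space scale) (compl_points scale n H)"

definition arr_compl_struct where
  "arr_compl_struct scale n H =
     restrict_mor (proj_space scale) (compl_points scale n H) (proj_space_struct scale)"

definition matroid_indep :: "nat \<Rightarrow> (nat \<Rightarrow> 'v \<Rightarrow> 'k::field) \<Rightarrow> nat set \<Rightarrow> bool" where
  "matroid_indep n l I \<longleftrightarrow> I \<subseteq> {..n} \<and> inj_on l I \<and> \<not> module.dependent dual_scale (l ` I)"

definition circuit :: "'e set \<Rightarrow> ('e set \<Rightarrow> bool) \<Rightarrow> 'e set \<Rightarrow> bool" where
  "circuit E indep C \<longleftrightarrow> C \<subseteq> E \<and> \<not> indep C \<and> (\<forall>D. D \<subset> C \<longrightarrow> indep D)"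

definition connected_matroid :: "'e set \<Rightarrow> ('e set \<Rightarrow> bool) \<Rightarrow> bool" where
  "connected_matroid E indep \<longleftrightarrow>
     (\<forall>i\<in>E. \<forall>j\<in>E. i \<noteq> j \<longrightarrow> (\<exists>C. circuit E indep C \<and> i \<in> C \<and> j \<in> C))"

end

theory Submission
  imports Defs
    "HOL-Computational_Algebra.Fraction_Field"
begin

text \<open>Write \<open>l\<^sub>i\<close> for the linear forms of the arrangement. The symmetric algebra is a polynomial ring in
  which the \<open>l\<^sub>i\<close> are prime, so the units of \<open>\<O>(\<Omega>)\<close> are the products of a constant and powers of
  \<open>u\<^sub>i = l\<^sub>i / l\<^sub>0\<close>, and by essentiality these units span \<open>\<O>(\<Omega>)\<close>. A dominant \<open>f\<close> induces an injective
  endomorphism \<open>\<psi>\<close> of the \<open>K\<close>-algebra \<open>\<O>(\<Omega>)\<close>, hence an injective endomorphism of the finitely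
  generated group \<open>\<O>(\<Omega>)\<^sup>\<times>/K\<^sup>\<times>\<close>. A linear dependency between the exponent vectors of
  \<open>u\<^sub>i, \<psi>(u\<^sub>i), \<psi>\<^sup>2(u\<^sub>i), \<dots>\<close> shows that some power \<open>u\<^sub>i\<^sup>N\<close> lies in the image of \<open>\<psi>\<close>, and then the monomials
  with exponents below these \<open>N\<close> span \<open>\<O>(\<Omega>)\<close> over the image. Since everything is integral, the
  structure sheaves of \<open>\<Omega>\<close> and of \<open>Spec \<O>(\<Omega>)\<close> are described by subrings of one function field.\<close>

section \<open>Integral spaces inside a function field\<close>

text \<open>A section over an open set \<open>U\<close> is given by an element of the function field that lies in the local
  ring \<open>\<O> p\<close> of every \<open>p \<in> U\<close>; over \<open>U = {}\<close> this is the whole field, and \<open>sec\<close> is constant there.\<close>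

locale rational_space =
  fixes X :: "('p, 's) ringed_space" and \<O> :: "'p \<Rightarrow> 'f::field set" and sec :: "'p set \<Rightarrow> 'f \<Rightarrow> 's"
  assumes carrier_sheaf: "openin (space_of X) U \<Longrightarrow> carrier (sheaf X U) = sec U ` (\<Inter>p\<in>U. \<O> p)"
    and sec_mult: "openin (space_of X) U \<Longrightarrow> x \<in> (\<Inter>p\<in>U. \<O> p) \<Longrightarrow> y \<in> (\<Inter>p\<in>U. \<O> p) \<Longrightarrow>
        sec U x \<otimes>\<^bsub>sheaf X U\<^esub> sec U y = sec U (x * y)"
    and sec_add: "openin (space_of X) U \<Longrightarrow> x \<in> (\<Inter>p\<in>U. \<O> p) \<Longrightarrow> y \<in> (\<Inter>p\<in>U. \<O> p) \<Longrightarrow>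
        sec U x \<oplus>\<^bsub>sheaf X U\<^esub> sec U y = sec U (x + y)"
    and sec_one: "openin (space_of X) U \<Longrightarrow> \<one>\<^bsub>sheaf X U\<^esub> = sec U 1"
    and sec_zero: "openin (space_of X) U \<Longrightarrow> \<zero>\<^bsub>sheaf X U\<^esub> = sec U 0"
    and restr_sec: "openin (space_of X) U \<Longrightarrow> openin (space_of X) V \<Longrightarrow> V \<subseteq> U \<Longrightarrow>
        x \<in> (\<Inter>p\<in>U. \<O> p) \<Longrightarrow> restr X U V (sec U x) = sec V x"
    and sec_inj: "openin (space_of X) U \<Longrightarrow> U \<noteq> {} \<Longrightarrow> x \<in> (\<Inter>p\<in>U. \<O> p) \<Longrightarrow> y \<in> (\<Inter>p\<in>U. \<O> p) \<Longrightarrow>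
        sec U x = sec U y \<Longrightarrow> x = y"
    and sec_empty: "sec {} x = sec {} y"
    and \<O>_one: "p \<in> points X \<Longrightarrow> 1 \<in> \<O> p"
    and \<O>_zero: "p \<in> points X \<Longrightarrow> 0 \<in> \<O> p"
    and \<O>_add: "p \<in> points X \<Longrightarrow> x \<in> \<O> p \<Longrightarrow> y \<in> \<O> p \<Longrightarrow> x + y \<in> \<O> p"
    and \<O>_mult: "p \<in> points X \<Longrightarrow> x \<in> \<O> p \<Longrightarrow> y \<in> \<O> p \<Longrightarrow> x * y \<in> \<O> p"
    and spread: "p \<in> points X \<Longrightarrow> x \<in> \<O> p \<Longrightarrow>
        \<exists>W. openin (space_of X) W \<and> p \<in> W \<and> x \<in> (\<Inter>q\<in>W. \<O> q)"
begin

definition germ_set :: "'p \<Rightarrow> 'f \<Rightarrow> ('p set \<times> 's) set" where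
  "germ_set p x = {(W, sec W x) | W. openin (space_of X) W \<and> p \<in> W \<and> x \<in> (\<Inter>q\<in>W. \<O> q)}"

lemma germ_sec:
  assumes U: "openin (space_of X) U" "p \<in> U" and x: "x \<in> (\<Inter>q\<in>U. \<O> q)"
  shows "germ X p U (sec U x) = germ_set p x"
proof (intro subset_antisym subsetI)
  fix w assume "w \<in> germ X p U (sec U x)"
  then obtain W t Z where w: "w = (W, t)" "openin (space_of X) W" "p \<in> W" "t \<in> carrier (sheaf X W)"
    "openin (space_of X) Z" "p \<in> Z" "Z \<subseteq> U \<inter> W" "restr X U Z (sec U x) = restr X W Z t"
    unfolding germ_def by blast
  then obtain y where y: "t = sec W y" "y \<in> (\<Inter>q\<in>W. \<O> q)" using carrier_sheaf by auto
  have "sec Z x = sec Z y" using w y U x restr_sec[of U Z x] restr_sec[of W Z y] by auto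
  moreover have "x \<in> (\<Inter>q\<in>Z. \<O> q)" "y \<in> (\<Inter>q\<in>Z. \<O> q)" using w(7) x y by auto
  ultimately have "x = y" using sec_inj w by blast
  then show "w \<in> germ_set p x" using w y unfolding germ_set_def by auto
next
  fix w assume "w \<in> germ_set p x"
  then obtain W where w: "w = (W, sec W x)" "openin (space_of X) W" "p \<in> W" "x \<in> (\<Inter>q\<in>W. \<O> q)"
    unfolding germ_set_def by auto
  have UW: "openin (space_of X) (U \<inter> W)" using U w by auto
  moreover have "sec W x \<in> carrier (sheaf X W)" using carrier_sheaf w by auto
  moreover have "restr X U (U \<inter> W) (sec U x) = restr X W (U \<inter> W) (sec W x)"
    using restr_sec[OF U(1) UW _ x] restr_sec[OF w(2) UW _ w(4)] by simp
  ultimately show "w \<in> germ X p U (sec U x)" unfolding germ_def using U w by blast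
qed

lemma germ_set_nonempty: "p \<in> points X \<Longrightarrow> x \<in> \<O> p \<Longrightarrow> germ_set p x \<noteq> {}"
  using spread[of p x] unfolding germ_set_def by auto

lemma germ_set_inj:
  assumes "p \<in> points X" "x \<in> \<O> p" "germ_set p x = germ_set p y"
  shows "x = y"
proof -
  obtain W where W: "openin (space_of X) W" "p \<in> W" "x \<in> (\<Inter>q\<in>W. \<O> q)" using spread[OF assms(1,2)] by auto
  then have "(W, sec W x) \<in> germ_set p x" unfolding germ_set_def by auto
  then have "sec W x = sec W y" "y \<in> (\<Inter>q\<in>W. \<O> q)" unfolding assms(3) unfolding germ_set_def by auto
  then show ?thesis using sec_inj[OF W(1) _ W(3)] W(2) by auto
qed

lemma carrier_stalk:
  assumes p: "p \<in> points X"
  shows "carrier (stalk X p) = germ_set p ` \<O> p"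
proof (intro subset_antisym subsetI)
  fix w assume "w \<in> carrier (stalk X p)"
  then obtain U s where w: "w = germ X p U s" "openin (space_of X) U" "p \<in> U" "s \<in> carrier (sheaf X U)"
    unfolding stalk_def by auto
  then obtain x where x: "s = sec U x" "x \<in> (\<Inter>q\<in>U. \<O> q)" using carrier_sheaf by auto
  show "w \<in> germ_set p ` \<O> p" using w x germ_sec[of U p x] by auto
next
  fix w assume "w \<in> germ_set p ` \<O> p"
  then obtain x where x: "w = germ_set p x" "x \<in> \<O> p" by auto
  obtain W where W: "openin (space_of X) W" "p \<in> W" "x \<in> (\<Inter>q\<in>W. \<O> q)" using spread[OF p x(2)] by auto
  have "w = germ X p W (sec W x)" using germ_sec W x by auto
  moreover have "sec W x \<in> carrier (sheaf X W)" using carrier_sheaf W by auto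
  ultimately show "w \<in> carrier (stalk X p)" unfolding stalk_def using W by auto
qed

lemma stalk_mult:
  assumes p: "p \<in> points X" and x: "x \<in> \<O> p" and y: "y \<in> \<O> p"
  shows "germ_set p x \<otimes>\<^bsub>stalk X p\<^esub> germ_set p y = germ_set p (x * y)"
proof -
  have *: "germ X p (U \<inter> W) (restr X U (U \<inter> W) s \<otimes>\<^bsub>sheaf X (U \<inter> W)\<^esub> restr X W (U \<inter> W) t) = germ_set p (x * y)"
    if st: "(U, s) \<in> germ_set p x" "(W, t) \<in> germ_set p y" for U s W t
  proof -
    have U: "s = sec U x" "openin (space_of X) U" "p \<in> U" "x \<in> (\<Inter>q\<in>U. \<O> q)"
     and W: "t = sec W y" "openin (space_of X) W" "p \<in> W" "y \<in> (\<Inter>q\<in>W. \<O> q)"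
      using st unfolding germ_set_def by auto
    have UW: "openin (space_of X) (U \<inter> W)" "p \<in> U \<inter> W" using U W by auto
    have xy: "x \<in> (\<Inter>q\<in>U \<inter> W. \<O> q)" "y \<in> (\<Inter>q\<in>U \<inter> W. \<O> q)" using U W by auto
    have "U \<inter> W \<subseteq> points X" using UW openin_subset by blast
    then have "x * y \<in> (\<Inter>q\<in>U \<inter> W. \<O> q)" using xy \<O>_mult by blast
    then show ?thesis unfolding U(1) W(1)
      using restr_sec[OF U(2) UW(1) _ U(4)] restr_sec[OF W(2) UW(1) _ W(4)]
        sec_mult[OF UW(1) xy] germ_sec[OF UW] by simp
  qed
  have "germ_set p x \<otimes>\<^bsub>stalk X p\<^esub> germ_set p y = (\<Union>(U, s)\<in>germ_set p x. \<Union>(W, t)\<in>germ_set p y. germ_set p (x * y))"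
    unfolding stalk_def monoid.simps using * by (intro SUP_cong refl) (auto simp del: monoid.simps)
  then show ?thesis using germ_set_nonempty[OF p x] germ_set_nonempty[OF p y] by auto
qed

lemma stalk_one:
  assumes p: "p \<in> points X"
  shows "\<one>\<^bsub>stalk X p\<^esub> = germ_set p 1"
proof -
  have "1 \<in> (\<Inter>q\<in>points X. \<O> q)" using \<O>_one by auto
  then show ?thesis unfolding stalk_def using sec_one[of "points X"] germ_sec[of "points X" p 1] p by auto
qed

lemma germ_set_in_Units:
  assumes p: "p \<in> points X" and x: "x \<in> \<O> p"
  shows "germ_set p x \<in> Units (stalk X p) \<longleftrightarrow> (\<exists>y\<in>\<O> p. x * y = 1)"
proof
  assume "germ_set p x \<in> Units (stalk X p)"
  then obtain y where y: "y \<in> \<O> p" "germ_set p x \<otimes>\<^bsub>stalk X p\<^esub> germ_set p y = \<one>\<^bsub>stalk X p\<^esub>"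
    unfolding Units_def carrier_stalk[OF p] by blast
  then have "germ_set p (x * y) = germ_set p 1" using stalk_mult stalk_one p x by simp
  then show "\<exists>y\<in>\<O> p. x * y = 1" using germ_set_inj[OF p] \<O>_mult[OF p x] y by blast
next
  assume "\<exists>y\<in>\<O> p. x * y = 1"
  then obtain y where y: "y \<in> \<O> p" "x * y = 1" by blast
  then show "germ_set p x \<in> Units (stalk X p)"
    unfolding Units_def carrier_stalk[OF p] using x
    by (auto simp: stalk_mult[OF p] stalk_one[OF p] mult.commute intro!: bexI[of _ y])
qed

lemma open_subspace_rational:
  assumes U: "openin (space_of X) U"
  shows "rational_space (open_subspace X U) \<O> sec"
proof -
  have *: "openin (space_of (open_subspace X U)) V \<longleftrightarrow> openin (space_of X) V \<and> V \<subseteq> U" for V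
    unfolding open_subspace_def using U by (auto simp: openin_open_subtopology)
  have sp: "points (open_subspace X U) \<subseteq> points X" unfolding open_subspace_def by (auto simp: topspace_subtopology)
  have [simp]: "sheaf (open_subspace X U) = sheaf X" "restr (open_subspace X U) = restr X"
    unfolding open_subspace_def by auto
  show ?thesis
  proof (unfold_locales, goal_cases)
    case (13 p x)
    then have "p \<in> points X" "p \<in> U" unfolding open_subspace_def by (auto simp: topspace_subtopology)
    then obtain W where W: "openin (space_of X) W" "p \<in> W" "x \<in> (\<Inter>q\<in>W. \<O> q)" using spread[OF _ 13(2)] by auto
    show ?case using W \<open>p \<in> U\<close> U by (intro exI[of _ "U \<inter> W"]) (auto simp: *)
  next
    case (8 x y) then show ?case by (rule sec_empty)
  next
    case 7 then show ?case unfolding * using sec_inj by metis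
  qed (use sp in \<open>auto simp: * carrier_sheaf sec_mult sec_add sec_one sec_zero restr_sec \<O>_one \<O>_zero \<O>_add \<O>_mult\<close>)
qed

end

lemma rational_space_isomorphism:
  assumes X: "rational_space X \<O>X secX" and Y: "rational_space Y \<O>Y secY"
    and homeo: "homeomorphic_map (space_of X) (space_of Y) \<phi>"
    and loc: "\<And>p. p \<in> points X \<Longrightarrow> \<O>Y (\<phi> p) = \<O>X p"
  shows "\<exists>f. lrs_isomorphism X Y f"
proof -
  interpret X: rational_space X \<O>X secX by (rule X)
  interpret Y: rational_space Y \<O>Y secY by (rule Y)
  define f where "f = (\<phi>, \<lambda>V t. secX {p \<in> points X. \<phi> p \<in> V} (SOME x. x \<in> (\<Inter>q\<in>V. \<O>Y q) \<and> t = secY V x))"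
  have cont: "continuous_map (space_of X) (space_of Y) \<phi>"
    using homeo homeomorphic_imp_continuous_map by blast
  have surj: "\<phi> ` points X = points Y" using homeo homeomorphic_imp_surjective_map by blast
  have pre: "preim X f V = {p \<in> points X. \<phi> p \<in> V}" for V unfolding preim_def f_def by auto
  have preop: "openin (space_of X) (preim X f V)" if "openin (space_of Y) V" for V
    unfolding pre using cont that by (simp add: continuous_map_def)
  have img: "V = \<phi> ` preim X f V" if "openin (space_of Y) V" for V
  proof -
    have "V \<subseteq> \<phi> ` points X" using openin_subset[OF that] surj by simp
    then show ?thesis unfolding pre by (fastforce simp: image_iff)
  qed
  have \<Gamma>: "(\<Inter>q\<in>V. \<O>Y q) = (\<Inter>p\<in>preim X f V. \<O>X p)" if V: "openin (space_of Y) V" for V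
  proof -
    have "(\<Inter>q\<in>V. \<O>Y q) = (\<Inter>q\<in>\<phi> ` preim X f V. \<O>Y q)" using img[OF V] by simp
    then show ?thesis using loc by (auto simp: pre)
  qed
  have f_sec: "snd f V (secY V x) = secX (preim X f V) x"
    if V: "openin (space_of Y) V" and x: "x \<in> (\<Inter>q\<in>V. \<O>Y q)" for V x
  proof (cases "V = {}")
    case True
    then have "preim X f V = {}" by (auto simp: pre)
    then show ?thesis using True X.sec_empty unfolding f_def by auto
  next
    case False
    have "(SOME y. y \<in> (\<Inter>q\<in>V. \<O>Y q) \<and> secY V x = secY V y) = x"
    proof (rule some_equality)
      show "x \<in> (\<Inter>q\<in>V. \<O>Y q) \<and> secY V x = secY V x" using x by simp
    qed (use Y.sec_inj[OF V False] x in blast)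
    then show ?thesis unfolding pre unfolding f_def snd_conv by (rule arg_cong)
  qed
  have ne: "preim X f V \<noteq> {}" if "openin (space_of Y) V" "V \<noteq> {}" for V
    using img[OF that(1)] that(2) by (metis image_empty)
  have add_closed: "x + y \<in> (\<Inter>q\<in>V. \<O>Y q)" and mult_closed: "x * y \<in> (\<Inter>q\<in>V. \<O>Y q)"
    if "openin (space_of Y) V" "x \<in> (\<Inter>q\<in>V. \<O>Y q)" "y \<in> (\<Inter>q\<in>V. \<O>Y q)" for x y V
    using that(2,3) openin_subset[OF that(1)] by (auto intro!: Y.\<O>_add Y.\<O>_mult)
  have one_in: "1 \<in> (\<Inter>q\<in>V. \<O>Y q)" if "openin (space_of Y) V" for V
    using openin_subset[OF that] by (auto intro!: Y.\<O>_one)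
  have hom: "snd f V \<in> ring_hom (sheaf Y V) (sheaf X (preim X f V))" if V: "openin (space_of Y) V" for V
  proof (rule ring_hom_memI)
    fix s assume "s \<in> carrier (sheaf Y V)"
    then obtain x where x: "s = secY V x" "x \<in> (\<Inter>q\<in>V. \<O>Y q)" using Y.carrier_sheaf[OF V] by blast
    show "snd f V s \<in> carrier (sheaf X (preim X f V))"
      unfolding x(1) f_sec[OF V x(2)] X.carrier_sheaf[OF preop[OF V]] \<Gamma>[OF V, symmetric]
      using x(2) by (rule imageI)
    fix t assume "t \<in> carrier (sheaf Y V)"
    then obtain y where y: "t = secY V y" "y \<in> (\<Inter>q\<in>V. \<O>Y q)" using Y.carrier_sheaf[OF V] by blast
    have xy: "x \<in> (\<Inter>p\<in>preim X f V. \<O>X p)" "y \<in> (\<Inter>p\<in>preim X f V. \<O>X p)" using x y \<Gamma>[OF V] by auto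
    have "snd f V (s \<otimes>\<^bsub>sheaf Y V\<^esub> t) = secX (preim X f V) (x * y)"
      unfolding x(1) y(1) Y.sec_mult[OF V x(2) y(2)] using f_sec[OF V mult_closed[OF V x(2) y(2)]] .
    then show "snd f V (s \<otimes>\<^bsub>sheaf Y V\<^esub> t) = snd f V s \<otimes>\<^bsub>sheaf X (preim X f V)\<^esub> snd f V t"
      unfolding x(1) y(1) f_sec[OF V x(2)] f_sec[OF V y(2)] X.sec_mult[OF preop[OF V] xy] .
    have "snd f V (s \<oplus>\<^bsub>sheaf Y V\<^esub> t) = secX (preim X f V) (x + y)"
      unfolding x(1) y(1) Y.sec_add[OF V x(2) y(2)] using f_sec[OF V add_closed[OF V x(2) y(2)]] .
    then show "snd f V (s \<oplus>\<^bsub>sheaf Y V\<^esub> t) = snd f V s \<oplus>\<^bsub>sheaf X (preim X f V)\<^esub> snd f V t"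
      unfolding x(1) y(1) f_sec[OF V x(2)] f_sec[OF V y(2)] X.sec_add[OF preop[OF V] xy] .
  next
    show "snd f V \<one>\<^bsub>sheaf Y V\<^esub> = \<one>\<^bsub>sheaf X (preim X f V)\<^esub>"
      unfolding Y.sec_one[OF V] X.sec_one[OF preop[OF V]] using f_sec[OF V one_in[OF V]] .
  qed
  have bij: "bij_betw (snd f V) (carrier (sheaf Y V)) (carrier (sheaf X (preim X f V)))"
    if V: "openin (space_of Y) V" for V
    unfolding bij_betw_def
  proof
    show "inj_on (snd f V) (carrier (sheaf Y V))"
    proof (cases "V = {}")
      case True
      have eq: "s = t" if st: "s \<in> carrier (sheaf Y V)" "t \<in> carrier (sheaf Y V)" for s t
      proof -
        obtain x where "s = secY V x" using st(1) unfolding Y.carrier_sheaf[OF V] by (rule imageE)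
        moreover obtain y where "t = secY V y" using st(2) unfolding Y.carrier_sheaf[OF V] by (rule imageE)
        ultimately show ?thesis using Y.sec_empty[of x y] True by simp
      qed
      show ?thesis by (rule inj_onI) (rule eq)
    next
      case False
      show ?thesis
      proof (rule inj_onI)
        fix s t assume st: "s \<in> carrier (sheaf Y V)" "t \<in> carrier (sheaf Y V)" "snd f V s = snd f V t"
        obtain x where x: "s = secY V x" "x \<in> (\<Inter>q\<in>V. \<O>Y q)"
          using st(1) unfolding Y.carrier_sheaf[OF V] by (rule imageE)
        obtain y where y: "t = secY V y" "y \<in> (\<Inter>q\<in>V. \<O>Y q)"
          using st(2) unfolding Y.carrier_sheaf[OF V] by (rule imageE)
        have xy: "x \<in> (\<Inter>p\<in>preim X f V. \<O>X p)" "y \<in> (\<Inter>p\<in>preim X f V. \<O>X p)" using x y \<Gamma>[OF V] by auto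
        have "secX (preim X f V) x = secX (preim X f V) y" using st x y f_sec[OF V] by simp
        then have "x = y" using X.sec_inj[OF preop[OF V] ne[OF V False] xy] by blast
        then show "s = t" using x y by simp
      qed
    qed
    have "snd f V ` carrier (sheaf Y V) = secX (preim X f V) ` (\<Inter>q\<in>V. \<O>Y q)"
      unfolding Y.carrier_sheaf[OF V] image_image by (rule image_cong[OF refl]) (rule f_sec[OF V])
    then show "snd f V ` carrier (sheaf Y V) = carrier (sheaf X (preim X f V))"
      unfolding X.carrier_sheaf[OF preop[OF V]] \<Gamma>[OF V] .
  qed
  have rsm: "ringed_space_morphism X Y f"
    unfolding ringed_space_morphism_def
  proof (intro conjI allI impI ballI)
    show "continuous_map (space_of X) (space_of Y) (fst f)" using cont unfolding f_def by simp
  next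
    fix V W s assume V: "openin (space_of Y) V" and W: "openin (space_of Y) W" "W \<subseteq> V" and "s \<in> carrier (sheaf Y V)"
    then obtain x where x: "s = secY V x" "x \<in> (\<Inter>q\<in>V. \<O>Y q)" using Y.carrier_sheaf[OF V] by blast
    have x': "x \<in> (\<Inter>q\<in>W. \<O>Y q)" using x W by auto
    have "preim X f W \<subseteq> preim X f V" using W by (auto simp: pre)
    then have r: "restr X (preim X f V) (preim X f W) (secX (preim X f V) x) = secX (preim X f W) x"
      using X.restr_sec[OF preop[OF V] preop[OF W(1)]] x(2) \<Gamma>[OF V] by blast
    show "snd f W (restr Y V W s) = restr X (preim X f V) (preim X f W) (snd f V s)"
      unfolding x(1) Y.restr_sec[OF V W x(2)] f_sec[OF V x(2)] f_sec[OF W(1) x'] r ..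
  qed (rule hom)
  have "local_morphism X Y f"
    unfolding local_morphism_def
  proof (intro conjI ballI impI rsm)
    fix p g assume p: "p \<in> points X" and g: "g \<in> carrier (stalk Y (fst f p))" "g \<notin> Units (stalk Y (fst f p))"
    have q: "fst f p = \<phi> p" "\<phi> p \<in> points Y" using p surj unfolding f_def by auto
    then obtain x where x: "g = Y.germ_set (\<phi> p) x" "x \<in> \<O>Y (\<phi> p)" using g Y.carrier_stalk by auto
    have x': "x \<in> \<O>X p" using x loc[OF p] by simp
    have *: "germ X p (preim X f V) (snd f V s) = X.germ_set p x" if "(V, s) \<in> g" for V s
    proof -
      have V: "s = secY V x" "openin (space_of Y) V" "\<phi> p \<in> V" "x \<in> (\<Inter>q\<in>V. \<O>Y q)"
        using that x(1) unfolding Y.germ_set_def by auto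
      have "p \<in> preim X f V" using V p by (auto simp: pre)
      then show ?thesis unfolding V(1) f_sec[OF V(2,4)]
        using X.germ_sec[OF preop[OF V(2)], of p x] V(4) \<Gamma>[OF V(2)] by simp
    qed
    have "stalk_map X f p g = (\<Union>(V, s)\<in>g. X.germ_set p x)"
      unfolding stalk_map_def using * by (intro SUP_cong refl) auto
    also have "\<dots> = X.germ_set p x" using Y.germ_set_nonempty[OF q(2) x(2)] x(1) by auto
    finally have "stalk_map X f p g = X.germ_set p x" .
    then show "stalk_map X f p g \<notin> Units (stalk X p)"
      using g x q Y.germ_set_in_Units[OF q(2) x(2)] X.germ_set_in_Units[OF p x'] loc[OF p] by simp
  qed
  then have "lrs_isomorphism X Y f"
    unfolding lrs_isomorphism_def ring_iso_def using homeo hom bij by (auto simp: f_def)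
  then show ?thesis by blast
qed

lemma (in cring) primeideal_mult_iff:
  assumes "primeideal p R" "a \<in> carrier R" "b \<in> carrier R"
  shows "a \<otimes> b \<in> p \<longleftrightarrow> a \<in> p \<or> b \<in> p"
proof -
  interpret primeideal p R by fact
  show ?thesis using I_prime I_l_closed I_r_closed assms(2,3) by blast
qed

lemma (in cring) primeideal_one_notin:
  assumes "primeideal p R" shows "\<one> \<notin> p"
proof -
  interpret primeideal p R by fact
  show ?thesis using one_imp_carrier I_notcarr by auto
qed

locale fraction_space =
  fixes A :: "('a, 'm) ring_scheme" (structure) and \<G> :: "'a set set" and P :: "'a set set"
    and \<iota> :: "'a \<Rightarrow> 'f::field"
  assumes cring_A: "cring A"
    and \<iota>_mult: "a \<in> carrier A \<Longrightarrow> b \<in> carrier A \<Longrightarrow> \<iota> (a \<otimes> b) = \<iota> a * \<iota> b"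
    and \<iota>_add: "a \<in> carrier A \<Longrightarrow> b \<in> carrier A \<Longrightarrow> \<iota> (a \<oplus> b) = \<iota> a + \<iota> b"
    and \<iota>_one: "\<iota> \<one> = 1"
    and \<iota>_inj: "inj_on \<iota> (carrier A)"
    and piece_carrier: "G \<in> \<G> \<Longrightarrow> G \<subseteq> carrier A"
    and piece_mult: "G \<in> \<G> \<Longrightarrow> H \<in> \<G> \<Longrightarrow> \<exists>J\<in>\<G>. \<forall>a\<in>G. \<forall>b\<in>H. a \<otimes> b \<in> J"
    and piece_add: "G \<in> \<G> \<Longrightarrow> a \<in> G \<Longrightarrow> b \<in> G \<Longrightarrow> a \<oplus> b \<in> G"
    and piece_one: "\<exists>G\<in>\<G>. \<one> \<in> G \<and> \<zero> \<in> G"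
    and prime: "p \<in> P \<Longrightarrow> primeideal p A"
    and generic: "{\<zero>} \<in> P"
begin

sublocale cring A by (rule cring_A)

definition fr :: "'a set \<Rightarrow> 'f \<Rightarrow> ('a \<times> 'a) set" where
  "fr p x = {(a, b) \<in> fractions \<G> p. \<iota> a = x * \<iota> b}"

definition locring :: "'a set \<Rightarrow> 'f set" where
  "locring p = {x. fr p x \<noteq> {}}"

definition sec :: "'a set set \<Rightarrow> 'f \<Rightarrow> 'a set \<Rightarrow> ('a \<times> 'a) set" where
  "sec U x = (\<lambda>p\<in>U. fr p x)"

lemma \<iota>_zero: "\<iota> \<zero> = 0"
proof -
  have "\<iota> \<zero> + \<iota> \<zero> = \<iota> \<zero> + 0" using \<iota>_add[OF zero_closed zero_closed] by simp
  then show ?thesis by (rule add_left_imp_eq)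
qed

lemma \<iota>_uminus: "a \<in> carrier A \<Longrightarrow> \<iota> (\<ominus> a) = - \<iota> a"
  using \<iota>_add[of a "\<ominus> a"] \<iota>_zero by (simp add: r_neg eq_neg_iff_add_eq_0 add.commute)

lemma \<iota>_eq_0_iff: "a \<in> carrier A \<Longrightarrow> \<iota> a = 0 \<longleftrightarrow> a = \<zero>"
  using \<iota>_zero \<iota>_inj by (metis inj_on_eq_iff zero_closed)

lemma homogeneous_mult: "a \<in> \<Union>\<G> \<Longrightarrow> b \<in> \<Union>\<G> \<Longrightarrow> a \<otimes> b \<in> \<Union>\<G>"
  using piece_mult by (meson UnionE UnionI)

lemma istop: "istopology (\<lambda>U. \<exists>E\<subseteq>\<Union>\<G>. U = {p \<in> P. \<not> E \<subseteq> p})"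
  by (rule istopology_zariski[of P A]) (use prime piece_carrier homogeneous_mult in auto)

lemma openin_zariski: "openin (zariski \<G> P) U \<longleftrightarrow> (\<exists>E\<subseteq>\<Union>\<G>. U = {p \<in> P. \<not> E \<subseteq> p})"
  unfolding zariski_def topology_inverse'[OF istop] ..

lemma openin_basic: "b \<in> \<Union>\<G> \<Longrightarrow> openin (zariski \<G> P) {p \<in> P. b \<notin> p}"
  unfolding openin_zariski by (intro exI[of _ "{b}"]) auto

lemma topspace_zariski: "topspace (zariski \<G> P) = P"
proof (rule antisym)
  show "topspace (zariski \<G> P) \<subseteq> P"
    using openin_topspace[of "zariski \<G> P"] unfolding openin_zariski by auto
  have "openin (zariski \<G> P) {p \<in> P. \<one> \<notin> p}" using piece_one by (intro openin_basic) auto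
  moreover have "{p \<in> P. \<one> \<notin> p} = P" using primeideal_one_notin prime by auto
  ultimately show "P \<subseteq> topspace (zariski \<G> P)" using openin_subset by metis
qed

lemma open_subset: "openin (zariski \<G> P) U \<Longrightarrow> U \<subseteq> P"
  using openin_subset topspace_zariski by blast

lemma generic_in_open:
  assumes "openin (zariski \<G> P) U" "U \<noteq> {}"
  shows "{\<zero>} \<in> U"
proof -
  obtain E where E: "U = {p \<in> P. \<not> E \<subseteq> p}" using assms openin_zariski by auto
  obtain p where p: "p \<in> P" "\<not> E \<subseteq> p" using E assms by auto
  interpret p: primeideal p A by (rule prime[OF p(1)])
  have "\<not> E \<subseteq> {\<zero>}" using p p.zero_closed by auto
  then show ?thesis using E generic by auto
qed

lemma fractionsD:
  assumes "p \<in> P" "(a, b) \<in> fractions \<G> p"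
  shows "a \<in> carrier A" "b \<in> carrier A" "b \<notin> p" "\<iota> b \<noteq> 0" "b \<in> \<Union>\<G>"
proof -
  interpret p: primeideal p A by (rule prime[OF assms(1)])
  obtain G where G: "G \<in> \<G>" "a \<in> G" "b \<in> G" "b \<notin> p" using assms unfolding fractions_def by auto
  then show *: "a \<in> carrier A" "b \<in> carrier A" "b \<notin> p" "b \<in> \<Union>\<G>" using piece_carrier by auto
  then have "b \<noteq> \<zero>" using p.zero_closed by auto
  then show "\<iota> b \<noteq> 0" using * \<iota>_eq_0_iff by auto
qed

lemma loc_frac_eq:
  assumes p: "p \<in> P" and ab: "(a, b) \<in> fractions \<G> p"
  shows "loc_frac A \<G> p a b = fr p (\<iota> a / \<iota> b)"
proof -
  note ab' = fractionsD[OF p ab]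
  interpret p: primeideal p A by (rule prime[OF p])
  have "(\<exists>u\<in>\<Union>\<G> - p. u \<otimes> (a \<otimes> e) = u \<otimes> (c \<otimes> b)) \<longleftrightarrow> \<iota> c = \<iota> a / \<iota> b * \<iota> e"
    if "(c, e) \<in> fractions \<G> p" for c e
  proof -
    note ce = fractionsD[OF p that]
    have *: "\<iota> c = \<iota> a / \<iota> b * \<iota> e \<longleftrightarrow> \<iota> a * \<iota> e = \<iota> c * \<iota> b"
      using ab' by (auto simp: field_simps)
    show ?thesis unfolding *
    proof
      assume "\<exists>u\<in>\<Union>\<G> - p. u \<otimes> (a \<otimes> e) = u \<otimes> (c \<otimes> b)"
      then obtain u where u: "u \<in> \<Union>\<G>" "u \<notin> p" "u \<otimes> (a \<otimes> e) = u \<otimes> (c \<otimes> b)" by auto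
      have uc: "u \<in> carrier A" using u piece_carrier by auto
      have "u \<noteq> \<zero>" using u p.zero_closed by auto
      then have "\<iota> u \<noteq> 0" using \<iota>_eq_0_iff[OF uc] by simp
      moreover have "\<iota> u * (\<iota> a * \<iota> e) = \<iota> u * (\<iota> c * \<iota> b)"
        using arg_cong[OF u(3), of \<iota>] uc ab' ce by (simp add: \<iota>_mult)
      ultimately show "\<iota> a * \<iota> e = \<iota> c * \<iota> b" by simp
    next
      assume "\<iota> a * \<iota> e = \<iota> c * \<iota> b"
      then have "\<iota> (a \<otimes> e) = \<iota> (c \<otimes> b)" using ab' ce by (simp add: \<iota>_mult)
      then have "a \<otimes> e = c \<otimes> b" using ab' ce \<iota>_inj by (meson inj_onD m_closed)
      then show "\<exists>u\<in>\<Union>\<G> - p. u \<otimes> (a \<otimes> e) = u \<otimes> (c \<otimes> b)" using ab' by auto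
    qed
  qed
  then show ?thesis unfolding loc_frac_def fr_def by auto
qed

lemma fr_inj: "p \<in> P \<Longrightarrow> x \<in> locring p \<Longrightarrow> fr p x = fr p y \<Longrightarrow> x = y"
proof -
  assume p: "p \<in> P" and x: "x \<in> locring p" and eq: "fr p x = fr p y"
  then obtain a b where "(a, b) \<in> fr p x" unfolding locring_def by auto
  then have "(a, b) \<in> fr p x" "(a, b) \<in> fr p y" using eq by auto
  then show "x = y" using fractionsD(4)[OF p, of a b] unfolding fr_def by auto
qed

lemma locring_iff:
  assumes p: "p \<in> P"
  shows "x \<in> locring p \<longleftrightarrow> (\<exists>a b. (a, b) \<in> fractions \<G> p \<and> x = \<iota> a / \<iota> b)"
proof
  assume "x \<in> locring p"
  then obtain a b where "(a, b) \<in> fractions \<G> p" "\<iota> a = x * \<iota> b" unfolding locring_def fr_def by auto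
  then show "\<exists>a b. (a, b) \<in> fractions \<G> p \<and> x = \<iota> a / \<iota> b" using fractionsD(4)[OF p] by fastforce
next
  assume "\<exists>a b. (a, b) \<in> fractions \<G> p \<and> x = \<iota> a / \<iota> b"
  then obtain a b where ab: "(a, b) \<in> fractions \<G> p" "x = \<iota> a / \<iota> b" by auto
  then have "(a, b) \<in> fr p x" using fractionsD(4)[OF p] unfolding fr_def by auto
  then show "x \<in> locring p" unfolding locring_def by auto
qed

lemma fractions_mult:
  assumes p: "p \<in> P" and ab: "(a, b) \<in> fractions \<G> p" and ce: "(c, e) \<in> fractions \<G> p"
  shows "(a \<otimes> c, b \<otimes> e) \<in> fractions \<G> p" "(a \<otimes> e \<oplus> c \<otimes> b, b \<otimes> e) \<in> fractions \<G> p"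
proof -
  note [simp] = fractionsD[OF p ab] fractionsD[OF p ce]
  obtain G where G: "G \<in> \<G>" "a \<in> G" "b \<in> G" using ab unfolding fractions_def by auto
  obtain H where H: "H \<in> \<G>" "c \<in> H" "e \<in> H" using ce unfolding fractions_def by auto
  obtain J where J: "J \<in> \<G>" "\<forall>x\<in>G. \<forall>y\<in>H. x \<otimes> y \<in> J" using piece_mult G H by blast
  have np: "b \<otimes> e \<notin> p" using primeideal_mult_iff[OF prime[OF p]] by simp
  show "(a \<otimes> c, b \<otimes> e) \<in> fractions \<G> p" using G H J np unfolding fractions_def by auto
  have "c \<otimes> b = b \<otimes> c" by (simp add: m_comm)
  then have "a \<otimes> e \<oplus> c \<otimes> b \<in> J" using G H J piece_add by simp
  then show "(a \<otimes> e \<oplus> c \<otimes> b, b \<otimes> e) \<in> fractions \<G> p" using G H J np unfolding fractions_def by auto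
qed

lemma fr_ops:
  assumes p: "p \<in> P" and x: "x \<in> locring p" and y: "y \<in> locring p"
  shows "fr p x \<otimes>\<^bsub>local_ring A \<G> p\<^esub> fr p y = fr p (x * y)"
    and "fr p x \<oplus>\<^bsub>local_ring A \<G> p\<^esub> fr p y = fr p (x + y)"
    and "x * y \<in> locring p" and "x + y \<in> locring p"
proof -
  have ne: "fr p x \<noteq> {}" "fr p y \<noteq> {}" using x y unfolding locring_def by auto
  have m: "loc_frac A \<G> p (a \<otimes> c) (b \<otimes> e) = fr p (x * y) \<and> x * y \<in> locring p"
      "loc_frac A \<G> p (a \<otimes> e \<oplus> c \<otimes> b) (b \<otimes> e) = fr p (x + y) \<and> x + y \<in> locring p"
    if ab: "(a, b) \<in> fr p x" and ce: "(c, e) \<in> fr p y" for a b c e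
  proof -
    have ab: "(a, b) \<in> fractions \<G> p" "\<iota> a = x * \<iota> b" and ce: "(c, e) \<in> fractions \<G> p" "\<iota> c = y * \<iota> e"
      using ab ce unfolding fr_def by auto
    note F = fractionsD[OF p ab(1)] fractionsD[OF p ce(1)]
    note M = fractions_mult[OF p ab(1) ce(1)]
    have 1: "x * y = \<iota> (a \<otimes> c) / \<iota> (b \<otimes> e)" using F ab ce by (simp add: \<iota>_mult)
    have 2: "x + y = \<iota> (a \<otimes> e \<oplus> c \<otimes> b) / \<iota> (b \<otimes> e)" using F ab ce by (simp add: \<iota>_mult \<iota>_add field_simps)
    show "loc_frac A \<G> p (a \<otimes> c) (b \<otimes> e) = fr p (x * y) \<and> x * y \<in> locring p"
      unfolding locring_iff[OF p] 1 using loc_frac_eq[OF p M(1)] M(1) by blast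
    show "loc_frac A \<G> p (a \<otimes> e \<oplus> c \<otimes> b) (b \<otimes> e) = fr p (x + y) \<and> x + y \<in> locring p"
      unfolding locring_iff[OF p] 2 using loc_frac_eq[OF p M(2)] M(2) by blast
  qed
  have "fr p x \<otimes>\<^bsub>local_ring A \<G> p\<^esub> fr p y = (\<Union>(a, b)\<in>fr p x. \<Union>(c, e)\<in>fr p y. fr p (x * y))"
    unfolding local_ring_def monoid.simps using m by (intro SUP_cong refl) auto
  then show "fr p x \<otimes>\<^bsub>local_ring A \<G> p\<^esub> fr p y = fr p (x * y)" using ne by auto
  have "fr p x \<oplus>\<^bsub>local_ring A \<G> p\<^esub> fr p y = (\<Union>(a, b)\<in>fr p x. \<Union>(c, e)\<in>fr p y. fr p (x + y))"
    unfolding local_ring_def ring_record_simps using m by (intro SUP_cong refl) auto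
  then show "fr p x \<oplus>\<^bsub>local_ring A \<G> p\<^esub> fr p y = fr p (x + y)" using ne by auto
  obtain a b c e where "(a, b) \<in> fr p x" "(c, e) \<in> fr p y" using ne by auto
  then show "x * y \<in> locring p" "x + y \<in> locring p" using m by blast+
qed

lemma fractions_one:
  assumes p: "p \<in> P"
  shows "(\<one>, \<one>) \<in> fractions \<G> p" "(\<zero>, \<one>) \<in> fractions \<G> p"
  using piece_one primeideal_one_notin[OF prime[OF p]] unfolding fractions_def by auto

lemma local_ring_one: "p \<in> P \<Longrightarrow> \<one>\<^bsub>local_ring A \<G> p\<^esub> = fr p 1"
  and local_ring_zero: "p \<in> P \<Longrightarrow> \<zero>\<^bsub>local_ring A \<G> p\<^esub> = fr p 0"
  using loc_frac_eq fractions_one unfolding local_ring_def by (simp_all add: \<iota>_one \<iota>_zero)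

lemma locring_one: "p \<in> P \<Longrightarrow> 1 \<in> locring p"
  and locring_zero: "p \<in> P \<Longrightarrow> 0 \<in> locring p"
  unfolding locring_iff using fractions_one by (fastforce simp: \<iota>_one \<iota>_zero)+

lemma locring_spread:
  assumes p: "p \<in> P" and x: "x \<in> locring p"
  obtains a b W where "x = \<iota> a / \<iota> b" "openin (zariski \<G> P) W" "p \<in> W"
    "\<And>q. q \<in> W \<Longrightarrow> (a, b) \<in> fractions \<G> q"
proof -
  obtain a b where ab: "(a, b) \<in> fractions \<G> p" "x = \<iota> a / \<iota> b" using x locring_iff[OF p] by auto
  note F = fractionsD[OF p ab(1)]
  show ?thesis
  proof (rule that[OF ab(2) openin_basic[OF F(5)]])
    show "p \<in> {q \<in> P. b \<notin> q}" using p F by auto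
    show "(a, b) \<in> fractions \<G> q" if "q \<in> {q \<in> P. b \<notin> q}" for q
      using that ab unfolding fractions_def by auto
  qed
qed

lemma regular_sections_eq:
  assumes U: "openin (zariski \<G> P) U"
  shows "regular_sections A \<G> P U = sec U ` (\<Inter>p\<in>U. locring p)"
proof (intro subset_antisym subsetI)
  fix s assume "s \<in> sec U ` (\<Inter>p\<in>U. locring p)"
  then obtain x where x: "s = sec U x" "x \<in> (\<Inter>p\<in>U. locring p)" by auto
  have "\<exists>W a b. openin (zariski \<G> P) W \<and> p \<in> W \<and> W \<subseteq> U \<and>
     (\<forall>q\<in>W. (a, b) \<in> fractions \<G> q \<and> s q = loc_frac A \<G> q a b)" if p: "p \<in> U" for p
  proof -
    have "p \<in> P" "x \<in> locring p" using open_subset[OF U] p x by auto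
    then obtain a b W where W: "x = \<iota> a / \<iota> b" "openin (zariski \<G> P) W" "p \<in> W"
       "\<And>q. q \<in> W \<Longrightarrow> (a, b) \<in> fractions \<G> q" using locring_spread by metis
    have "openin (zariski \<G> P) (W \<inter> U)" using W U by auto
    moreover have "s q = loc_frac A \<G> q a b" if "q \<in> W \<inter> U" for q
      using loc_frac_eq[of q a b] W that open_subset[OF U] x(1) unfolding sec_def by auto
    ultimately show ?thesis using W p by (intro exI[of _ "W \<inter> U"] exI[of _ a] exI[of _ b]) auto
  qed
  moreover have "s \<in> extensional U" unfolding x sec_def by simp
  ultimately show "s \<in> regular_sections A \<G> P U" unfolding regular_sections_def by blast
next
  fix s assume "s \<in> regular_sections A \<G> P U"
  then have s: "s \<in> extensional U" and loc: "\<And>p. p \<in> U \<Longrightarrow> \<exists>W a b. openin (zariski \<G> P) W \<and> p \<in> W \<and> W \<subseteq> U \<and>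
     (\<forall>q\<in>W. (a, b) \<in> fractions \<G> q \<and> s q = loc_frac A \<G> q a b)"
    unfolding regular_sections_def by auto
  show "s \<in> sec U ` (\<Inter>p\<in>U. locring p)"
  proof (cases "U = {}")
    case True
    then have "s = sec U 0" using s unfolding sec_def by auto
    then show ?thesis using True by auto
  next
    case False
    have g: "{\<zero>} \<in> U" using generic_in_open[OF U False] .
    have fr: "\<exists>x. x \<in> locring p \<and> s p = fr p x \<and> x \<in> locring {\<zero>} \<and> s {\<zero>} = fr {\<zero>} x" if p: "p \<in> U" for p
    proof -
      obtain W a b where W: "openin (zariski \<G> P) W" "p \<in> W" "W \<subseteq> U"
        and ab: "\<And>q. q \<in> W \<Longrightarrow> (a, b) \<in> fractions \<G> q \<and> s q = loc_frac A \<G> q a b"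
        using loc[OF p] by blast
      have "{\<zero>} \<in> W" using generic_in_open[OF W(1)] W(2) by auto
      have "\<iota> a / \<iota> b \<in> locring q \<and> s q = fr q (\<iota> a / \<iota> b)" if "q \<in> W" for q
        using ab[OF that] loc_frac_eq[of q a b] locring_iff[of q] that open_subset[OF W(1)] by auto
      then show ?thesis using W(2) \<open>{\<zero>} \<in> W\<close> by blast
    qed
    obtain x where x: "x \<in> locring {\<zero>}" "s {\<zero>} = fr {\<zero>} x" using fr[OF g] by auto
    have *: "x \<in> locring p \<and> s p = fr p x" if pU: "p \<in> U" for p
    proof -
      obtain y where y: "y \<in> locring p" "s p = fr p y" "y \<in> locring {\<zero>}" "s {\<zero>} = fr {\<zero>} y"
        using fr[OF pU] by auto
      have "x = y" using fr_inj[OF generic x(1), of y] x y by simp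
      then show ?thesis using y by simp
    qed
    then have "s = sec U x" using s unfolding sec_def by (auto intro!: extensionalityI[of s U])
    then show ?thesis using * by auto
  qed
qed

sublocale rational_space "prime_space A \<G> P" locring sec
proof (unfold_locales, goal_cases)
  case (1 U)
  then show ?case using regular_sections_eq by (simp add: prime_space_def)
next
  case (2 U x y)
  then have *: "p \<in> P" "x \<in> locring p" "y \<in> locring p" if "p \<in> U" for p
    using that open_subset[of U] by (auto simp: prime_space_def)
  show ?case by (auto simp: prime_space_def sec_def fun_eq_iff fr_ops * restrict_def)
next
  case (3 U x y)
  then have *: "p \<in> P" "x \<in> locring p" "y \<in> locring p" if "p \<in> U" for p
    using that open_subset[of U] by (auto simp: prime_space_def)
  show ?case by (auto simp: prime_space_def sec_def fun_eq_iff fr_ops * restrict_def)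
next
  case (4 U)
  then have "p \<in> P" if "p \<in> U" for p using that open_subset[of U] by (auto simp: prime_space_def)
  then show ?case by (auto simp: prime_space_def sec_def fun_eq_iff restrict_def local_ring_one)
next
  case (5 U)
  then have "p \<in> P" if "p \<in> U" for p using that open_subset[of U] by (auto simp: prime_space_def)
  then show ?case by (auto simp: prime_space_def sec_def fun_eq_iff restrict_def local_ring_zero)
next
  case (6 U V x)
  then show ?case by (auto simp: prime_space_def sec_def fun_eq_iff restrict_def)
next
  case (7 U x y)
  then obtain p where p: "p \<in> U" by auto
  then have "p \<in> P" "x \<in> locring p" using 7 open_subset[of U] by (auto simp: prime_space_def)
  moreover have "fr p x = fr p y" using fun_cong[OF 7(5), of p] p unfolding sec_def by simp
  ultimately show ?case using fr_inj by blast
next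
  case 8 then show ?case by (simp add: sec_def restrict_def)
next
  case (13 p x)
  then have "p \<in> P" using topspace_zariski by (simp add: prime_space_def)
  then obtain a b W where W: "x = \<iota> a / \<iota> b" "openin (zariski \<G> P) W" "p \<in> W"
       "\<And>q. q \<in> W \<Longrightarrow> (a, b) \<in> fractions \<G> q" using locring_spread 13 by metis
  have "x \<in> locring q" if "q \<in> W" for q
    using locring_iff[of q] open_subset[OF W(2)] W(1) W(4)[OF that] that by auto
  then show ?case using W(2,3) by (intro exI[of _ W]) (auto simp: prime_space_def)
qed (auto simp: prime_space_def topspace_zariski locring_one locring_zero fr_ops)

end

section \<open>Subrings of a field and their primes\<close>

definition field_subring :: "'f::field set \<Rightarrow> bool" where
  "field_subring R \<longleftrightarrow> 0 \<in> R \<and> 1 \<in> R \<and> (\<forall>x\<in>R. - x \<in> R) \<and>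
     (\<forall>x\<in>R. \<forall>y\<in>R. x + y \<in> R \<and> x * y \<in> R)"

lemma field_subringD:
  assumes "field_subring R"
  shows "0 \<in> R" "1 \<in> R" "x \<in> R \<Longrightarrow> - x \<in> R" "x \<in> R \<Longrightarrow> y \<in> R \<Longrightarrow> x + y \<in> R"
    "x \<in> R \<Longrightarrow> y \<in> R \<Longrightarrow> x * y \<in> R"
  using assms unfolding field_subring_def by auto

definition ideal_in :: "'f::field set \<Rightarrow> 'f set \<Rightarrow> bool" where
  "ideal_in R q \<longleftrightarrow> q \<subseteq> R \<and> 0 \<in> q \<and> (\<forall>x\<in>q. \<forall>y\<in>q. x + y \<in> q) \<and> (\<forall>x\<in>q. \<forall>y\<in>R. x * y \<in> q)"

definition prime_in :: "'f::field set \<Rightarrow> 'f set \<Rightarrow> bool" where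
  "prime_in R q \<longleftrightarrow> ideal_in R q \<and> 1 \<notin> q \<and> (\<forall>x\<in>R. \<forall>y\<in>R. x * y \<in> q \<longrightarrow> x \<in> q \<or> y \<in> q)"

lemma ideal_inD:
  assumes "ideal_in R q"
  shows "q \<subseteq> R" "0 \<in> q" "x \<in> q \<Longrightarrow> y \<in> q \<Longrightarrow> x + y \<in> q" "x \<in> q \<Longrightarrow> y \<in> R \<Longrightarrow> x * y \<in> q"
    "x \<in> q \<Longrightarrow> y \<in> R \<Longrightarrow> y * x \<in> q"
  using assms unfolding ideal_in_def by (auto simp: mult.commute)

lemma ideal_in_sum: "ideal_in R q \<Longrightarrow> (\<And>i. i \<in> I \<Longrightarrow> f i \<in> q) \<Longrightarrow> sum f I \<in> q"
  by (induction I rule: infinite_finite_induct) (auto simp: ideal_inD)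

lemma ideal_in_uminus: "field_subring R \<Longrightarrow> ideal_in R q \<Longrightarrow> x \<in> q \<Longrightarrow> - x \<in> q"
  using ideal_inD(4)[of R q x "- 1"] field_subringD(2,3)[of R] by simp

lemma prime_in_extends:
  assumes R: "field_subring R" and J: "ideal_in R J" "1 \<notin> J"
  obtains q where "prime_in R q" "J \<subseteq> q"
proof -
  define \<A> where "\<A> = {q. ideal_in R q \<and> 1 \<notin> q \<and> J \<subseteq> q}"
  have "\<exists>M\<in>\<A>. \<forall>X\<in>\<A>. M \<subseteq> X \<longrightarrow> X = M"
  proof (rule subset_Zorn_nonempty)
    show "\<A> \<noteq> {}" using J unfolding \<A>_def by auto
    fix \<C> assume C: "\<C> \<noteq> {}" "subset.chain \<A> \<C>"
    then have CA: "\<And>q. q \<in> \<C> \<Longrightarrow> q \<in> \<A>" unfolding subset.chain_def by auto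
    have tot: "q \<subseteq> q' \<or> q' \<subseteq> q" if "q \<in> \<C>" "q' \<in> \<C>" for q q'
      using C that unfolding subset.chain_def by auto
    have "ideal_in R (\<Union>\<C>)"
      unfolding ideal_in_def
    proof (intro conjI ballI)
      show "\<Union>\<C> \<subseteq> R" using CA ideal_inD(1) unfolding \<A>_def by blast
      show "0 \<in> \<Union>\<C>" using C(1) CA ideal_inD(2) unfolding \<A>_def by blast
      show "x * y \<in> \<Union>\<C>" if "x \<in> \<Union>\<C>" "y \<in> R" for x y
        using that CA ideal_inD(4) unfolding \<A>_def by blast
      fix x y assume "x \<in> \<Union>\<C>" "y \<in> \<Union>\<C>"
      then obtain q q' where q: "q \<in> \<C>" "x \<in> q" "q' \<in> \<C>" "y \<in> q'" by blast
      then obtain r where r: "r \<in> \<C>" "x \<in> r" "y \<in> r" using tot[of q q'] by blast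
      then have "x + y \<in> r" using CA[of r] ideal_inD(3) unfolding \<A>_def by blast
      then show "x + y \<in> \<Union>\<C>" using r by blast
    qed
    moreover have "1 \<notin> \<Union>\<C>" "J \<subseteq> \<Union>\<C>" using CA C(1) unfolding \<A>_def by auto
    ultimately show "\<Union>\<C> \<in> \<A>" unfolding \<A>_def by auto
  qed
  then obtain q where qA: "q \<in> \<A>" and mx: "\<forall>X\<in>\<A>. q \<subseteq> X \<longrightarrow> X = q" by blast
  have q: "ideal_in R q" "1 \<notin> q" "J \<subseteq> q" using qA unfolding \<A>_def by auto
  have max: "X = q" if "ideal_in R X" "1 \<notin> X" "q \<subseteq> X" for X
    using mx that q(3) unfolding \<A>_def by auto
  note I = ideal_inD[OF q(1)] note S = field_subringD[OF R]
  have "x \<in> q \<or> y \<in> q" if xy: "x \<in> R" "y \<in> R" "x * y \<in> q" for x y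
  proof (rule ccontr)
    assume n: "\<not> (x \<in> q \<or> y \<in> q)"
    define X where "X = {a + x * r | a r. a \<in> q \<and> r \<in> R}"
    have "ideal_in R X"
      unfolding ideal_in_def
    proof (intro conjI ballI)
      show "X \<subseteq> R" unfolding X_def using S(4,5) I(1) xy(1) by (auto simp: subset_iff)
      show "0 \<in> X" unfolding X_def using S I by (intro CollectI exI[of _ 0]) auto
      fix u assume "u \<in> X"
      then obtain a r where u: "u = a + x * r" "a \<in> q" "r \<in> R" unfolding X_def by blast
      show "u * v \<in> X" if "v \<in> R" for v
      proof -
        have "u * v = a * v + x * (r * v)" using u by (simp add: algebra_simps)
        then show ?thesis unfolding X_def using u that I(4) S(5) by blast
      qed
      fix v assume "v \<in> X"
      then obtain a' r' where v: "v = a' + x * r'" "a' \<in> q" "r' \<in> R" unfolding X_def by blast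
      have "u + v = (a + a') + x * (r + r')" using u v by (simp add: algebra_simps)
      then show "u + v \<in> X" unfolding X_def using u v I(3) S(4) by blast
    qed
    moreover have "q \<subseteq> X"
    proof
      fix a assume "a \<in> q"
      then have "a = a + x * 0 \<and> a \<in> q \<and> 0 \<in> R" using S by simp
      then show "a \<in> X" unfolding X_def by blast
    qed
    moreover have "1 \<notin> X"
    proof
      assume "1 \<in> X"
      then obtain a r where ar: "1 = a + x * r" "a \<in> q" "r \<in> R" unfolding X_def by blast
      have "y = a * y + (x * y) * r" using arg_cong[OF ar(1), of "\<lambda>z. z * y"] by (simp add: algebra_simps)
      moreover have "a * y \<in> q" "(x * y) * r \<in> q" using I(4) ar xy by auto
      ultimately have "y \<in> q" using I(3) by metis
      then show False using n by simp
    qed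
    moreover have "x \<in> X"
    proof -
      have "x = 0 + x * 1 \<and> 0 \<in> q \<and> 1 \<in> R" using S I by simp
      then show ?thesis unfolding X_def by blast
    qed
    ultimately show False using max n by blast
  qed
  then have "prime_in R q" unfolding prime_in_def using q by blast
  then show ?thesis using that q(3) by blast
qed

locale subring_copy =
  fixes B :: "('b, 'm) ring_scheme" (structure) and R :: "'f::field set" and e :: "'f \<Rightarrow> 'b"
  assumes R: "field_subring R" and carrier_B: "carrier B = e ` R" and e_inj: "inj_on e R"
    and e_mult: "x \<in> R \<Longrightarrow> y \<in> R \<Longrightarrow> e x \<otimes> e y = e (x * y)"
    and e_add: "x \<in> R \<Longrightarrow> y \<in> R \<Longrightarrow> e x \<oplus> e y = e (x + y)"
    and e_one: "\<one> = e 1" and e_zero: "\<zero> = e 0"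
begin

lemmas Rs = field_subringD[OF R]

lemma cring_B: "cring B"
proof (rule cringI)
  show "abelian_group B"
  proof (rule abelian_groupI)
    fix x assume "x \<in> carrier B"
    then obtain a where a: "x = e a" "a \<in> R" using carrier_B by auto
    show "\<exists>y\<in>carrier B. y \<oplus> x = \<zero>"
      using a Rs e_add[of "- a" a] carrier_B e_zero by (intro bexI[of _ "e (- a)"]) auto
  qed (auto simp: carrier_B e_add e_zero Rs algebra_simps)
  show "Group.comm_monoid B"
    by (rule comm_monoidI) (auto simp: carrier_B e_mult e_one Rs algebra_simps)
qed (auto simp: carrier_B e_mult e_add Rs algebra_simps)

sublocale cring B by (rule cring_B)

lemma e_uminus: "x \<in> R \<Longrightarrow> \<ominus> (e x) = e (- x)"
  using e_add[of "- x" x] Rs(3)[of x] carrier_B e_zero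
  by (intro minus_equality) auto

lemma e_in: "q \<subseteq> R \<Longrightarrow> x \<in> R \<Longrightarrow> e x \<in> e ` q \<longleftrightarrow> x \<in> q"
  using e_inj by (auto dest: inj_onD)

lemma primeideal_image:
  assumes q: "prime_in R q" shows "primeideal (e ` q) B"
proof (rule primeidealI)
  have I: "ideal_in R q" using q unfolding prime_in_def by auto
  note Q = ideal_inD[OF I]
  show "ideal (e ` q) B"
  proof (rule idealI)
    show "ring B" by (rule ring_axioms)
    show "subgroup (e ` q) (add_monoid B)"
    proof (rule add.subgroupI)
      show "e ` q \<subseteq> carrier B" "e ` q \<noteq> {}" using Q carrier_B by auto
      show "\<ominus> a \<in> e ` q" if "a \<in> e ` q" for a
        using that Q(1) e_uminus ideal_in_uminus[OF R I] by (auto simp: subset_iff)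
      show "a \<oplus> b \<in> e ` q" if "a \<in> e ` q" "b \<in> e ` q" for a b
        using that Q(1,3) e_add by (auto simp: subset_iff)
    qed
    show "x \<otimes> a \<in> e ` q" "a \<otimes> x \<in> e ` q" if "a \<in> e ` q" "x \<in> carrier B" for a x
      using that Q(1,4,5) e_mult carrier_B by (auto simp: subset_iff)
  qed
  show "cring B" by (rule cring_B)
  have "e 1 \<notin> e ` q" using q Q(1) Rs e_in unfolding prime_in_def by auto
  then show "carrier B \<noteq> e ` q" using carrier_B Rs by auto
  show "a \<in> e ` q \<or> b \<in> e ` q" if ab: "a \<in> carrier B" "b \<in> carrier B" "a \<otimes> b \<in> e ` q" for a b
  proof -
    obtain x y where xy: "a = e x" "b = e y" "x \<in> R" "y \<in> R" using ab carrier_B by auto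
    then have "x * y \<in> q" using ab e_mult e_in[OF Q(1)] Rs by auto
    then show ?thesis using q xy unfolding prime_in_def by auto
  qed
qed

lemma primeideal_preimage:
  assumes Q: "primeideal Q B" 
  obtains q where "prime_in R q" "Q = e ` q"
proof -
  interpret Q: primeideal Q B by (rule Q)
  define q where "q = {x \<in> R. e x \<in> Q}"
  have sub: "Q \<subseteq> e ` R" using Q.a_subset carrier_B by auto
  have "prime_in R q"
    unfolding prime_in_def ideal_in_def
  proof (intro conjI ballI impI)
    show "q \<subseteq> R" unfolding q_def by auto
    show "0 \<in> q" unfolding q_def using Rs Q.zero_closed e_zero by auto
    show "1 \<notin> q" unfolding q_def using primeideal_one_notin[OF Q] e_one by auto
    show "x + y \<in> q" if "x \<in> q" "y \<in> q" for x y
      using that Q.a_closed[of "e x" "e y"] e_add Rs unfolding q_def by auto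
    show "x * y \<in> q" if "x \<in> q" "y \<in> R" for x y
      using that Q.I_r_closed[of "e x" "e y"] e_mult Rs carrier_B unfolding q_def by auto
    show "x \<in> q \<or> y \<in> q" if "x \<in> R" "y \<in> R" "x * y \<in> q" for x y
      using that primeideal_mult_iff[OF Q, of "e x" "e y"] e_mult carrier_B unfolding q_def by auto
  qed
  moreover have "Q = e ` q" using sub unfolding q_def by auto
  ultimately show ?thesis using that by blast
qed

lemma Spec_fraction_space:
  "fraction_space B {carrier B} {Q. primeideal Q B} (inv_into R e)"
proof -
  have inv: "inv_into R e (e x) = x" if "x \<in> R" for x using that e_inj by simp
  show ?thesis
  proof (rule fraction_space.intro, goal_cases)
    case 1 show ?case by (rule cring_B)
  next
    case 11
    have "prime_in R {0}" unfolding prime_in_def ideal_in_def using Rs by auto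
    then show ?case using primeideal_image[of "{0}"] e_zero by simp
  qed (use inv Rs in \<open>auto simp: carrier_B e_mult e_add e_one e_zero intro!: inj_on_inv_into\<close>)
qed

end

section \<open>Complements of linear forms in Proj of a graded domain\<close>

text \<open>A grading is encoded by the ring homomorphism \<open>\<eta> : s \<mapsto> \<Sum>\<^sub>k s\<^sub>k t\<^sup>k\<close> into polynomials over a field,
  whose value at \<open>t = 1\<close> is the embedding of the graded ring into that field.\<close>

locale graded_domain =
  fixes S :: "('a, 'm) ring_scheme" (structure) and gr :: "nat \<Rightarrow> 'a set" and \<eta> :: "'a \<Rightarrow> 'f::field poly"
  assumes cring_S: "cring S"
    and \<eta>_mult: "a \<in> carrier S \<Longrightarrow> b \<in> carrier S \<Longrightarrow> \<eta> (a \<otimes> b) = \<eta> a * \<eta> b"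
    and \<eta>_add: "a \<in> carrier S \<Longrightarrow> b \<in> carrier S \<Longrightarrow> \<eta> (a \<oplus> b) = \<eta> a + \<eta> b"
    and \<eta>_one: "\<eta> \<one> = 1"
    and gr_iff: "s \<in> gr k \<longleftrightarrow> s \<in> carrier S \<and> (\<exists>x. \<eta> s = Polynomial.monom x k)"
    and component: "s \<in> carrier S \<Longrightarrow> \<exists>a\<in>gr k. \<eta> a = Polynomial.monom (Polynomial.coeff (\<eta> s) k) k"
    and eval_inj: "inj_on (\<lambda>s. Polynomial.poly (\<eta> s) 1) (carrier S)"
begin

sublocale cring S by (rule cring_S)

definition \<iota> :: "'a \<Rightarrow> 'f" where "\<iota> s = Polynomial.poly (\<eta> s) 1"

lemma \<iota>_hom: "a \<in> carrier S \<Longrightarrow> b \<in> carrier S \<Longrightarrow> \<iota> (a \<otimes> b) = \<iota> a * \<iota> b"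
  "a \<in> carrier S \<Longrightarrow> b \<in> carrier S \<Longrightarrow> \<iota> (a \<oplus> b) = \<iota> a + \<iota> b" "\<iota> \<one> = 1"
  unfolding \<iota>_def by (simp_all add: \<eta>_mult \<eta>_add \<eta>_one)

lemma \<eta>_inj: "a \<in> carrier S \<Longrightarrow> b \<in> carrier S \<Longrightarrow> \<eta> a = \<eta> b \<Longrightarrow> a = b"
  using inj_onD[OF eval_inj, of a b] by simp

lemma \<eta>_zero: "\<eta> \<zero> = 0"
proof -
  have "\<eta> \<zero> + \<eta> \<zero> = \<eta> \<zero> + 0" using \<eta>_add[OF zero_closed zero_closed] by simp
  then show ?thesis by (rule add_left_imp_eq)
qed

lemma \<eta>_uminus: "a \<in> carrier S \<Longrightarrow> \<eta> (\<ominus> a) = - \<eta> a"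
  using \<eta>_add[of a "\<ominus> a"] \<eta>_zero by (simp add: r_neg eq_neg_iff_add_eq_0 add.commute)

lemma gr_carrier: "a \<in> gr k \<Longrightarrow> a \<in> carrier S"
  using gr_iff by simp

lemma \<eta>_gr: "a \<in> gr k \<Longrightarrow> \<eta> a = Polynomial.monom (\<iota> a) k"
  using gr_iff unfolding \<iota>_def by (auto simp: poly_monom)

lemma gr_mult: "a \<in> gr j \<Longrightarrow> b \<in> gr k \<Longrightarrow> a \<otimes> b \<in> gr (j + k)"
  unfolding gr_iff[of _ "j + k"] using \<eta>_gr[of a j] \<eta>_gr[of b k] gr_carrier by (auto simp: \<eta>_mult mult_monom)

lemma gr_add: "a \<in> gr k \<Longrightarrow> b \<in> gr k \<Longrightarrow> a \<oplus> b \<in> gr k"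
  unfolding gr_iff[of _ k] by (auto simp: \<eta>_add add_monom)

lemma gr_uminus: "a \<in> gr k \<Longrightarrow> \<ominus> a \<in> gr k"
  unfolding gr_iff[of _ k] by (auto simp: \<eta>_uminus minus_monom)

lemma gr_zero: "\<zero> \<in> gr k"
  unfolding gr_iff using \<eta>_zero by (auto intro!: exI[of _ 0])

lemma gr_one: "\<one> \<in> gr 0"
  unfolding gr_iff using \<eta>_one by (auto intro!: exI[of _ 1])

lemma sum_of_components:
  assumes I: "additive_subgroup I S" and s: "s \<in> carrier S"
    and c: "\<And>k a. a \<in> gr k \<Longrightarrow> \<eta> a = Polynomial.monom (Polynomial.coeff (\<eta> s) k) k \<Longrightarrow> a \<in> I"
  shows "s \<in> I"
proof -
  interpret I: additive_subgroup I S by (rule I)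
  have "\<forall>k\<ge>N. Polynomial.coeff (\<eta> s) k = 0 \<Longrightarrow> s \<in> carrier S \<Longrightarrow>
     (\<And>k a. a \<in> gr k \<Longrightarrow> \<eta> a = Polynomial.monom (Polynomial.coeff (\<eta> s) k) k \<Longrightarrow> a \<in> I) \<Longrightarrow> s \<in> I" for N s
  proof (induction N arbitrary: s)
    case 0
    then have "\<eta> s = \<eta> \<zero>" by (auto simp: \<eta>_zero poly_eq_iff)
    then show ?case using \<eta>_inj[of s \<zero>] 0 by simp
  next
    case (Suc N)
    obtain a where a: "a \<in> gr N" "\<eta> a = Polynomial.monom (Polynomial.coeff (\<eta> s) N) N" using component[OF Suc.prems(2)] by blast
    have ac: "a \<in> carrier S" using a gr_carrier by auto
    have aI: "a \<in> I" using Suc.prems(3) a by blast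
    have e: "\<eta> (s \<oplus> \<ominus> a) = \<eta> s - Polynomial.monom (Polynomial.coeff (\<eta> s) N) N" using ac Suc.prems a by (simp add: \<eta>_add \<eta>_uminus)
    have "s \<oplus> \<ominus> a \<in> I"
    proof (rule Suc.IH)
      show "\<forall>k\<ge>N. Polynomial.coeff (\<eta> (s \<oplus> \<ominus> a)) k = 0" using Suc.prems(1) unfolding e by auto
      show "s \<oplus> \<ominus> a \<in> carrier S" using ac Suc.prems by simp
      fix k b assume b: "b \<in> gr k" "\<eta> b = Polynomial.monom (Polynomial.coeff (\<eta> (s \<oplus> \<ominus> a)) k) k"
      show "b \<in> I"
      proof (cases "k = N")
        case True
        then have "\<eta> b = \<eta> \<zero>" using b by (simp add: e \<eta>_zero)
        then show ?thesis using \<eta>_inj[of b \<zero>] gr_carrier[OF b(1)] by simp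
      next
        case False
        then show ?thesis using Suc.prems(3) b by (auto simp: e)
      qed
    qed
    moreover have "s = (s \<oplus> \<ominus> a) \<oplus> a" using ac Suc.prems(2) by (simp add: a_assoc l_neg)
    ultimately show ?case using aI I.a_closed by metis
  qed
  then show ?thesis using s c MOST_coeff_eq_0 by (metis coeff_eq_0 less_eq_Suc_le)
qed

end

locale graded_arrangement = graded_domain S gr \<eta>
  for S :: "('a, 'm) ring_scheme" (structure) and gr and \<eta> :: "'a \<Rightarrow> 'f::field poly" +
  fixes n :: nat and l :: "nat \<Rightarrow> 'a"
  assumes l_gr: "i \<le> n \<Longrightarrow> l i \<in> gr 1" and l_nonzero: "i \<le> n \<Longrightarrow> l i \<noteq> \<zero>"
begin

lemma \<iota>_zero: "\<iota> \<zero> = 0" unfolding \<iota>_def \<eta>_zero by simp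

lemma \<iota>_inj: "inj_on \<iota> (carrier S)"
  unfolding \<iota>_def using eval_inj .

lemma \<iota>_eq_0: "a \<in> carrier S \<Longrightarrow> \<iota> a = 0 \<longleftrightarrow> a = \<zero>"
  using \<iota>_zero \<iota>_inj by (metis inj_on_eq_iff zero_closed)

lemma \<iota>_l: "i \<le> n \<Longrightarrow> \<iota> (l i) \<noteq> 0"
  using \<iota>_eq_0 l_gr l_nonzero gr_carrier by blast

sublocale fraction_space S "range gr" "Proj_points S gr" \<iota>
proof (rule fraction_space.intro, goal_cases)
  case 1 show ?case by (rule cring_S)
next
  case (7 G H)
  then obtain j k where "G = gr j" "H = gr k" by auto
  then show ?case using gr_mult by (intro bexI[of _ "gr (j + k)"]) auto
next
  case 9 show ?case using gr_one gr_zero by auto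
next
  case 11
  have "primeideal {\<zero>} S"
  proof (rule primeidealI)
    show "ideal {\<zero>} S" by (rule zeroideal)
    have "\<one> \<noteq> \<zero>" using \<iota>_hom(3) \<iota>_zero by auto
    then show "carrier S \<noteq> {\<zero>}" by auto
    show "a \<in> {\<zero>} \<or> b \<in> {\<zero>}" if ab: "a \<in> carrier S" "b \<in> carrier S" "a \<otimes> b \<in> {\<zero>}" for a b
    proof -
      have "\<iota> a * \<iota> b = 0" using \<iota>_hom(1)[OF ab(1,2)] ab(3) \<iota>_zero by simp
      then show ?thesis using \<iota>_eq_0 ab by auto
    qed
  qed (rule cring_S)
  moreover have "homogeneous_ideal S gr {\<zero>}"
  proof -
    have "{\<zero>} \<inter> (\<Union>k. gr k) = {\<zero>}" using gr_zero by auto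
    then show ?thesis unfolding homogeneous_ideal_def using zeroideal genideal_zero by simp
  qed
  moreover have "l 0 \<in> Idl (\<Union>k\<in>{0<..}. gr k)"
    using genideal_self[of "\<Union>k\<in>{0<..}. gr k"] l_gr[of 0] gr_carrier by fastforce
  ultimately show ?case unfolding Proj_points_def using l_nonzero[of 0] by auto
qed (auto simp: \<iota>_hom \<iota>_inj gr_carrier gr_add Proj_points_def)

definition \<Omega> :: "'a set set" where
  "\<Omega> = {p \<in> Proj_points S gr. \<forall>i\<le>n. l i \<notin> p}"

fun lmon :: "nat list \<Rightarrow> 'a" where
  "lmon [] = \<one>" |
  "lmon (i # is) = l i \<otimes> lmon is"

definition Reg :: "'f set" where
  "Reg = {\<iota> a / \<iota> (lmon is) | a is. set is \<subseteq> {..n} \<and> a \<in> gr (length is)}"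

lemma lmon_gr: "set is \<subseteq> {..n} \<Longrightarrow> lmon is \<in> gr (length is)"
proof (induction "is")
  case (Cons i "is")
  then show ?case using gr_mult[OF l_gr, of i "lmon is" "length is"] by simp
qed (simp add: gr_one)

lemma lmon_carrier: "set is \<subseteq> {..n} \<Longrightarrow> lmon is \<in> carrier S"
  using lmon_gr gr_carrier by blast

lemma \<iota>_lmon: "set is \<subseteq> {..n} \<Longrightarrow> \<iota> (lmon is) = (\<Prod>i\<leftarrow>is. \<iota> (l i))"
  by (induction "is") (auto simp: \<iota>_hom lmon_carrier gr_carrier[OF l_gr])

lemma \<iota>_lmon_nonzero: "set is \<subseteq> {..n} \<Longrightarrow> \<iota> (lmon is) \<noteq> 0"
  unfolding \<iota>_lmon by (induction "is") (auto simp: \<iota>_l)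

lemma lmon_notin: "p \<in> \<Omega> \<Longrightarrow> set is \<subseteq> {..n} \<Longrightarrow> lmon is \<notin> p"
proof (induction "is")
  case Nil
  then show ?case using primeideal_one_notin prime unfolding \<Omega>_def by auto
next
  case (Cons i "is")
  then show ?case using primeideal_mult_iff[OF prime, of p "l i" "lmon is"] lmon_carrier l_gr[of i] gr_carrier
    unfolding \<Omega>_def by auto
qed

lemma fractions_gr: "(a, b) \<in> fractions (range gr) p \<longleftrightarrow> (\<exists>k. a \<in> gr k \<and> b \<in> gr k \<and> b \<notin> p)"
  unfolding fractions_def by auto

lemma openin_\<Omega>: "openin (zariski (range gr) (Proj_points S gr)) \<Omega>"
proof -
  have "\<Omega> = {p \<in> Proj_points S gr. lmon [0..<Suc n] \<notin> p}"
  proof (intro subset_antisym subsetI)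
    fix p assume "p \<in> \<Omega>"
    then show "p \<in> {p \<in> Proj_points S gr. lmon [0..<Suc n] \<notin> p}"
      using lmon_notin[of p "[0..<Suc n]"] unfolding \<Omega>_def by (auto simp del: upt_Suc simp: subset_iff)
  next
    fix p assume p: "p \<in> {p \<in> Proj_points S gr. lmon [0..<Suc n] \<notin> p}"
    have "l i \<in> p \<Longrightarrow> i \<in> set is \<Longrightarrow> set is \<subseteq> {..n} \<Longrightarrow> lmon is \<in> p" for i "is"
    proof (induction "is")
      case (Cons j "is")
      then show ?case using primeideal_mult_iff[OF prime, of p "l j" "lmon is"] p lmon_carrier l_gr[of j] gr_carrier by auto
    qed auto
    then have "l i \<notin> p" if "i \<le> n" for i using p that by force
    then show "p \<in> \<Omega>" using p unfolding \<Omega>_def by auto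
  qed
  moreover have "lmon [0..<Suc n] \<in> \<Union> (range gr)" using lmon_gr[of "[0..<Suc n]"] by force
  ultimately show ?thesis using openin_basic by metis
qed

lemma Reg_locring: "p \<in> \<Omega> \<Longrightarrow> x \<in> Reg \<Longrightarrow> x \<in> locring p"
proof -
  assume p: "p \<in> \<Omega>" and "x \<in> Reg"
  then obtain a "is" where x: "x = \<iota> a / \<iota> (lmon is)" "set is \<subseteq> {..n}" "a \<in> gr (length is)"
    unfolding Reg_def by auto
  then have "(a, lmon is) \<in> fractions (range gr) p" using lmon_notin[OF p] lmon_gr fractions_gr by blast
  then show ?thesis using locring_iff[of p x] p x unfolding \<Omega>_def by blast
qed

lemma field_subring_Reg: "field_subring Reg"
  unfolding field_subring_def
proof (intro conjI ballI)
  show "0 \<in> Reg" unfolding Reg_def by (intro CollectI exI[of _ \<zero>] exI[of _ "[]"]) (auto simp: gr_zero \<iota>_zero)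
  show "1 \<in> Reg" unfolding Reg_def by (intro CollectI exI[of _ \<one>] exI[of _ "[]"]) (auto simp: gr_one \<iota>_hom)
  fix x assume "x \<in> Reg"
  then obtain a "is" where x: "x = \<iota> a / \<iota> (lmon is)" "set is \<subseteq> {..n}" "a \<in> gr (length is)"
    unfolding Reg_def by auto
  note nx = \<iota>_lmon_nonzero[OF x(2)] note cx = gr_carrier[OF x(3)]
  have "- x = \<iota> (\<ominus> a) / \<iota> (lmon is)" using x(1) cx by (simp add: \<iota>_uminus)
  then show "- x \<in> Reg" unfolding Reg_def using x gr_uminus by blast
  fix y assume "y \<in> Reg"
  then obtain b js where y: "y = \<iota> b / \<iota> (lmon js)" "set js \<subseteq> {..n}" "b \<in> gr (length js)"
    unfolding Reg_def by auto
  note ny = \<iota>_lmon_nonzero[OF y(2)] note cy = gr_carrier[OF y(3)]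
  have s: "set (is @ js) \<subseteq> {..n}" using x y by auto
  have d: "\<iota> (lmon (is @ js)) = \<iota> (lmon is) * \<iota> (lmon js)"
    using x y by (simp add: \<iota>_lmon)
  have "a \<otimes> b \<in> gr (length (is @ js))" using gr_mult[OF x(3) y(3)] by simp
  moreover have "x * y = \<iota> (a \<otimes> b) / \<iota> (lmon (is @ js))" unfolding d x(1) y(1) using cx cy by (simp add: \<iota>_hom)
  ultimately show "x * y \<in> Reg" unfolding Reg_def using s by blast
  let ?c = "a \<otimes> lmon js \<oplus> b \<otimes> lmon is"
  have "?c \<in> gr (length (is @ js))"
    using gr_mult[OF x(3) lmon_gr[OF y(2)]] gr_mult[OF y(3) lmon_gr[OF x(2)]] by (simp add: gr_add add.commute)
  moreover have "x + y = \<iota> ?c / \<iota> (lmon (is @ js))" unfolding d x(1) y(1)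
    using cx cy lmon_carrier[OF x(2)] lmon_carrier[OF y(2)] nx ny by (simp add: \<iota>_hom field_simps)
  ultimately show "x + y \<in> Reg" unfolding Reg_def using s by blast
qed

abbreviation t :: 'f where "t \<equiv> \<iota> (l 0)"

lemma t_nonzero: "t \<noteq> 0" using \<iota>_l by simp

lemma Reg_dehom: "a \<in> gr k \<Longrightarrow> \<iota> a / t ^ k \<in> Reg"
proof -
  assume a: "a \<in> gr k"
  have s: "set (replicate k 0) \<subseteq> {..n}" by auto
  have "\<iota> (lmon (replicate k 0)) = t ^ k" using \<iota>_lmon[OF s] by simp
  then show ?thesis unfolding Reg_def using a s by (intro CollectI exI[of _ a] exI[of _ "replicate k 0"]) auto
qed

lemma Reg_inverse: "i \<le> n \<Longrightarrow> t / \<iota> (l i) \<in> Reg"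
  unfolding Reg_def using l_gr[of 0] l_gr[of i]
  by (intro CollectI exI[of _ "l 0"] exI[of _ "[i]"]) (auto simp: gr_carrier)

text \<open>The point of \<open>\<Omega>\<close> that corresponds to a prime \<open>q\<close> of \<open>\<O>(\<Omega>)\<close>, by dehomogenization with respect to
  \<open>l\<^sub>0\<close>.\<close>

definition pt :: "'f set \<Rightarrow> 'a set" where
  "pt q = {s \<in> carrier S. \<forall>k. Polynomial.coeff (\<eta> s) k / t ^ k \<in> q}"

lemma pt_gr:
  assumes "0 \<in> q" "a \<in> gr k"
  shows "a \<in> pt q \<longleftrightarrow> \<iota> a / t ^ k \<in> q"
  unfolding pt_def using assms \<eta>_gr[of a k] gr_carrier by auto

lemma coeff_in_Reg:
  assumes "s \<in> carrier S" shows "Polynomial.coeff (\<eta> s) k / t ^ k \<in> Reg"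
proof -
  obtain a where a: "a \<in> gr k" "\<eta> a = Polynomial.monom (Polynomial.coeff (\<eta> s) k) k" using component assms by blast
  then have "\<iota> a = Polynomial.coeff (\<eta> s) k" unfolding \<iota>_def by (simp add: poly_monom)
  then show ?thesis using Reg_dehom[OF a(1)] by simp
qed

lemma coeff_mult_dehom:
  "a \<in> carrier S \<Longrightarrow> b \<in> carrier S \<Longrightarrow> Polynomial.coeff (\<eta> (a \<otimes> b)) k / t ^ k =
    (\<Sum>i\<le>k. (Polynomial.coeff (\<eta> a) i / t ^ i) * (Polynomial.coeff (\<eta> b) (k - i) / t ^ (k - i)))"
  by (simp add: \<eta>_mult coeff_mult sum_divide_distrib power_add[symmetric])

lemma pt_prime:
  assumes q: "prime_in Reg q"
  shows "primeideal (pt q) S"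
proof (rule primeidealI)
  have I: "ideal_in Reg q" and q1: "1 \<notin> q" using q unfolding prime_in_def by auto
  note Q = ideal_inD[OF I]
  note cR = coeff_in_Reg
  show "ideal (pt q) S"
  proof (rule idealI)
    show "ring S" by (rule ring_axioms)
    show "subgroup (pt q) (add_monoid S)"
    proof (rule add.subgroupI)
      show "pt q \<subseteq> carrier S" unfolding pt_def by auto
      have "\<zero> \<in> pt q" unfolding pt_def using Q(2) \<eta>_zero by auto
      then show "pt q \<noteq> {}" by auto
      show "\<ominus> a \<in> pt q" if "a \<in> pt q" for a
        using that ideal_in_uminus[OF field_subring_Reg I] unfolding pt_def by (auto simp: \<eta>_uminus)
      show "a \<oplus> b \<in> pt q" if "a \<in> pt q" "b \<in> pt q" for a b
        using that Q(3) unfolding pt_def by (auto simp: \<eta>_add add_divide_distrib)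
    qed
    show "a \<otimes> x \<in> pt q" if a: "a \<in> pt q" and x: "x \<in> carrier S" for a x
    proof -
      have ac: "a \<in> carrier S" "\<And>k. Polynomial.coeff (\<eta> a) k / t ^ k \<in> q" using a unfolding pt_def by auto
      have "Polynomial.coeff (\<eta> (a \<otimes> x)) k / t ^ k \<in> q" for k
        unfolding coeff_mult_dehom[OF ac(1) x]
        by (rule ideal_in_sum[OF I], rule Q(4)[OF ac(2) cR[OF x]])
      then show ?thesis unfolding pt_def using ac x by auto
    qed
    then show "x \<otimes> a \<in> pt q" if "a \<in> pt q" "x \<in> carrier S" for a x
      using that m_comm[of x a] unfolding pt_def by auto
  qed
  show "cring S" by (rule cring_S)
  have "\<one> \<notin> pt q" using pt_gr[OF Q(2) gr_one] q1 by (simp add: \<iota>_hom)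
  then show "carrier S \<noteq> pt q" by auto
  fix a b assume ab: "a \<in> carrier S" "b \<in> carrier S" "a \<otimes> b \<in> pt q"
  show "a \<in> pt q \<or> b \<in> pt q"
  proof (rule ccontr)
    assume n: "\<not> (a \<in> pt q \<or> b \<in> pt q)"
    let ?a = "\<lambda>k. Polynomial.coeff (\<eta> a) k / t ^ k" and ?b = "\<lambda>k. Polynomial.coeff (\<eta> b) k / t ^ k"
    define i j where "i = (LEAST k. ?a k \<notin> q)" and "j = (LEAST k. ?b k \<notin> q)"
    have ex: "\<exists>k. ?a k \<notin> q" "\<exists>k. ?b k \<notin> q" using n ab unfolding pt_def by auto
    have i: "?a i \<notin> q" "\<And>k. k < i \<Longrightarrow> ?a k \<in> q" unfolding i_def using LeastI_ex[OF ex(1)] not_less_Least[of _ "\<lambda>k. ?a k \<notin> q"] by auto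
    have j: "?b j \<notin> q" "\<And>k. k < j \<Longrightarrow> ?b k \<in> q" unfolding j_def using LeastI_ex[OF ex(2)] not_less_Least[of _ "\<lambda>k. ?b k \<notin> q"] by auto
    let ?rest = "\<Sum>k\<in>{..i + j} - {i}. ?a k * ?b (i + j - k)"
    have "Polynomial.coeff (\<eta> (a \<otimes> b)) (i + j) / t ^ (i + j) = ?a i * ?b j + ?rest"
      unfolding coeff_mult_dehom[OF ab(1,2)] by (subst sum.remove[of _ i]) auto
    moreover have "Polynomial.coeff (\<eta> (a \<otimes> b)) (i + j) / t ^ (i + j) \<in> q" using ab unfolding pt_def by auto
    ultimately have tot: "?a i * ?b j + ?rest \<in> q" by simp
    have rest: "?rest \<in> q"
    proof (rule ideal_in_sum[OF I])
      fix k assume k: "k \<in> {..i + j} - {i}"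
      show "?a k * ?b (i + j - k) \<in> q"
      proof (cases "k < i")
        case True
        show ?thesis by (rule Q(4)[OF i(2)[OF True] cR[OF ab(2)]])
      next
        case False
        then have "i + j - k < j" using k by auto
        show ?thesis by (rule Q(5)[OF j(2) cR[OF ab(1)]]) fact
      qed
    qed
    from tot have "(?a i * ?b j + ?rest) + - ?rest \<in> q" by (rule Q(3)[OF _ ideal_in_uminus[OF field_subring_Reg I rest]])
    then have "?a i * ?b j \<in> q" by simp
    then have "?a i \<in> q \<or> ?b j \<in> q" using q cR[OF ab(1), of i] cR[OF ab(2), of j] unfolding prime_in_def by auto
    then show False using i(1) j(1) by simp
  qed
qed

lemma pt_in_\<Omega>:
  assumes q: "prime_in Reg q"
  shows "pt q \<in> \<Omega>"
proof -
  have I: "ideal_in Reg q" and q1: "1 \<notin> q" using q unfolding prime_in_def by auto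
  note Q = ideal_inD[OF I]
  interpret P: primeideal "pt q" S by (rule pt_prime[OF assms])
  have li: "l i \<notin> pt q" if i: "i \<le> n" for i
  proof
    assume "l i \<in> pt q"
    then have "\<iota> (l i) / t \<in> q" using pt_gr[OF Q(2) l_gr[OF i]] by simp
    then have "\<iota> (l i) / t * (t / \<iota> (l i)) \<in> q" using Q(4) Reg_inverse[OF i] by blast
    then show False using q1 \<iota>_l[OF i] t_nonzero by simp
  qed
  have "homogeneous_ideal S gr (pt q)"
    unfolding homogeneous_ideal_def
  proof (intro conjI subset_antisym subsetI)
    show "ideal (pt q) S" by (rule P.is_ideal)
    have sub: "pt q \<inter> (\<Union>k. gr k) \<subseteq> carrier S" using P.a_subset by auto
    show "s \<in> pt q" if "s \<in> Idl (pt q \<inter> (\<Union>k. gr k))" for s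
      using genideal_minimal[OF P.is_ideal, of "pt q \<inter> (\<Union>k. gr k)"] that by auto
    fix s assume s: "s \<in> pt q"
    show "s \<in> Idl (pt q \<inter> (\<Union>k. gr k))"
    proof (rule sum_of_components)
      show "additive_subgroup (Idl (pt q \<inter> (\<Union>k. gr k))) S"
        using genideal_ideal[OF sub] ideal.axioms(1) by blast
      show "s \<in> carrier S" using s unfolding pt_def by auto
      fix k a assume a: "a \<in> gr k" "\<eta> a = Polynomial.monom (Polynomial.coeff (\<eta> s) k) k"
      then have "\<iota> a = Polynomial.coeff (\<eta> s) k" unfolding \<iota>_def by (simp add: poly_monom)
      then have "a \<in> pt q" using pt_gr[OF Q(2) a(1)] s unfolding pt_def by auto
      then show "a \<in> Idl (pt q \<inter> (\<Union>k. gr k))" using genideal_self[OF sub] a(1) by auto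
    qed
  qed
  moreover have "l 0 \<in> Idl (\<Union>k\<in>{0<..}. gr k)"
    using genideal_self[of "\<Union>k\<in>{0<..}. gr k"] l_gr[of 0] gr_carrier by fastforce
  ultimately show ?thesis unfolding \<Omega>_def Proj_points_def using li pt_prime[OF assms] by auto
qed

text \<open>For \<open>x \<in> \<O>(\<Omega>)\<close> the ideal of denominators of \<open>x\<close> in \<open>Reg\<close> lies in no prime ideal of \<open>Reg\<close>, because
  \<open>x\<close> is regular at the corresponding point of \<open>\<Omega>\<close>.\<close>

lemma Reg_eq: "(\<Inter>p\<in>\<Omega>. locring p) = Reg"
proof (intro subset_antisym subsetI)
  fix x assume x: "x \<in> (\<Inter>p\<in>\<Omega>. locring p)"
  note Rs = field_subringD[OF field_subring_Reg]
  define J where "J = {y \<in> Reg. y * x \<in> Reg}"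
  have J: "ideal_in Reg J"
    unfolding ideal_in_def
  proof (intro conjI ballI)
    fix y z assume y: "y \<in> J"
    show "y + z \<in> J" if "z \<in> J" using y that Rs unfolding J_def by (auto simp: distrib_right)
    show "y * z \<in> J" if z: "z \<in> Reg"
    proof -
      have "y * z * x = (y * x) * z" by simp
      moreover have "(y * x) * z \<in> Reg" "y * z \<in> Reg" using y z Rs(5) unfolding J_def by blast+
      ultimately show ?thesis unfolding J_def by (simp add: ac_simps)
    qed
  qed (use Rs in \<open>auto simp: J_def\<close>)
  have "1 \<in> J"
  proof (rule ccontr)
    assume "1 \<notin> J"
    then obtain q where q: "prime_in Reg q" "J \<subseteq> q" using prime_in_extends[OF field_subring_Reg J] by blast
    then have q0: "0 \<in> q" unfolding prime_in_def ideal_in_def by auto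
    have pq: "pt q \<in> \<Omega>" using pt_in_\<Omega>[OF q(1)] .
    then have "x \<in> locring (pt q)" using x by auto
    then obtain a b k where ab: "a \<in> gr k" "b \<in> gr k" "b \<notin> pt q" "x = \<iota> a / \<iota> b"
      using locring_iff[of "pt q" x] pq fractions_gr unfolding \<Omega>_def by auto
    have b: "\<iota> b / t ^ k \<in> Reg" "\<iota> b / t ^ k \<notin> q" using ab pt_gr[OF q0] Reg_dehom by auto
    have "\<iota> b \<noteq> 0" using b q0 by auto
    then have "\<iota> b / t ^ k * x = \<iota> a / t ^ k" using ab by simp
    then have "\<iota> b / t ^ k * x \<in> Reg" using Reg_dehom[OF ab(1)] by (simp only:)
    then have "\<iota> b / t ^ k \<in> J" unfolding J_def using b by blast
    then show False using q b by auto
  qed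
  then show "x \<in> Reg" unfolding J_def by auto
qed (use Reg_locring in auto)

lemma generic_in_\<Omega>: "{\<zero>} \<in> \<Omega>"
  using generic l_nonzero unfolding \<Omega>_def by auto

lemma \<Omega>_points: "\<Omega> \<subseteq> Proj_points S gr"
  unfolding \<Omega>_def by auto

lemma Reg_fraction:
  assumes "x \<in> Reg"
  obtains a b k where "x = \<iota> a / \<iota> b" "a \<in> gr k" "b \<in> gr k" "\<iota> b \<noteq> 0" "\<And>p. p \<in> \<Omega> \<Longrightarrow> b \<notin> p"
proof -
  obtain a "is" where x: "x = \<iota> a / \<iota> (lmon is)" "set is \<subseteq> {..n}" "a \<in> gr (length is)"
    using assms unfolding Reg_def by auto
  show ?thesis using that[OF x(1,3) lmon_gr[OF x(2)] \<iota>_lmon_nonzero[OF x(2)]] lmon_notin x(2) by blast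
qed

definition vanishing :: "'a set \<Rightarrow> 'f set" where
  "vanishing p = {\<iota> a / \<iota> b | a b k. a \<in> gr k \<and> b \<in> gr k \<and> b \<notin> p \<and> a \<in> p} \<inter> Reg"

lemma vanishing_iff:
  assumes p: "p \<in> \<Omega>" and ab: "a \<in> gr k" "b \<in> gr k" "b \<notin> p" and R: "\<iota> a / \<iota> b \<in> Reg"
  shows "\<iota> a / \<iota> b \<in> vanishing p \<longleftrightarrow> a \<in> p"
proof
  have pP: "p \<in> Proj_points S gr" using p \<Omega>_points by auto
  note pr = prime[OF pP]
  assume "\<iota> a / \<iota> b \<in> vanishing p"
  then obtain c e j where ce: "c \<in> gr j" "e \<in> gr j" "e \<notin> p" "c \<in> p" "\<iota> a / \<iota> b = \<iota> c / \<iota> e"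
    unfolding vanishing_def by blast
  have nz: "\<iota> b \<noteq> 0" "\<iota> e \<noteq> 0"
    using fractionsD(4)[OF pP, of a b] fractionsD(4)[OF pP, of c e] ab ce fractions_gr by blast+
  note cc = gr_carrier[OF ab(1)] gr_carrier[OF ab(2)] gr_carrier[OF ce(1)] gr_carrier[OF ce(2)]
  have "\<iota> (a \<otimes> e) = \<iota> (c \<otimes> b)" using ce(5) nz cc by (simp add: \<iota>_hom field_simps)
  then have "a \<otimes> e = c \<otimes> b" using inj_onD[OF \<iota>_inj] cc by simp
  then show "a \<in> p" using primeideal_mult_iff[OF pr] cc ce by metis
qed (use assms in \<open>auto simp: vanishing_def\<close>)

lemma vanishing_prime:
  assumes p: "p \<in> \<Omega>" shows "prime_in Reg (vanishing p)"
proof -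
  have pP: "p \<in> Proj_points S gr" using p \<Omega>_points by auto
  note pr = prime[OF pP]
  interpret P: primeideal p S by (rule pr)
  note Rs = field_subringD[OF field_subring_Reg]
  have rep: "\<exists>a b k. x = \<iota> a / \<iota> b \<and> a \<in> gr k \<and> b \<in> gr k \<and> \<iota> b \<noteq> 0 \<and> b \<notin> p \<and> (x \<in> vanishing p \<longleftrightarrow> a \<in> p)"
    if x: "x \<in> Reg" for x
  proof -
    obtain a b k where ab: "x = \<iota> a / \<iota> b" "a \<in> gr k" "b \<in> gr k" "\<iota> b \<noteq> 0" "b \<notin> p"
      using Reg_fraction[OF x] p by metis
    then show ?thesis using vanishing_iff[OF p ab(2,3,5)] x by blast
  qed
  have mult: "x * y \<in> vanishing p \<longleftrightarrow> x \<in> vanishing p \<or> y \<in> vanishing p" if xy: "x \<in> Reg" "y \<in> Reg" for x y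
  proof -
    obtain a b k where a: "x = \<iota> a / \<iota> b" "a \<in> gr k" "b \<in> gr k" "\<iota> b \<noteq> 0" "b \<notin> p" "x \<in> vanishing p \<longleftrightarrow> a \<in> p"
      using rep[OF xy(1)] by blast
    obtain c e j where c: "y = \<iota> c / \<iota> e" "c \<in> gr j" "e \<in> gr j" "\<iota> e \<noteq> 0" "e \<notin> p" "y \<in> vanishing p \<longleftrightarrow> c \<in> p"
      using rep[OF xy(2)] by blast
    note cc = gr_carrier[OF a(2)] gr_carrier[OF a(3)] gr_carrier[OF c(2)] gr_carrier[OF c(3)]
    have xye: "x * y = \<iota> (a \<otimes> c) / \<iota> (b \<otimes> e)" using a c cc by (simp add: \<iota>_hom)
    have "b \<otimes> e \<notin> p" using primeideal_mult_iff[OF pr] cc a c by simp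
    moreover have "\<iota> (a \<otimes> c) / \<iota> (b \<otimes> e) \<in> Reg" using Rs(5)[OF xy] xye by simp
    ultimately have "x * y \<in> vanishing p \<longleftrightarrow> a \<otimes> c \<in> p"
      using vanishing_iff[OF p gr_mult[OF a(2) c(2)] gr_mult[OF a(3) c(3)]] xye by simp
    then show ?thesis using primeideal_mult_iff[OF pr] cc a(6) c(6) by simp
  qed
  have add: "x + y \<in> vanishing p" if xy: "x \<in> vanishing p" "y \<in> vanishing p" for x y
  proof -
    have xyR: "x \<in> Reg" "y \<in> Reg" using xy unfolding vanishing_def by auto
    obtain a b k where a: "x = \<iota> a / \<iota> b" "a \<in> gr k" "b \<in> gr k" "\<iota> b \<noteq> 0" "b \<notin> p" "a \<in> p"
      using rep[OF xyR(1)] xy(1) by blast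
    obtain c e j where c: "y = \<iota> c / \<iota> e" "c \<in> gr j" "e \<in> gr j" "\<iota> e \<noteq> 0" "e \<notin> p" "c \<in> p"
      using rep[OF xyR(2)] xy(2) by blast
    note cc = gr_carrier[OF a(2)] gr_carrier[OF a(3)] gr_carrier[OF c(2)] gr_carrier[OF c(3)]
    let ?c = "a \<otimes> e \<oplus> c \<otimes> b"
    have xye: "x + y = \<iota> ?c / \<iota> (b \<otimes> e)" unfolding a(1) c(1) using a(4) c(4) cc by (simp add: \<iota>_hom field_simps)
    have "b \<otimes> e \<notin> p" using primeideal_mult_iff[OF pr] cc a c by simp
    moreover have "\<iota> ?c / \<iota> (b \<otimes> e) \<in> Reg" using Rs(4)[OF xyR] xye by simp
    moreover have "?c \<in> p" using a(6) c(6) cc P.I_r_closed P.a_closed by simp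
    moreover have "?c \<in> gr (k + j)" using gr_mult[OF a(2) c(3)] gr_mult[OF c(2) a(3)] by (simp add: gr_add add.commute)
    ultimately show ?thesis using vanishing_iff[OF p _ gr_mult[OF a(3) c(3)]] xye by simp
  qed
  have one: "1 \<notin> vanishing p"
    using vanishing_iff[OF p gr_one gr_one] primeideal_one_notin[OF pr] Rs(2) by (simp add: \<iota>_hom)
  have zero: "0 \<in> vanishing p"
    using vanishing_iff[OF p gr_zero gr_one] primeideal_one_notin[OF pr] Rs(1) P.zero_closed by (simp add: \<iota>_hom \<iota>_zero)
  have sub: "vanishing p \<subseteq> Reg" unfolding vanishing_def by auto
  show ?thesis unfolding prime_in_def ideal_in_def using mult add one zero sub by (auto simp: subset_iff)
qed

lemma vanishing_dehom:
  assumes p: "p \<in> \<Omega>" and a: "a \<in> gr k"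
  shows "\<iota> a / t ^ k \<in> vanishing p \<longleftrightarrow> a \<in> p"
proof -
  have s: "set (replicate k 0) \<subseteq> {..n}" by auto
  have "\<iota> (lmon (replicate k 0)) = t ^ k" using \<iota>_lmon[OF s] by simp
  then show ?thesis
    using vanishing_iff[OF p a, of "lmon (replicate k 0)"] lmon_gr[OF s] lmon_notin[OF p s] Reg_dehom[OF a] by simp
qed

lemma vanishing_inj: "inj_on vanishing \<Omega>"
proof (rule inj_onI)
  fix p p' assume p: "p \<in> \<Omega>" "p' \<in> \<Omega>" and eq: "vanishing p = vanishing p'"
  have "p \<inter> (\<Union>k. gr k) = p' \<inter> (\<Union>k. gr k)"
    using vanishing_dehom[OF p(1)] vanishing_dehom[OF p(2)] eq by blast
  moreover have "homogeneous_ideal S gr p" "homogeneous_ideal S gr p'" using p \<Omega>_points unfolding Proj_points_def by auto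
  ultimately show "p = p'" unfolding homogeneous_ideal_def by metis
qed

lemma vanishing_pt:
  assumes q: "prime_in Reg q"
  shows "vanishing (pt q) = q"
proof -
  have I: "ideal_in Reg q" using q unfolding prime_in_def by auto
  note Q = ideal_inD[OF I]
  have p: "pt q \<in> \<Omega>" using pt_in_\<Omega>[OF q] .
  have "x \<in> vanishing (pt q) \<longleftrightarrow> x \<in> q" if x: "x \<in> Reg" for x
  proof -
    obtain a b k where ab: "x = \<iota> a / \<iota> b" "a \<in> gr k" "b \<in> gr k" "\<iota> b \<noteq> 0" "b \<notin> pt q"
      using Reg_fraction[OF x] p by metis
    have b: "\<iota> b / t ^ k \<in> Reg" "\<iota> b / t ^ k \<notin> q" using ab pt_gr[OF Q(2)] Reg_dehom by auto
    have "x \<in> vanishing (pt q) \<longleftrightarrow> \<iota> a / t ^ k \<in> q"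
      using vanishing_iff[OF p ab(2,3,5)] pt_gr[OF Q(2) ab(2)] ab(1) x by simp
    also have "\<iota> a / t ^ k = x * (\<iota> b / t ^ k)" using ab by simp
    also have "x * (\<iota> b / t ^ k) \<in> q \<longleftrightarrow> x \<in> q"
      using q b x Q(4)[of x "\<iota> b / t ^ k"] unfolding prime_in_def by blast
    finally show ?thesis .
  qed
  moreover have "vanishing (pt q) \<subseteq> Reg" unfolding vanishing_def by auto
  ultimately show ?thesis using Q(1) by blast
qed

lemma sections_copy: "subring_copy (sheaf (Proj S gr) \<Omega>) Reg (sec \<Omega>)"
proof -
  have o: "openin (space_of (prime_space S (range gr) (Proj_points S gr))) \<Omega>"
    using openin_\<Omega> by (simp add: prime_space_def)
  have ne: "\<Omega> \<noteq> {}" using generic_in_\<Omega> by auto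
  show ?thesis
    unfolding Proj_def
  proof (rule subring_copy.intro, goal_cases)
    case 1 show ?case by (rule field_subring_Reg)
  next
    case 2 show ?case using carrier_sheaf[OF o] unfolding Reg_eq .
  next
    case 3 show ?case using sec_inj[OF o ne] unfolding Reg_eq by (auto intro: inj_onI)
  next
    case (4 x y) then show ?case using sec_mult[OF o, of x y] unfolding Reg_eq by blast
  next
    case (5 x y) then show ?case using sec_add[OF o, of x y] unfolding Reg_eq by blast
  next
    case 6 show ?case using sec_one[OF o] .
  next
    case 7 show ?case using sec_zero[OF o] .
  qed
qed

lemma affine_\<Omega>: "affine_scheme (open_subspace (Proj S gr) \<Omega>)"
proof -
  define B where "B = sheaf (Proj S gr) \<Omega>"
  define e where "e = sec \<Omega>"
  interpret C: subring_copy B Reg e unfolding B_def e_def by (rule sections_copy)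
  interpret Sp: fraction_space B "{carrier B}" "{Q. primeideal Q B}" "inv_into Reg e"
    by (rule C.Spec_fraction_space)
  define X where "X = open_subspace (Proj S gr) \<Omega>"
  have o: "openin (space_of (prime_space S (range gr) (Proj_points S gr))) \<Omega>"
    using openin_\<Omega> by (simp add: prime_space_def)
  have X: "rational_space X locring sec" unfolding X_def Proj_def by (rule open_subspace_rational[OF o])
  have Y: "rational_space (Spec B) Sp.locring Sp.sec" unfolding Spec_def by (rule Sp.rational_space_axioms)
  have spX: "space_of X = subtopology (zariski (range gr) (Proj_points S gr)) \<Omega>"
    unfolding X_def Proj_def open_subspace_def prime_space_def by simp
  have spY: "space_of (Spec B) = zariski {carrier B} {Q. primeideal Q B}" unfolding Spec_def prime_space_def by simp
  have openX: "openin (space_of X) U \<longleftrightarrow> openin (zariski (range gr) (Proj_points S gr)) U \<and> U \<subseteq> \<Omega>" for U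
    unfolding spX using openin_\<Omega> by (auto simp: openin_open_subtopology)
  have ptsX: "points X = \<Omega>" unfolding spX using \<Omega>_points by (auto simp: topspace_subtopology topspace_zariski)
  have ptsY: "points (Spec B) = {Q. primeideal Q B}" unfolding spY by (rule Sp.topspace_zariski)
  define \<phi> where "\<phi> p = e ` vanishing p" for p
  have sub: "vanishing p \<subseteq> Reg" for p unfolding vanishing_def by auto
  have e\<phi>: "e x \<in> \<phi> p \<longleftrightarrow> x \<in> vanishing p" if "x \<in> Reg" for x p unfolding \<phi>_def by (rule C.e_in[OF sub that])
  have \<phi>_prime: "primeideal (\<phi> p) B" if "p \<in> \<Omega>" for p
    unfolding \<phi>_def by (rule C.primeideal_image[OF vanishing_prime[OF that]])
  have surj: "\<phi> ` \<Omega> = {Q. primeideal Q B}"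
  proof (intro subset_antisym subsetI)
    fix Q assume "Q \<in> {Q. primeideal Q B}"
    then obtain q where q: "prime_in Reg q" "Q = e ` q" using C.primeideal_preimage by auto
    have "Q = \<phi> (pt q)" unfolding \<phi>_def vanishing_pt[OF q(1)] by (rule q(2))
    then show "Q \<in> \<phi> ` \<Omega>" using pt_in_\<Omega>[OF q(1)] by blast
  qed (use \<phi>_prime in auto)
  have inj: "inj_on \<phi> \<Omega>"
  proof (rule inj_onI)
    fix p p' assume p: "p \<in> \<Omega>" "p' \<in> \<Omega>" "\<phi> p = \<phi> p'"
    have "x \<in> vanishing p \<longleftrightarrow> x \<in> vanishing p'" if "x \<in> Reg" for x
      using e\<phi>[OF that] p(3) by metis
    then have "vanishing p = vanishing p'" using sub by blast
    then show "p = p'" using vanishing_inj p by (auto dest: inj_onD)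
  qed
  have cont: "continuous_map (space_of X) (space_of (Spec B)) \<phi>"
    unfolding continuous_map_def
  proof (intro conjI allI impI)
    show "\<phi> \<in> points X \<rightarrow> points (Spec B)" using surj ptsX ptsY by auto
    fix U assume "openin (space_of (Spec B)) U"
    then obtain E where E: "E \<subseteq> carrier B" "U = {Q. primeideal Q B \<and> \<not> E \<subseteq> Q}"
      unfolding spY Sp.openin_zariski by auto
    show "openin (space_of X) {p \<in> points X. \<phi> p \<in> U}"
    proof (subst openin_subopen, intro ballI)
      fix p assume "p \<in> {p \<in> points X. \<phi> p \<in> U}"
      then have p: "p \<in> \<Omega>" "\<not> E \<subseteq> \<phi> p" using ptsX E by auto
      then obtain s where s: "s \<in> E" "s \<notin> \<phi> p" by auto
      then obtain x where x: "s = e x" "x \<in> Reg" using E C.carrier_B by auto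
      obtain a b k where ab: "x = \<iota> a / \<iota> b" "a \<in> gr k" "b \<in> gr k" "\<iota> b \<noteq> 0" "\<And>p. p \<in> \<Omega> \<Longrightarrow> b \<notin> p"
        using Reg_fraction[OF x(2)] by metis
      have ap: "s \<in> \<phi> p' \<longleftrightarrow> a \<in> p'" if "p' \<in> \<Omega>" for p'
        unfolding x(1) e\<phi>[OF x(2)] using vanishing_iff[OF that ab(2,3) ab(5)[OF that]] x(2) ab(1) by simp
      let ?W = "{p \<in> Proj_points S gr. a \<notin> p} \<inter> \<Omega>"
      have "openin (zariski (range gr) (Proj_points S gr)) ?W"
        using openin_basic[of a] ab(2) openin_\<Omega> by (intro openin_Int) auto
      then have "openin (space_of X) ?W" unfolding openX by auto
      moreover have "p \<in> ?W" using ap[OF p(1)] s p(1) \<Omega>_points by auto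
      moreover have "?W \<subseteq> {p \<in> points X. \<phi> p \<in> U}" using ap s(1) E(2) \<phi>_prime ptsX by blast
      ultimately show "\<exists>T. openin (space_of X) T \<and> p \<in> T \<and> T \<subseteq> {p \<in> points X. \<phi> p \<in> U}" by blast
    qed
  qed
  have op: "open_map (space_of X) (space_of (Spec B)) \<phi>"
    unfolding open_map_def
  proof (intro allI impI)
    fix U assume "openin (space_of X) U"
    then obtain E where E: "E \<subseteq> \<Union>(range gr)" "U = {p \<in> Proj_points S gr. \<not> E \<subseteq> p}" "U \<subseteq> \<Omega>"
      unfolding openX openin_zariski by auto
    show "openin (space_of (Spec B)) (\<phi> ` U)"
    proof (subst openin_subopen, intro ballI)
      fix Q assume "Q \<in> \<phi> ` U"
      then obtain p where p: "Q = \<phi> p" "p \<in> U" by auto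
      then obtain a where a: "a \<in> E" "a \<notin> p" using E by auto
      then obtain k where k: "a \<in> gr k" using E by auto
      let ?y = "\<iota> a / t ^ k"
      let ?W = "{Q \<in> {Q. primeideal Q B}. e ?y \<notin> Q}"
      have yR: "?y \<in> Reg" by (rule Reg_dehom[OF k])
      have "openin (space_of (Spec B)) ?W" unfolding spY using yR C.carrier_B by (intro Sp.openin_basic) auto
      moreover have "Q \<in> ?W" using p a E(3) \<phi>_prime e\<phi>[OF yR] vanishing_dehom[OF _ k] by auto
      moreover have "?W \<subseteq> \<phi> ` U"
      proof
        fix Q' assume Q': "Q' \<in> ?W"
        then have "Q' \<in> \<phi> ` \<Omega>" unfolding surj by auto
        then obtain p' where p': "p' \<in> \<Omega>" "Q' = \<phi> p'" by auto
        then have "a \<notin> p'" using Q' e\<phi>[OF yR] vanishing_dehom[OF _ k] by auto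
        then show "Q' \<in> \<phi> ` U" using p' a(1) \<Omega>_points E(2) by auto
      qed
      ultimately show "\<exists>T. openin (space_of (Spec B)) T \<and> Q \<in> T \<and> T \<subseteq> \<phi> ` U" by blast
    qed
  qed
  have homeo: "homeomorphic_map (space_of X) (space_of (Spec B)) \<phi>"
    by (rule bijective_open_imp_homeomorphic_map[OF cont op]) (use surj inj ptsX ptsY in auto)
  have loc: "Sp.locring (\<phi> p) = locring p" if "p \<in> points X" for p
  proof (intro subset_antisym subsetI)
    have p: "p \<in> \<Omega>" "p \<in> Proj_points S gr" using that ptsX \<Omega>_points by auto
    have \<phi>p: "\<phi> p \<in> {Q. primeideal Q B}" using \<phi>_prime p by auto
    fix x
    {
      assume "x \<in> Sp.locring (\<phi> p)"
      then obtain s u where su: "(s, u) \<in> fractions {carrier B} (\<phi> p)" "x = inv_into Reg e s / inv_into Reg e u"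
        using Sp.locring_iff[OF \<phi>p] by blast
      then have "s \<in> e ` Reg" "u \<in> e ` Reg" "u \<notin> \<phi> p" using C.carrier_B unfolding fractions_def by auto
      then obtain y z where yz: "s = e y" "u = e z" "y \<in> Reg" "z \<in> Reg" "z \<notin> vanishing p" using e\<phi> by blast
      have x: "x = y / z" using su(2) yz C.e_inj by simp
      obtain a b k where ab: "z = \<iota> a / \<iota> b" "a \<in> gr k" "b \<in> gr k" "\<iota> b \<noteq> 0" "b \<notin> p"
        using Reg_fraction[OF yz(4)] p by metis
      have "a \<notin> p" using vanishing_iff[OF p(1) ab(2,3,5)] yz ab(1) by simp
      then have "(b, a) \<in> fractions (range gr) p" using ab fractions_gr by blast
      moreover have "1 / z = \<iota> b / \<iota> a" using ab(1) by simp
      ultimately have "1 / z \<in> locring p" using locring_iff[OF p(2)] by blast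
      then have "y * (1 / z) \<in> locring p" using fr_ops(3)[OF p(2) Reg_locring[OF p(1) yz(3)]] by blast
      then show "x \<in> locring p" using x by simp
    next
      assume "x \<in> locring p"
      then obtain a b k where ab: "x = \<iota> a / \<iota> b" "a \<in> gr k" "b \<in> gr k" "b \<notin> p"
        using locring_iff[OF p(2)] fractions_gr by blast
      let ?y = "\<iota> a / t ^ k" and ?z = "\<iota> b / t ^ k"
      have R: "?y \<in> Reg" "?z \<in> Reg" using Reg_dehom ab by auto
      have "e ?z \<notin> \<phi> p" using e\<phi>[OF R(2)] vanishing_dehom[OF p(1) ab(3)] ab(4) by simp
      then have "(e ?y, e ?z) \<in> fractions {carrier B} (\<phi> p)" using R C.carrier_B unfolding fractions_def by auto
      moreover have "x = inv_into Reg e (e ?y) / inv_into Reg e (e ?z)" using C.e_inj R ab t_nonzero by simp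
      ultimately show "x \<in> Sp.locring (\<phi> p)" using Sp.locring_iff[OF \<phi>p] by blast
    }
  qed
  obtain f where "lrs_isomorphism X (Spec B) f" using rational_space_isomorphism[OF X Y homeo loc] by blast
  then show ?thesis unfolding affine_scheme_def X_def[symmetric] using C.cring_B by blast
qed

end

section \<open>Rings spanned by finitely generated groups of units\<close>

lemma integer_dependency:
  fixes e :: "'k \<Rightarrow> 'j \<Rightarrow> int"
  assumes "finite J" "finite K" "card J < card K"
  shows "\<exists>a. (\<exists>k\<in>K. a k \<noteq> 0) \<and> (\<forall>j\<in>J. (\<Sum>k\<in>K. a k * e k j) = 0)"
  using assms
proof (induction J arbitrary: K e rule: finite_induct)
  case empty
  then have "K \<noteq> {}" by auto
  then show ?case by (intro exI[of _ "\<lambda>_. 1"]) auto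
next
  case (insert j0 J)
  show ?case
  proof (cases "\<forall>k\<in>K. e k j0 = 0")
    case True
    have "card J < card K" using insert by simp
    then obtain a where "\<exists>k\<in>K. a k \<noteq> 0" "\<forall>j\<in>J. (\<Sum>k\<in>K. a k * e k j) = 0"
      using insert.IH[OF insert.prems(1)] by blast
    then show ?thesis using True by (intro exI[of _ a]) auto
  next
    case False
    then obtain p where p: "p \<in> K" "e p j0 \<noteq> 0" by auto
    define f where "f k j = e p j0 * e k j - e k j0 * e p j" for k j
    have "card J < card (K - {p})" using insert p by simp
    then obtain b where b: "\<exists>k\<in>K - {p}. b k \<noteq> 0" "\<forall>j\<in>J. (\<Sum>k\<in>K - {p}. b k * f k j) = 0"
      using insert.IH[of "K - {p}" f] insert.prems(1) by auto
    define a where "a k = (if k = p then - (\<Sum>k\<in>K - {p}. b k * e k j0) else e p j0 * b k)" for k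
    have "(\<Sum>k\<in>K. a k * e k j) = (\<Sum>k\<in>K - {p}. b k * f k j)" for j
    proof -
      have "(\<Sum>k\<in>K. a k * e k j) = a p * e p j + (\<Sum>k\<in>K - {p}. a k * e k j)"
        using insert.prems(1) p(1) by (rule sum.remove)
      also have "(\<Sum>k\<in>K - {p}. a k * e k j) = (\<Sum>k\<in>K - {p}. e p j0 * b k * e k j)"
        by (rule sum.cong) (auto simp: a_def)
      also have "a p * e p j = (\<Sum>k\<in>K - {p}. - (b k * e k j0 * e p j))"
        by (simp add: a_def sum_distrib_right sum_negf)
      also have "\<dots> + (\<Sum>k\<in>K - {p}. e p j0 * b k * e k j) = (\<Sum>k\<in>K - {p}. b k * f k j)"
        unfolding sum.distrib[symmetric] by (rule sum.cong) (auto simp: f_def algebra_simps)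
      finally show ?thesis .
    qed
    moreover have "f k j0 = 0" for k by (simp add: f_def)
    ultimately have "\<forall>j\<in>insert j0 J. (\<Sum>k\<in>K. a k * e k j) = 0" using b(2) by auto
    moreover have "\<exists>k\<in>K. a k \<noteq> 0" using b(1) p(2) unfolding a_def by auto
    ultimately show ?thesis by blast
  qed
qed

text \<open>The assumption \<open>generated\<close> says that the elements \<open>c * (\<Prod>i\<le>n. u i powi e i)\<close> span \<open>R\<close> additively. The units
  of \<open>R\<close> modulo constants form a finitely generated group, on which an injective endomorphism of \<open>R\<close>
  has image of finite index.\<close>

locale unit_generated_ring =
  fixes R C :: "'f::field set" and n :: nat and u :: "nat \<Rightarrow> 'f" and \<psi> :: "'f \<Rightarrow> 'f"
  assumes R: "field_subring R" and CR: "C \<subseteq> R"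
    and C_mult: "x \<in> C \<Longrightarrow> y \<in> C \<Longrightarrow> x * y \<in> C" and C_inverse: "x \<in> C \<Longrightarrow> inverse x \<in> C" and C_one: "1 \<in> C"
    and u: "i \<le> n \<Longrightarrow> u i \<in> R \<and> u i \<noteq> 0 \<and> inverse (u i) \<in> R"
    and generated: "0 \<in> Q \<Longrightarrow> (\<And>x y. x \<in> Q \<Longrightarrow> y \<in> Q \<Longrightarrow> x + y \<in> Q) \<Longrightarrow>
        (\<And>c e. c \<in> C \<Longrightarrow> c * (\<Prod>i\<le>n. u i powi e i) \<in> Q) \<Longrightarrow> R \<subseteq> Q"
    and units: "x \<in> R \<Longrightarrow> x \<noteq> 0 \<Longrightarrow> inverse x \<in> R \<Longrightarrow> \<exists>c e. c \<in> C \<and> x = c * (\<Prod>i\<le>n. u i powi e i)"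
    and \<psi>_closed: "x \<in> R \<Longrightarrow> \<psi> x \<in> R"
    and \<psi>_add: "x \<in> R \<Longrightarrow> y \<in> R \<Longrightarrow> \<psi> (x + y) = \<psi> x + \<psi> y"
    and \<psi>_mult: "x \<in> R \<Longrightarrow> y \<in> R \<Longrightarrow> \<psi> (x * y) = \<psi> x * \<psi> y"
    and \<psi>_const: "c \<in> C \<Longrightarrow> \<psi> c = c"
    and \<psi>_inj: "x \<in> R \<Longrightarrow> \<psi> x = 0 \<Longrightarrow> x = 0"
begin

lemmas Rs = field_subringD[OF R]

definition U :: "'f set" where "U = {x \<in> R. x \<noteq> 0 \<and> inverse x \<in> R}"

lemma U_mult: "x \<in> U \<Longrightarrow> y \<in> U \<Longrightarrow> x * y \<in> U"
  and U_one: "1 \<in> U" and U_inverse: "x \<in> U \<Longrightarrow> inverse x \<in> U"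
  unfolding U_def using Rs by auto

lemma U_power: "x \<in> U \<Longrightarrow> x ^ k \<in> U"
  by (induction k) (auto simp: U_mult U_one)

lemma U_powi: "x \<in> U \<Longrightarrow> x powi k \<in> U"
  unfolding power_int_def using U_power U_inverse by auto

lemma U_prod: "(\<And>i. i \<in> I \<Longrightarrow> f i \<in> U) \<Longrightarrow> prod f I \<in> U"
  by (induction I rule: infinite_finite_induct) (auto simp: U_mult U_one)

lemma C_power: "x \<in> C \<Longrightarrow> x ^ k \<in> C"
  by (induction k) (auto simp: C_mult C_one)

lemma C_powi: "x \<in> C \<Longrightarrow> x powi k \<in> C"
  unfolding power_int_def using C_power C_inverse by auto

lemma C_prod: "(\<And>i. i \<in> I \<Longrightarrow> f i \<in> C) \<Longrightarrow> prod f I \<in> C"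
  by (induction I rule: infinite_finite_induct) (auto simp: C_mult C_one)

lemma \<psi>_one: "\<psi> 1 = 1" using \<psi>_const[OF C_one] .

lemma \<psi>_zero: "\<psi> 0 = 0"
proof -
  have "\<psi> 0 + \<psi> 0 = \<psi> 0 + 0" using \<psi>_add[OF Rs(1) Rs(1)] by simp
  then show ?thesis by (rule add_left_imp_eq)
qed

lemma prod_powi: "(\<Prod>i\<in>I. f i) powi a = (\<Prod>i\<in>I. f i powi a)" for f :: "'i \<Rightarrow> 'f"
  by (induction I rule: infinite_finite_induct) (auto simp: power_int_mult_distrib)

lemma powi_sum: "x \<noteq> 0 \<Longrightarrow> x powi (\<Sum>i\<in>I. a i) = (\<Prod>i\<in>I. x powi a i)" for x :: 'f
  by (induction I rule: infinite_finite_induct) (auto simp: power_int_add)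

lemma \<psi>_inverse: "x \<in> U \<Longrightarrow> \<psi> (inverse x) = inverse (\<psi> x)"
  using \<psi>_mult[of "inverse x" x] \<psi>_one unfolding U_def by (auto simp: inverse_unique inverse_eq_divide eq_divide_eq)

lemma \<psi>_U: "x \<in> U \<Longrightarrow> \<psi> x \<in> U"
  using \<psi>_inverse[of x] \<psi>_inj[of x] \<psi>_closed unfolding U_def by force

lemma \<psi>_power: "x \<in> U \<Longrightarrow> \<psi> (x ^ k) = \<psi> x ^ k"
proof (induction k)
  case (Suc k)
  then show ?case using U_power[of x k] \<psi>_mult[of x "x ^ k"] unfolding U_def by simp
qed (simp add: \<psi>_one)

lemma \<psi>_powi: "x \<in> U \<Longrightarrow> \<psi> (x powi k) = \<psi> x powi k"
  unfolding power_int_def using \<psi>_power \<psi>_inverse U_inverse by auto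

lemma \<psi>_prod: "(\<And>i. i \<in> I \<Longrightarrow> f i \<in> U) \<Longrightarrow> \<psi> (prod f I) = (\<Prod>i\<in>I. \<psi> (f i))"
proof (induction I rule: infinite_finite_induct)
  case (insert i I)
  then have "f i \<in> R" "prod f I \<in> R" using U_prod[of I f] unfolding U_def by auto
  then show ?case using insert \<psi>_mult by simp
qed (auto simp: \<psi>_one)

lemma \<psi>_funpow_U: "x \<in> U \<Longrightarrow> (\<psi> ^^ k) x \<in> U"
  by (induction k) (auto simp: \<psi>_U)

lemma \<psi>_funpow_R: "x \<in> R \<Longrightarrow> (\<psi> ^^ k) x \<in> R"
  by (induction k) (auto simp: \<psi>_closed)

lemma \<psi>_funpow_inj: "x \<in> R \<Longrightarrow> y \<in> R \<Longrightarrow> (\<psi> ^^ k) x = (\<psi> ^^ k) y \<Longrightarrow> x = y"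
proof (induction k)
  case (Suc k)
  let ?x = "(\<psi> ^^ k) x" and ?y = "(\<psi> ^^ k) y"
  have xy: "?x \<in> R" "?y \<in> R" "- ?y \<in> R" using Suc.prems \<psi>_funpow_R Rs(3) by auto
  have "\<psi> (- ?y) + \<psi> ?y = 0" using \<psi>_add[OF xy(3,2)] \<psi>_zero by simp
  then have "\<psi> (?x + - ?y) = 0" using \<psi>_add[OF xy(1,3)] Suc.prems(3) by (simp add: add.commute)
  then have "?x + - ?y = 0" using \<psi>_inj Rs(4) xy by blast
  then show ?case using Suc by simp
qed simp

lemma \<psi>_funpow_const: "c \<in> C \<Longrightarrow> (\<psi> ^^ k) c = c"
  by (induction k) (auto simp: \<psi>_const)

lemma \<psi>_funpow_prod_powi:
  "(\<And>i. i \<in> I \<Longrightarrow> f i \<in> U) \<Longrightarrow> (\<psi> ^^ k) (\<Prod>i\<in>I. f i powi a i) = (\<Prod>i\<in>I. (\<psi> ^^ k) (f i) powi a i)"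
proof (induction k)
  case (Suc k)
  have "(\<psi> ^^ k) (f i) \<in> U" if "i \<in> I" for i using \<psi>_funpow_U Suc.prems that by blast
  then show ?case using Suc by (simp add: \<psi>_prod U_powi \<psi>_powi)
qed simp

lemma power_in_image:
  assumes x: "x \<in> U"
  obtains N z where "N > 0" "z \<in> U" "x ^ N = \<psi> z"
proof -
  have "\<exists>c e. c \<in> C \<and> (\<psi> ^^ k) x = c * (\<Prod>i\<le>n. u i powi e i)" for k
    using units[of "(\<psi> ^^ k) x"] \<psi>_funpow_U[OF x, of k] unfolding U_def by auto
  then obtain c e where ce: "\<And>k. c k \<in> C" "\<And>k. (\<psi> ^^ k) x = c k * (\<Prod>i\<le>n. u i powi e k i)" by metis
  obtain a where a: "\<exists>k\<in>{..Suc n}. a k \<noteq> 0" "\<forall>j\<in>{..n}. (\<Sum>k\<in>{..Suc n}. a k * e k j) = 0"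
    using integer_dependency[of "{..n}" "{..Suc n}" e] by auto
  define c0 where "c0 = (\<Prod>k\<le>Suc n. c k powi a k)"
  have c0C: "c0 \<in> C" unfolding c0_def by (rule C_prod) (rule C_powi[OF ce(1)])
  have "(\<Prod>k\<le>Suc n. (\<psi> ^^ k) x powi a k) = (\<Prod>k\<le>Suc n. c k powi a k * (\<Prod>i\<le>n. u i powi (a k * e k i)))"
  proof (rule prod.cong[OF refl])
    fix k
    have "(u i powi e k i) powi a k = u i powi (a k * e k i)" for i
      by (simp add: power_int_mult[symmetric] mult.commute)
    then show "(\<psi> ^^ k) x powi a k = c k powi a k * (\<Prod>i\<le>n. u i powi (a k * e k i))"
      unfolding ce(2) power_int_mult_distrib prod_powi by simp
  qed
  also have "\<dots> = c0 * (\<Prod>i\<le>n. \<Prod>k\<le>Suc n. u i powi (a k * e k i))"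
    unfolding c0_def prod.distrib by (subst prod.swap) (rule refl)
  also have "(\<Prod>i\<le>n. \<Prod>k\<le>Suc n. u i powi (a k * e k i)) = (\<Prod>i\<le>n. u i powi (\<Sum>k\<le>Suc n. a k * e k i))"
    by (intro prod.cong refl) (use u in \<open>auto simp: powi_sum simp del: sum.atMost_Suc prod.atMost_Suc\<close>)
  also have "\<dots> = 1" using a(2) by (intro prod.neutral) (auto simp del: sum.atMost_Suc)
  finally have rel: "(\<Prod>k\<le>Suc n. (\<psi> ^^ k) x powi a k) = c0" by simp
  define k0 where "k0 = (LEAST k. a k \<noteq> 0)"
  have k0: "a k0 \<noteq> 0" "\<And>k. k < k0 \<Longrightarrow> a k = 0"
  proof -
    have "\<exists>k. a k \<noteq> 0" using a(1) by blast
    then show "a k0 \<noteq> 0" unfolding k0_def by (rule LeastI_ex)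
    show "a k = 0" if "k < k0" for k using not_less_Least[of k "\<lambda>k. a k \<noteq> 0"] that unfolding k0_def by blast
  qed
  have k0n: "k0 \<le> Suc n" 
  proof -
    obtain k where "k \<le> Suc n" "a k \<noteq> 0" using a(1) by auto
    then have "k0 \<le> k" using k0(2)[of k] by (meson linorder_not_less)
    then show ?thesis using \<open>k \<le> Suc n\<close> by simp
  qed
  define y where "y = (\<Prod>k\<in>{k0..Suc n}. (\<psi> ^^ (k - k0)) x powi a k)"
  have yU: "y \<in> U" unfolding y_def by (intro U_prod U_powi \<psi>_funpow_U x)
  have "(\<psi> ^^ k0) y = (\<Prod>k\<in>{k0..Suc n}. (\<psi> ^^ k0) ((\<psi> ^^ (k - k0)) x) powi a k)"
    unfolding y_def by (rule \<psi>_funpow_prod_powi) (rule \<psi>_funpow_U[OF x])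
  also have "\<dots> = (\<Prod>k\<in>{k0..Suc n}. (\<psi> ^^ k) x powi a k)"
  proof (rule prod.cong[OF refl])
    fix k assume "k \<in> {k0..Suc n}"
    then have "(\<psi> ^^ k0) ((\<psi> ^^ (k - k0)) x) = (\<psi> ^^ k) x"
      by (metis atLeastAtMost_iff comp_apply funpow_add le_add_diff_inverse)
    then show "(\<psi> ^^ k0) ((\<psi> ^^ (k - k0)) x) powi a k = (\<psi> ^^ k) x powi a k" by simp
  qed
  also have "\<dots> = (\<Prod>k\<le>Suc n. (\<psi> ^^ k) x powi a k)"
    by (rule prod.mono_neutral_left) (use k0(2) in auto)
  finally have "(\<psi> ^^ k0) y = (\<psi> ^^ k0) c0" using rel \<psi>_funpow_const[OF c0C] by simp
  then have yc: "y = c0" using \<psi>_funpow_inj[of y c0 k0] yU CR c0C unfolding U_def by auto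
  define z where "z = (\<Prod>k\<in>{Suc k0..Suc n}. (\<psi> ^^ (k - Suc k0)) x powi a k)"
  have zU: "z \<in> U" unfolding z_def by (intro U_prod U_powi \<psi>_funpow_U x)
  have "\<psi> z = (\<Prod>k\<in>{Suc k0..Suc n}. \<psi> ((\<psi> ^^ (k - Suc k0)) x) powi a k)"
    using \<psi>_funpow_prod_powi[of "{Suc k0..Suc n}" "\<lambda>k. (\<psi> ^^ (k - Suc k0)) x" 1 a] \<psi>_funpow_U[OF x]
    unfolding z_def by simp
  also have "\<dots> = (\<Prod>k\<in>{Suc k0..Suc n}. (\<psi> ^^ (k - k0)) x powi a k)"
  proof (rule prod.cong[OF refl])
    fix k assume "k \<in> {Suc k0..Suc n}"
    then have "k - k0 = Suc (k - Suc k0)" by auto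
    then show "\<psi> ((\<psi> ^^ (k - Suc k0)) x) powi a k = (\<psi> ^^ (k - k0)) x powi a k" by simp
  qed
  finally have "y = x powi a k0 * \<psi> z"
    unfolding y_def using k0n by (simp add: prod.atLeast_Suc_atMost del: prod.cl_ivl_Suc)
  then have xa: "x powi a k0 * \<psi> z = \<psi> c0" using yc \<psi>_const[OF c0C] by simp
  have c0U: "c0 \<in> U" using yU yc by simp
  have iz: "inverse z * c0 \<in> U" using U_mult U_inverse zU c0U by blast
  have zi: "\<psi> (inverse z * c0) = inverse (\<psi> z) * \<psi> c0"
    using \<psi>_mult[of "inverse z" c0] \<psi>_inverse[OF zU] U_inverse[OF zU] c0U unfolding U_def by simp
  have "\<psi> z \<noteq> 0" using \<psi>_U[OF zU] unfolding U_def by auto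
  then have xa': "x powi a k0 = \<psi> (inverse z * c0)" unfolding zi xa[symmetric] by simp
  show ?thesis
  proof (cases "a k0 > 0")
    case True
    then have "x ^ nat (a k0) = \<psi> (inverse z * c0)" using xa' by (simp add: power_int_def)
    then show ?thesis using that[of "nat (a k0)"] True iz by auto
  next
    case False
    then have "x ^ nat (- a k0) = inverse (x powi a k0)" using k0(1)
      by (simp add: power_int_def power_inverse)
    then have "x ^ nat (- a k0) = \<psi> (inverse (inverse z * c0))" using xa' \<psi>_inverse[OF iz] by simp
    then show ?thesis using that[of "nat (- a k0)"] False k0(1) U_inverse[OF iz] by auto
  qed
qed

theorem finite_over_image:
  obtains B where "finite B" "B \<subseteq> R" "\<And>x. x \<in> R \<Longrightarrow> \<exists>w\<in>B \<rightarrow> R. x = (\<Sum>b\<in>B. \<psi> (w b) * b)"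
proof -
  have uU: "u i \<in> U" if "i \<le> n" for i using u[OF that] unfolding U_def by auto
  have "\<exists>N z. i \<le> n \<longrightarrow> N > 0 \<and> z \<in> U \<and> u i ^ N = \<psi> z" for i
    using power_in_image[OF uU, of i] by metis
  then obtain N z where Nz: "\<And>i. i \<le> n \<Longrightarrow> N i > 0 \<and> z i \<in> U \<and> u i ^ N i = \<psi> (z i)" by metis
  define mon where "mon r = (\<Prod>i\<le>n. u i ^ r i)" for r :: "nat \<Rightarrow> nat"
  define B where "B = mon ` (\<Pi>\<^sub>E i\<in>{..n}. {..<N i})"
  have finB: "finite B" unfolding B_def by (intro finite_imageI finite_PiE) auto
  have BU: "B \<subseteq> U" unfolding B_def mon_def using U_prod[of "{..n}"] U_power uU by auto
  then have BR: "B \<subseteq> R" unfolding U_def by auto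
  define Q where "Q = {x. \<exists>w\<in>B \<rightarrow> R. x = (\<Sum>b\<in>B. \<psi> (w b) * b)}"
  have "R \<subseteq> Q"
  proof (rule generated)
    show "0 \<in> Q" unfolding Q_def using Rs(1) \<psi>_zero by (auto intro!: bexI[of _ "\<lambda>_. 0"])
    fix x y assume "x \<in> Q" "y \<in> Q"
    then obtain w w' where w: "w \<in> B \<rightarrow> R" "x = (\<Sum>b\<in>B. \<psi> (w b) * b)"
      and w': "w' \<in> B \<rightarrow> R" "y = (\<Sum>b\<in>B. \<psi> (w' b) * b)" unfolding Q_def by blast
    have "x + y = (\<Sum>b\<in>B. \<psi> (w b + w' b) * b)"
      unfolding w(2) w'(2) sum.distrib[symmetric]
    proof (rule sum.cong[OF refl])
      fix b assume "b \<in> B"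
      then show "\<psi> (w b) * b + \<psi> (w' b) * b = \<psi> (w b + w' b) * b"
        using \<psi>_add[OF funcset_mem[OF w(1)] funcset_mem[OF w'(1)]] by (simp add: distrib_right)
    qed
    moreover have "(\<lambda>b. w b + w' b) \<in> B \<rightarrow> R" using w(1) w'(1) Rs(4) by auto
    ultimately show "x + y \<in> Q" unfolding Q_def by (intro CollectI bexI[of _ "\<lambda>b. w b + w' b"])
  next
    fix c and e :: "nat \<Rightarrow> int" assume c: "c \<in> C"
    define r where "r i = (if i \<le> n then nat (e i mod int (N i)) else undefined)" for i
    define y where "y = c * (\<Prod>i\<le>n. z i powi (e i div int (N i)))"
    have zU: "(\<Prod>i\<le>n. z i powi (e i div int (N i))) \<in> U" using Nz by (intro U_prod U_powi) auto
    have yR: "y \<in> R" unfolding y_def using zU c CR Rs(5) unfolding U_def by auto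
    have rB: "mon r \<in> B"
      unfolding B_def by (rule imageI) (use Nz in \<open>auto simp: r_def PiE_iff extensional_def nat_less_iff\<close>)
    have "u i powi e i = \<psi> (z i) powi (e i div int (N i)) * u i ^ r i" if i: "i \<le> n" for i
    proof -
      have "u i powi e i = u i powi (int (N i) * (e i div int (N i)) + e i mod int (N i))" by simp
      also have "\<dots> = (u i powi int (N i)) powi (e i div int (N i)) * u i powi (e i mod int (N i))"
        by (simp only: power_int_add[OF disjI1[OF conjunct1[OF conjunct2[OF u[OF i]]]]] power_int_mult)
      also have "u i powi (e i mod int (N i)) = u i ^ r i"
        using Nz[OF i] i by (simp add: r_def power_int_def)
      finally show ?thesis using Nz[OF i] by simp
    qed
    then have "(\<Prod>i\<le>n. u i powi e i) = (\<Prod>i\<le>n. \<psi> (z i) powi (e i div int (N i))) * mon r"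
      unfolding mon_def prod.distrib[symmetric] by (intro prod.cong) auto
    also have "(\<Prod>i\<le>n. \<psi> (z i) powi (e i div int (N i))) = \<psi> (\<Prod>i\<le>n. z i powi (e i div int (N i)))"
      using Nz \<psi>_funpow_prod_powi[of "{..n}" z 1] by simp
    finally have "c * (\<Prod>i\<le>n. u i powi e i) = \<psi> y * mon r"
      using \<psi>_mult[of c "\<Prod>i\<le>n. z i powi (e i div int (N i))"] c CR zU \<psi>_const[OF c]
      unfolding y_def U_def by (auto simp: mult.assoc)
    also have "\<dots> = (\<Sum>b\<in>B. \<psi> (if b = mon r then y else 0) * b)"
      using finB rB \<psi>_zero by (simp add: if_distrib[of \<psi>] if_distrib[of "\<lambda>x. x * _"] sum.delta cong: if_cong)
    finally show "c * (\<Prod>i\<le>n. u i powi e i) \<in> Q"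
      unfolding Q_def using yR Rs(1) by (auto intro!: bexI[of _ "\<lambda>b. if b = mon r then y else 0"])
  qed
  then show ?thesis using that[OF finB BR] unfolding Q_def by blast
qed

end

section \<open>Evaluation of polynomials\<close>

definition monomial_eval :: "('w \<Rightarrow> 'r::comm_ring_1) \<Rightarrow> ('w \<Rightarrow>\<^sub>0 nat) \<Rightarrow> 'r" where
  "monomial_eval v m = (\<Prod>w\<in>Poly_Mapping.keys m. v w ^ Poly_Mapping.lookup m w)"

definition mpoly_eval :: "('k::comm_ring_1 \<Rightarrow> 'r::comm_ring_1) \<Rightarrow> ('w \<Rightarrow> 'r) \<Rightarrow> ('w, 'k) mpoly \<Rightarrow> 'r" where
  "mpoly_eval g v p = (\<Sum>m\<in>Poly_Mapping.keys p. g (Poly_Mapping.lookup p m) * monomial_eval v m)"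

definition mdeg :: "('w \<Rightarrow>\<^sub>0 nat) \<Rightarrow> nat" where
  "mdeg m = (\<Sum>w\<in>Poly_Mapping.keys m. Poly_Mapping.lookup m w)"

lemma mpoly_homogeneous_iff: "mpoly_homogeneous k p \<longleftrightarrow> (\<forall>m\<in>Poly_Mapping.keys p. mdeg m = k)"
  unfolding mpoly_homogeneous_def mdeg_def ..

lemma monomial_eval_superset:
  "finite A \<Longrightarrow> Poly_Mapping.keys m \<subseteq> A \<Longrightarrow> monomial_eval v m = (\<Prod>w\<in>A. v w ^ Poly_Mapping.lookup m w)"
  unfolding monomial_eval_def by (rule prod.mono_neutral_left) (auto simp: in_keys_iff)

lemma monomial_eval_add: "monomial_eval v (m + m') = monomial_eval v m * monomial_eval v m'"
  using monomial_eval_superset[of "Poly_Mapping.keys m \<union> Poly_Mapping.keys m'" m v]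
    monomial_eval_superset[of "Poly_Mapping.keys m \<union> Poly_Mapping.keys m'" m' v]
    monomial_eval_superset[of "Poly_Mapping.keys m \<union> Poly_Mapping.keys m'" "m + m'" v]
    Poly_Mapping.keys_add[of m m']
  by (simp add: lookup_add power_add prod.distrib)

lemma monomial_eval_zero [simp]: "monomial_eval v 0 = 1"
  unfolding monomial_eval_def by simp

lemma monomial_eval_single [simp]: "monomial_eval v (Poly_Mapping.single w k) = v w ^ k"
  unfolding monomial_eval_def by (cases "k = 0") auto

lemma mdeg_superset:
  "finite A \<Longrightarrow> Poly_Mapping.keys m \<subseteq> A \<Longrightarrow> mdeg m = (\<Sum>w\<in>A. Poly_Mapping.lookup m w)"
  unfolding mdeg_def by (rule sum.mono_neutral_left) (auto simp: in_keys_iff)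

lemma mdeg_add: "mdeg (m + m') = mdeg m + mdeg m'"
  using mdeg_superset[of "Poly_Mapping.keys m \<union> Poly_Mapping.keys m'" m]
    mdeg_superset[of "Poly_Mapping.keys m \<union> Poly_Mapping.keys m'" m']
    mdeg_superset[of "Poly_Mapping.keys m \<union> Poly_Mapping.keys m'" "m + m'"]
    Poly_Mapping.keys_add[of m m']
  by (simp add: lookup_add sum.distrib)

lemma mdeg_zero [simp]: "mdeg 0 = 0"
  unfolding mdeg_def by simp

lemma mdeg_single [simp]: "mdeg (Poly_Mapping.single w k) = k"
  unfolding mdeg_def by (cases "k = 0") auto

lemma mdeg_eq_0_iff: "mdeg m = 0 \<longleftrightarrow> m = 0"
  unfolding mdeg_def by (auto simp: poly_mapping_eq_iff fun_eq_iff in_keys_iff)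

lemma sum_of_singles: "p = (\<Sum>m\<in>Poly_Mapping.keys p. Poly_Mapping.single m (Poly_Mapping.lookup p m))"
  by (rule poly_mapping_eqI)
    (simp add: Poly_Mapping.lookup_sum lookup_single when_def sum.delta' in_keys_iff)

lemma single_monomial:
  "Poly_Mapping.single m c = mpoly_const c * monomial_eval mpoly_var m" for c :: "'k::comm_ring_1"
proof -
  have var_pow: "mpoly_var w ^ k = Poly_Mapping.single (Poly_Mapping.single w k) (1::'k)" for w :: 'a and k
    unfolding mpoly_var_def by (induction k) (simp_all add: mult_single single_add[symmetric])
  have "(\<Prod>w\<in>A. Poly_Mapping.single (Poly_Mapping.single w (k w)) (1::'k)) =
      Poly_Mapping.single (\<Sum>w\<in>A. Poly_Mapping.single w (k w)) 1" for A and k :: "'a \<Rightarrow> nat"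
    by (induction A rule: infinite_finite_induct) (simp_all add: mult_single)
  then have "monomial_eval mpoly_var m = Poly_Mapping.single m (1::'k)"
    unfolding monomial_eval_def var_pow using sum_of_singles[of m] by simp
  then show ?thesis by (simp add: mpoly_const_def mult_single)
qed

lemma mpoly_add_induct [case_names single add]:
  assumes "\<And>m c. Q (Poly_Mapping.single m c)" "\<And>p q. Q p \<Longrightarrow> Q q \<Longrightarrow> Q (p + q)"
  shows "Q (p :: ('w, 'k::comm_ring_1) mpoly)"
proof -
  have "Q (\<Sum>m\<in>A. Poly_Mapping.single m (c m))" for A and c :: "('w \<Rightarrow>\<^sub>0 nat) \<Rightarrow> 'k"
    using assms(1)[of 0 0] by (induction A rule: infinite_finite_induct) (auto intro: assms)
  then show ?thesis using sum_of_singles[of p] by metis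
qed

locale coefficient_hom =
  fixes g :: "'k::comm_ring_1 \<Rightarrow> 'r::comm_ring_1"
  assumes g_add: "g (a + b) = g a + g b" and g_mult: "g (a * b) = g a * g b" and g_one: "g 1 = 1"
begin

lemma g_zero: "g 0 = 0"
  using g_add[of 0 0] by (metis add_cancel_right_right add_0)

lemma eval_superset: "finite A \<Longrightarrow> Poly_Mapping.keys p \<subseteq> A \<Longrightarrow>
    mpoly_eval g v p = (\<Sum>m\<in>A. g (Poly_Mapping.lookup p m) * monomial_eval v m)"
  unfolding mpoly_eval_def by (rule sum.mono_neutral_left) (auto simp: in_keys_iff g_zero)

lemma eval_add: "mpoly_eval g v (p + q) = mpoly_eval g v p + mpoly_eval g v q"
  using eval_superset[of "Poly_Mapping.keys p \<union> Poly_Mapping.keys q" p v]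
    eval_superset[of "Poly_Mapping.keys p \<union> Poly_Mapping.keys q" q v]
    eval_superset[of "Poly_Mapping.keys p \<union> Poly_Mapping.keys q" "p + q" v]
    Poly_Mapping.keys_add[of p q]
  by (simp add: lookup_add g_add distrib_right sum.distrib)

lemma eval_single: "mpoly_eval g v (Poly_Mapping.single m c) = g c * monomial_eval v m"
  unfolding mpoly_eval_def by (cases "c = 0") (auto simp: g_zero)

lemma eval_zero: "mpoly_eval g v 0 = 0"
  unfolding mpoly_eval_def by simp

lemma eval_mult: "mpoly_eval g v (p * q) = mpoly_eval g v p * mpoly_eval g v q"
proof (induction p rule: mpoly_add_induct)
  case (single m c)
  show ?case
  proof (induction q rule: mpoly_add_induct)
    case (single m' c')
    show ?case by (simp add: mult_single eval_single monomial_eval_add g_mult algebra_simps)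
  qed (simp add: distrib_left eval_add)
qed (simp add: distrib_right eval_add)

lemma eval_const: "mpoly_eval g v (mpoly_const c) = g c"
  unfolding mpoly_const_def by (simp add: eval_single)

lemma eval_var: "mpoly_eval g v (mpoly_var w) = v w"
  unfolding mpoly_var_def by (simp add: eval_single g_one)

lemma eval_one: "mpoly_eval g v 1 = 1"
  using eval_const[of v 1] by (simp add: mpoly_const_def g_one)

lemma eval_diff: "mpoly_eval g v (p - q) = mpoly_eval g v p - mpoly_eval g v q"
  using eval_add[of v "p - q" q] by simp

lemma eval_sum: "mpoly_eval g v (\<Sum>i\<in>I. f i) = (\<Sum>i\<in>I. mpoly_eval g v (f i))"
  by (induction I rule: infinite_finite_induct) (auto simp: eval_zero eval_add)

end

lemma mpoly_const_hom: "mpoly_const (a + b) = mpoly_const a + mpoly_const b"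
  "mpoly_const (a * b) = mpoly_const a * mpoly_const b" "mpoly_const 1 = 1" "mpoly_const 0 = 0"
  unfolding mpoly_const_def by (simp_all add: single_add mult_single)

interpretation const_hom: coefficient_hom mpoly_const
  by unfold_locales (simp_all add: mpoly_const_hom)

section \<open>The polynomial ring on a set of indeterminates\<close>

lemma mpoly_ring_simps:
  "x \<otimes>\<^bsub>mpoly_ring W\<^esub> y = x * y" "x \<oplus>\<^bsub>mpoly_ring W\<^esub> y = x + y"
  "\<one>\<^bsub>mpoly_ring W\<^esub> = 1" "\<zero>\<^bsub>mpoly_ring W\<^esub> = 0"
  unfolding mpoly_ring_def ring_of_type_algebra_def by simp_all

lemma carrier_mpoly_ring: "p \<in> carrier (mpoly_ring W) \<longleftrightarrow> (\<forall>m\<in>Poly_Mapping.keys p. Poly_Mapping.keys m \<subseteq> W)"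
  unfolding mpoly_ring_def by simp

lemma mpoly_ring_closed:
  "p \<in> carrier (mpoly_ring W) \<Longrightarrow> q \<in> carrier (mpoly_ring W) \<Longrightarrow> p + q \<in> carrier (mpoly_ring W)"
  "p \<in> carrier (mpoly_ring W) \<Longrightarrow> q \<in> carrier (mpoly_ring W) \<Longrightarrow> p * q \<in> carrier (mpoly_ring W)"
  "p \<in> carrier (mpoly_ring W) \<Longrightarrow> - p \<in> carrier (mpoly_ring W)"
  "p \<in> carrier (mpoly_ring W) \<Longrightarrow> q \<in> carrier (mpoly_ring W) \<Longrightarrow> p - q \<in> carrier (mpoly_ring W)"
  "mpoly_const c \<in> carrier (mpoly_ring W)"
  "w \<in> W \<Longrightarrow> mpoly_var w \<in> carrier (mpoly_ring W)"
  "0 \<in> carrier (mpoly_ring W)" "1 \<in> carrier (mpoly_ring W)"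
proof -
  show a: "p + q \<in> carrier (mpoly_ring W)" if "p \<in> carrier (mpoly_ring W)" "q \<in> carrier (mpoly_ring W)" for p q
    using that Poly_Mapping.keys_add[of p q] unfolding carrier_mpoly_ring by blast
  show "p * q \<in> carrier (mpoly_ring W)" if pq: "p \<in> carrier (mpoly_ring W)" "q \<in> carrier (mpoly_ring W)"
    unfolding carrier_mpoly_ring
  proof
    fix m assume "m \<in> Poly_Mapping.keys (p * q)"
    then obtain a b where "m = a + b" "a \<in> Poly_Mapping.keys p" "b \<in> Poly_Mapping.keys q"
      using Poly_Mapping.keys_mult[of p q] by blast
    then show "Poly_Mapping.keys m \<subseteq> W" using Poly_Mapping.keys_add[of a b] pq unfolding carrier_mpoly_ring by blast
  qed
  show u: "- p \<in> carrier (mpoly_ring W)" if "p \<in> carrier (mpoly_ring W)" for p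
    using that unfolding carrier_mpoly_ring by (auto simp: in_keys_iff)
  show "p - q \<in> carrier (mpoly_ring W)" if "p \<in> carrier (mpoly_ring W)" "q \<in> carrier (mpoly_ring W)"
    using a[OF that(1) u[OF that(2)]] by simp
qed (auto simp: carrier_mpoly_ring mpoly_const_def mpoly_var_def split: if_splits)

lemma cring_mpoly_ring: "cring (mpoly_ring W)"
proof (rule cringI)
  show "abelian_group (mpoly_ring W)"
  proof (rule abelian_groupI)
    fix x assume "x \<in> carrier (mpoly_ring W)"
    then show "\<exists>y\<in>carrier (mpoly_ring W). y \<oplus>\<^bsub>mpoly_ring W\<^esub> x = \<zero>\<^bsub>mpoly_ring W\<^esub>"
      using mpoly_ring_closed(3) by (intro bexI[of _ "- x"]) (auto simp: mpoly_ring_simps)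
  qed (auto simp: mpoly_ring_simps mpoly_ring_closed algebra_simps)
  show "Group.comm_monoid (mpoly_ring W)"
    by (rule comm_monoidI) (auto simp: mpoly_ring_simps mpoly_ring_closed algebra_simps)
qed (auto simp: mpoly_ring_simps algebra_simps)

lemma mpoly_ring_sum: "(\<And>i. i \<in> I \<Longrightarrow> f i \<in> carrier (mpoly_ring W)) \<Longrightarrow> (\<Sum>i\<in>I. f i) \<in> carrier (mpoly_ring W)"
  by (induction I rule: infinite_finite_induct) (auto simp: mpoly_ring_closed)

lemma mpoly_ring_induct [consumes 1, case_names const var add mult]:
  fixes p :: "('w, 'k::comm_ring_1) mpoly"
  assumes p: "p \<in> carrier (mpoly_ring W)"
    and const: "\<And>c. Q (mpoly_const c)" and var: "\<And>w. w \<in> W \<Longrightarrow> Q (mpoly_var w)"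
    and add: "\<And>p q. p \<in> carrier (mpoly_ring W) \<Longrightarrow> q \<in> carrier (mpoly_ring W) \<Longrightarrow> Q p \<Longrightarrow> Q q \<Longrightarrow> Q (p + q)"
    and mult: "\<And>p q. p \<in> carrier (mpoly_ring W) \<Longrightarrow> q \<in> carrier (mpoly_ring W) \<Longrightarrow> Q p \<Longrightarrow> Q q \<Longrightarrow> Q (p * q)"
  shows "Q p"
proof -
  have "1 = mpoly_const 1" "0 = mpoly_const 0" by (simp_all add: mpoly_const_hom)
  then have one: "Q 1" and zero: "Q 0" using const by metis+
  have pow: "Q (q ^ k) \<and> q ^ k \<in> carrier (mpoly_ring W)" if "q \<in> carrier (mpoly_ring W)" "Q q" for q k
    using that by (induction k) (auto simp: one mult mpoly_ring_closed)
  have prod: "(\<And>i. i \<in> A \<Longrightarrow> Q (f i) \<and> f i \<in> carrier (mpoly_ring W)) \<Longrightarrow>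
      Q (\<Prod>i\<in>A. f i) \<and> (\<Prod>i\<in>A. f i) \<in> carrier (mpoly_ring W)" for A and f :: "'w \<Rightarrow> ('w, 'k) mpoly"
    by (induction A rule: infinite_finite_induct) (auto simp: one mult mpoly_ring_closed)
  have sum: "(\<And>i. i \<in> A \<Longrightarrow> Q (f i) \<and> f i \<in> carrier (mpoly_ring W)) \<Longrightarrow>
      Q (\<Sum>i\<in>A. f i) \<and> (\<Sum>i\<in>A. f i) \<in> carrier (mpoly_ring W)" for A and f :: "('w \<Rightarrow>\<^sub>0 nat) \<Rightarrow> ('w, 'k) mpoly"
    by (induction A rule: infinite_finite_induct) (auto simp: zero add mpoly_ring_closed)
  have "Q (Poly_Mapping.single m c) \<and> Poly_Mapping.single m c \<in> carrier (mpoly_ring W)"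
    if m: "Poly_Mapping.keys m \<subseteq> W" for m c
  proof -
    have "Q (monomial_eval mpoly_var m) \<and> (monomial_eval mpoly_var m :: ('w, 'k) mpoly) \<in> carrier (mpoly_ring W)"
      unfolding monomial_eval_def
    proof (rule prod)
      fix w assume "w \<in> Poly_Mapping.keys m"
      then have "w \<in> W" using m by auto
      then show "Q (mpoly_var w ^ Poly_Mapping.lookup m w) \<and> (mpoly_var w ^ Poly_Mapping.lookup m w :: ('w, 'k) mpoly) \<in> carrier (mpoly_ring W)"
        using pow[OF mpoly_ring_closed(6) var] by blast
    qed
    then show ?thesis unfolding single_monomial using mult const mpoly_ring_closed(2,5) by blast
  qed
  then have "Q (\<Sum>m\<in>Poly_Mapping.keys p. Poly_Mapping.single m (Poly_Mapping.lookup p m))"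
    using sum[of "Poly_Mapping.keys p" "\<lambda>m. Poly_Mapping.single m (Poly_Mapping.lookup p m)"] p
    unfolding carrier_mpoly_ring by blast
  then show ?thesis using sum_of_singles[of p] by metis
qed

lemma eval_closed:
  assumes p: "p \<in> carrier (mpoly_ring W)" and v: "\<And>w. w \<in> W \<Longrightarrow> v w \<in> carrier (mpoly_ring W')"
  shows "mpoly_eval mpoly_const v p \<in> carrier (mpoly_ring W')"
  using p by (induction rule: mpoly_ring_induct)
    (auto simp: const_hom.eval_const const_hom.eval_var const_hom.eval_add const_hom.eval_mult mpoly_ring_closed v)

lemma homogeneous_closed:
  "mpoly_homogeneous k p \<Longrightarrow> mpoly_homogeneous k q \<Longrightarrow> mpoly_homogeneous k (p + q)"
  "mpoly_homogeneous j p \<Longrightarrow> mpoly_homogeneous k q \<Longrightarrow> mpoly_homogeneous (j + k) (p * q)"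
  "mpoly_homogeneous 0 (mpoly_const c)" "mpoly_homogeneous 1 (mpoly_var w)" "mpoly_homogeneous k 0"
proof -
  show "mpoly_homogeneous k (p + q)" if "mpoly_homogeneous k p" "mpoly_homogeneous k q"
    using that Poly_Mapping.keys_add[of p q] unfolding mpoly_homogeneous_iff by blast
  show "mpoly_homogeneous (j + k) (p * q)" if pq: "mpoly_homogeneous j p" "mpoly_homogeneous k q"
    unfolding mpoly_homogeneous_iff
  proof
    fix m assume "m \<in> Poly_Mapping.keys (p * q)"
    then obtain a b where "m = a + b" "a \<in> Poly_Mapping.keys p" "b \<in> Poly_Mapping.keys q"
      using Poly_Mapping.keys_mult[of p q] by blast
    then show "mdeg m = j + k" using pq unfolding mpoly_homogeneous_iff by (auto simp: mdeg_add)
  qed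
qed (auto simp: mpoly_homogeneous_iff mpoly_const_def mpoly_var_def split: if_splits)

lemma homogeneous_sum: "(\<And>i. i \<in> I \<Longrightarrow> mpoly_homogeneous k (f i)) \<Longrightarrow> mpoly_homogeneous k (\<Sum>i\<in>I. f i)"
  by (induction I rule: infinite_finite_induct) (auto simp: homogeneous_closed)

lemma homogeneous_power: "mpoly_homogeneous 1 p \<Longrightarrow> mpoly_homogeneous k (p ^ k)"
  using homogeneous_closed(3)[of 1] homogeneous_closed(2)[of 1 p]
  by (induction k) (auto simp: mpoly_const_hom)

lemma homogeneous_prod:
  "(\<And>i. i \<in> I \<Longrightarrow> mpoly_homogeneous (k i) (f i)) \<Longrightarrow> mpoly_homogeneous (\<Sum>i\<in>I. k i) (\<Prod>i\<in>I. f i)"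
  using homogeneous_closed(3)[of 1]
  by (induction I rule: infinite_finite_induct) (auto simp: mpoly_const_hom homogeneous_closed(2))

lemma eval_homogeneous:
  assumes p: "p \<in> carrier (mpoly_ring W)" "mpoly_homogeneous k p"
    and v: "\<And>w. w \<in> W \<Longrightarrow> mpoly_homogeneous 1 (v w)"
  shows "mpoly_homogeneous k (mpoly_eval mpoly_const v p)"
  unfolding mpoly_eval_def
proof (rule homogeneous_sum)
  fix m assume m: "m \<in> Poly_Mapping.keys p"
  have "mpoly_homogeneous (mdeg m) (monomial_eval v m)"
    unfolding mdeg_def monomial_eval_def
    by (intro homogeneous_prod homogeneous_power v) (use m p in \<open>auto simp: carrier_mpoly_ring\<close>)
  then show "mpoly_homogeneous k (mpoly_const (Poly_Mapping.lookup p m) * monomial_eval v m)"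
    using homogeneous_closed(2)[OF homogeneous_closed(3)] m p(2) unfolding mpoly_homogeneous_iff by fastforce
qed

definition mpoly_component :: "nat \<Rightarrow> ('w, 'k::comm_ring_1) mpoly \<Rightarrow> ('w, 'k) mpoly" where
  "mpoly_component k p = (\<Sum>m\<in>{m \<in> Poly_Mapping.keys p. mdeg m = k}. Poly_Mapping.single m (Poly_Mapping.lookup p m))"

lemma lookup_component:
  "Poly_Mapping.lookup (mpoly_component k p) m = (if mdeg m = k then Poly_Mapping.lookup p m else 0)"
  unfolding mpoly_component_def
  by (simp add: Poly_Mapping.lookup_sum lookup_single when_def sum.delta' in_keys_iff)

lemma keys_component: "Poly_Mapping.keys (mpoly_component k p) = {m \<in> Poly_Mapping.keys p. mdeg m = k}"
  by (auto simp: in_keys_iff lookup_component split: if_splits)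

definition grading_hom :: "('w::linorder, 'k::field) mpoly \<Rightarrow> ('w, 'k) mpoly fract Polynomial.poly" where
  "grading_hom = mpoly_eval (\<lambda>c. [:Fract (mpoly_const c) 1:]) (\<lambda>i. Polynomial.monom (Fract (mpoly_var i) 1) 1)"

interpretation grading: coefficient_hom "\<lambda>c. [:Fract (mpoly_const c :: ('w::linorder, 'k::field) mpoly) 1:]"
  by unfold_locales (simp_all add: mpoly_const_hom One_fract_def[symmetric] pCons_one mult.commute)

lemma Fract_hom: "Fract (a + b) 1 = Fract a 1 + Fract b 1" "Fract (a * b) 1 = Fract a 1 * Fract b 1"
  "Fract 1 1 = 1" "Fract 0 1 = 0" "Fract a 1 = Fract b 1 \<longleftrightarrow> a = b"
  for a b :: "'a::idom"
  by (simp_all add: One_fract_def[symmetric] Zero_fract_def[symmetric] eq_fract)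

lemma Fract_sum: "Fract (\<Sum>i\<in>I. f i) 1 = (\<Sum>i\<in>I. Fract (f i) (1::'a::idom))"
  by (induction I rule: infinite_finite_induct) (auto simp: Fract_hom simp del: add_fract)

lemma Fract_prod: "Fract (\<Prod>i\<in>I. f i) 1 = (\<Prod>i\<in>I. Fract (f i) (1::'a::idom))"
  by (induction I rule: infinite_finite_induct) (auto simp: Fract_hom simp del: mult_fract)

lemma Fract_power: "Fract (a ^ k) 1 = Fract a (1::'a::idom) ^ k"
  by (induction k) (auto simp: Fract_hom simp del: mult_fract)

lemma monom_prod: "(\<Prod>i\<in>I. Polynomial.monom (f i) (k i)) = Polynomial.monom (\<Prod>i\<in>I. f i) (\<Sum>i\<in>I. k i)"
  for f :: "'i \<Rightarrow> 'a::comm_ring_1"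
  by (induction I rule: infinite_finite_induct) (auto simp: mult_monom one_poly_eq_simps(2) simp flip: monom_0)

lemma grading_hom_eq: "grading_hom p =
   (\<Sum>m\<in>Poly_Mapping.keys p. Polynomial.monom (Fract (Poly_Mapping.single m (Poly_Mapping.lookup p m)) 1) (mdeg m))"
  unfolding grading_hom_def mpoly_eval_def
proof (rule sum.cong[OF refl])
  fix m
  have "monomial_eval (\<lambda>i. Polynomial.monom (Fract (mpoly_var i) 1) 1) m =
     Polynomial.monom (Fract (monomial_eval mpoly_var m) (1::('a, 'b) mpoly)) (mdeg m)"
    unfolding monomial_eval_def mdeg_def by (simp add: monom_power monom_prod Fract_prod Fract_power)
  then show "[:Fract (mpoly_const (Poly_Mapping.lookup p m)) 1:] * monomial_eval (\<lambda>i. Polynomial.monom (Fract (mpoly_var i) 1) 1) m =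
      Polynomial.monom (Fract (Poly_Mapping.single m (Poly_Mapping.lookup p m)) 1) (mdeg m)"
    unfolding single_monomial by (simp add: smult_monom)
qed

lemma coeff_grading_hom: "Polynomial.coeff (grading_hom p) k = Fract (mpoly_component k p) 1"
proof -
  have "Polynomial.coeff (grading_hom p) k =
      (\<Sum>m\<in>Poly_Mapping.keys p. if mdeg m = k then Fract (Poly_Mapping.single m (Poly_Mapping.lookup p m)) 1 else 0)"
    unfolding grading_hom_eq by (simp add: coeff_sum)
  also have "\<dots> = (\<Sum>m\<in>{m \<in> Poly_Mapping.keys p. mdeg m = k}. Fract (Poly_Mapping.single m (Poly_Mapping.lookup p m)) 1)"
    by (simp add: sum.inter_filter)
  finally show ?thesis unfolding mpoly_component_def Fract_sum .
qed

lemma eval_grading_hom: "Polynomial.poly (grading_hom p) 1 = Fract p 1"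
proof -
  have "Polynomial.poly (grading_hom p) 1 =
      (\<Sum>m\<in>Poly_Mapping.keys p. Fract (Poly_Mapping.single m (Poly_Mapping.lookup p m)) 1)"
    unfolding grading_hom_eq by (simp add: poly_sum poly_monom)
  then show ?thesis using sum_of_singles[of p] Fract_sum by metis
qed

lemma homogeneous_iff_grading_hom: "mpoly_homogeneous k p \<longleftrightarrow> (\<exists>x. grading_hom p = Polynomial.monom x k)"
proof
  assume "mpoly_homogeneous k p"
  then have "mpoly_component j p = (if j = k then p else 0)" for j
    unfolding mpoly_homogeneous_iff by (intro poly_mapping_eqI) (auto simp: lookup_component in_keys_iff)
  then have "grading_hom p = Polynomial.monom (Fract p 1) k"
    by (intro poly_eqI) (auto simp: coeff_grading_hom Fract_hom)
  then show "\<exists>x. grading_hom p = Polynomial.monom x k" by blast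
next
  assume "\<exists>x. grading_hom p = Polynomial.monom x k"
  then obtain x where x: "grading_hom p = Polynomial.monom x k" by blast
  have "Fract (mpoly_component k p) 1 = Fract p 1"
    using coeff_grading_hom[of p k] eval_grading_hom[of p] unfolding x by (simp add: poly_monom)
  then have "mpoly_component k p = p" by (simp only: Fract_hom)
  then show "mpoly_homogeneous k p"
    using keys_component[of k p] unfolding mpoly_homogeneous_iff by auto
qed

section \<open>Dual bases\<close>

lemma dual_space_iff:
  assumes "vector_space scale"
  shows "\<phi> \<in> dual_space scale \<longleftrightarrow>
    (\<forall>x y. \<phi> (x + y) = \<phi> x + \<phi> y) \<and> (\<forall>c x. \<phi> (scale c x) = c * \<phi> x)"
proof -
  have "vector_space ((*) :: 'a \<Rightarrow> 'a \<Rightarrow> 'a)" by unfold_locales (simp_all add: algebra_simps)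
  then show ?thesis using assms unfolding dual_space_def Vector_Spaces.linear_iff by simp
qed

locale dual_basis =
  fixes scale :: "'k::field \<Rightarrow> 'v::ab_group_add \<Rightarrow> 'v" and d :: nat and e :: "nat \<Rightarrow> 'v" and co :: "nat \<Rightarrow> 'v \<Rightarrow> 'k"
  assumes vector_space: "vector_space scale"
    and co_dual: "i \<le> d \<Longrightarrow> co i \<in> dual_space scale"
    and co_e: "i \<le> d \<Longrightarrow> j \<le> d \<Longrightarrow> co i (e j) = (if i = j then 1 else 0)"
    and expand: "v = (\<Sum>i\<le>d. scale (co i v) (e i))"

lemma dual_basis_exists:
  fixes scale :: "'k::field \<Rightarrow> 'v::ab_group_add \<Rightarrow> 'v"
  assumes V: "vector_space scale" and dim: "vector_space.dim scale (UNIV :: 'v set) = d + 1"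
    and l: "l \<in> dual_space scale" "l \<noteq> (\<lambda>_. 0)"
  obtains e co where "dual_basis scale d e co" "co 0 = l"
proof -
  interpret V: vector_space scale by (rule V)
  have l_lin: "l (x + y) = l x + l y" "l (scale c x) = c * l x" for x y c
    using l(1) unfolding dual_space_iff[OF V] by auto
  obtain v1 where "l v1 \<noteq> 0" using l(2) by auto
  define v0 where "v0 = scale (inverse (l v1)) v1"
  have v0: "l v0 = 1" unfolding v0_def l_lin using \<open>l v1 \<noteq> 0\<close> by simp
  define N where "N = {v. l v = 0}"
  have l0: "l 0 = 0" using l_lin(2)[of 0 0] V.scale_zero_left[of 0] by simp
  have subN: "V.subspace N" unfolding N_def V.subspace_def by (auto simp: l_lin l0)
  obtain B0 where B0: "B0 \<subseteq> N" "V.independent B0" "N \<subseteq> V.span B0" "card B0 = V.dim N"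
    by (rule V.basis_exists)
  have spanB0: "V.span B0 = N" using B0 V.span_minimal[OF B0(1) subN] by auto
  define B where "B = insert v0 B0"
  have "v0 \<notin> N" unfolding N_def using v0 by simp
  then have indB: "V.independent B" unfolding B_def using B0(2) spanB0 by (simp add: V.independent_insert)
  have spanB: "v \<in> V.span B" for v
  proof -
    have "l (v - scale (l v) v0) + l (scale (l v) v0) = l v" using l_lin(1)[of "v - scale (l v) v0" "scale (l v) v0"] by simp
    then have "v - scale (l v) v0 \<in> N" unfolding N_def using v0 by (simp add: l_lin)
    then have "v - scale (l v) v0 \<in> V.span B" using spanB0 V.span_mono[of B0 B] unfolding B_def by blast
    moreover have "scale (l v) v0 \<in> V.span B" unfolding B_def by (intro V.span_scale V.span_base) simp
    ultimately have "(v - scale (l v) v0) + scale (l v) v0 \<in> V.span B" by (rule V.span_add)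
    then show ?thesis by simp
  qed
  have "card B = d + 1" using V.dim_unique[OF subset_UNIV subsetI[OF spanB] indB refl] dim by simp
  then have finB: "finite B" by (metis card.infinite add_is_0 one_neq_zero)
  have v0B0: "v0 \<notin> B0" using \<open>v0 \<notin> N\<close> B0(1) by blast
  have "card B0 = d" using \<open>card B = d + 1\<close> finB v0B0 unfolding B_def by simp
  then obtain h where h: "bij_betw h {1..d} B0"
    using finB bij_betw_iff_card[of "{1..d}" B0] unfolding B_def by auto
  define e where "e i = (if i = 0 then v0 else h i)" for i
  have bije: "bij_betw e {..d} B"
  proof -
    have "bij_betw e {1..d} B0" using h by (subst bij_betw_cong[of _ _ h]) (auto simp: e_def)
    then have "bij_betw e ({0} \<union> {1..d}) ({v0} \<union> B0)"
      by (intro bij_betw_combine) (auto simp: e_def v0B0 bij_betw_def)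
    moreover have "{0} \<union> {1..d} = {..d}" by auto
    ultimately show ?thesis unfolding B_def by simp
  qed
  define co where "co i v = V.representation B v (e i)" for i v
  have eB: "e i \<in> B" if "i \<le> d" for i using bije that unfolding bij_betw_def by auto
  have expand: "v = (\<Sum>i\<le>d. scale (co i v) (e i))" for v
  proof -
    have "v = (\<Sum>b\<in>B. scale (V.representation B v b) b)"
      using V.sum_representation_eq[OF indB spanB finB subset_refl] by simp
    also have "\<dots> = (\<Sum>i\<le>d. scale (co i v) (e i))"
      unfolding co_def using sum.reindex_bij_betw[OF bije, of "\<lambda>b. scale (V.representation B v b) b"] by simp
    finally show ?thesis .
  qed
  have db: "dual_basis scale d e co"
  proof
    show "co i \<in> dual_space scale" for i
      unfolding dual_space_iff[OF V] co_def by (simp add: V.representation_add[OF indB spanB spanB] V.representation_scale[OF indB spanB])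
    show "co i (e j) = (if i = j then 1 else 0)" if "i \<le> d" "j \<le> d" for i j
      unfolding co_def V.representation_basis[OF indB eB[OF that(2)]]
      using bij_betw_imp_inj_on[OF bije] that by (auto dest: inj_onD)
  qed (rule expand)
  have "co 0 v = l v" for v
  proof -
    have lsum: "l (sum f A) = (\<Sum>i\<in>A. l (f i))" for f :: "nat \<Rightarrow> 'v" and A
      by (induction A rule: infinite_finite_induct) (auto simp: l0 l_lin)
    have le: "l (e i) = (if i = 0 then 1 else 0)" if "i \<le> d" for i
    proof (cases "i = 0")
      case False
      then have "e i \<in> B0" using h that unfolding e_def bij_betw_def by auto
      then show ?thesis using B0(1) False unfolding N_def by auto
    qed (simp add: e_def v0)
    have "l v = (\<Sum>i\<le>d. co i v * l (e i))" by (subst expand) (simp add: lsum l_lin)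
    also have "\<dots> = (\<Sum>i\<le>d. if i = 0 then co 0 v else 0)" by (rule sum.cong) (auto simp: le)
    also have "\<dots> = co 0 v" by (simp only: sum.delta finite_atMost) simp
    finally show ?thesis by simp
  qed
  then have "co 0 = l" by blast
  then show ?thesis using that db by blast
qed

lemma dual_space_closed:
  assumes V: "vector_space scale"
  shows "\<phi> \<in> dual_space scale \<Longrightarrow> \<phi>' \<in> dual_space scale \<Longrightarrow> \<phi> + \<phi>' \<in> dual_space scale"
    "\<phi> \<in> dual_space scale \<Longrightarrow> dual_scale c \<phi> \<in> dual_space scale" "0 \<in> dual_space scale"
  unfolding dual_space_iff[OF V] dual_scale_def by (auto simp: algebra_simps)

lemma functional_in_span:
  assumes V: "vector_space scale" and "finite A" "\<And>i. i \<in> A \<Longrightarrow> l i \<in> dual_space scale" "\<phi> \<in> dual_space scale"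
    and "\<And>v. (\<forall>i\<in>A. l i v = 0) \<Longrightarrow> \<phi> v = 0"
  shows "\<exists>a. \<phi> = (\<lambda>v. \<Sum>i\<in>A. a i * l i v)"
  using assms(2-)
proof (induction A arbitrary: \<phi> rule: finite_induct)
  case empty
  then show ?case by auto
next
  case (insert i A)
  have lin: "\<psi> (x - scale c y) = \<psi> x - c * \<psi> y" if "\<psi> \<in> dual_space scale" for \<psi> x y c
  proof -
    have "\<psi> (x - scale c y) + \<psi> (scale c y) = \<psi> x" using that unfolding dual_space_iff[OF V] by (metis diff_add_cancel)
    then show ?thesis using that unfolding dual_space_iff[OF V] by (simp add: eq_diff_eq)
  qed
  show ?case
  proof (cases "\<forall>v. (\<forall>j\<in>A. l j v = 0) \<longrightarrow> l i v = 0")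
    case True
    then obtain a where a: "\<phi> = (\<lambda>v. \<Sum>j\<in>A. a j * l j v)"
      using insert.IH[of \<phi>] insert.prems by (metis insert_iff)
    define a' where "a' j = (if j = i then 0 else a j)" for j
    have "(\<Sum>j\<in>insert i A. a' j * l j v) = (\<Sum>j\<in>A. a j * l j v)" for v
      using insert.hyps by (auto simp: a'_def intro!: sum.cong)
    then show ?thesis using a by (intro exI[of _ a']) auto
  next
    case False
    then obtain w where w: "\<forall>j\<in>A. l j w = 0" "l i w \<noteq> 0" by blast
    define c where "c = \<phi> w / l i w"
    define \<phi>' where "\<phi>' = (\<lambda>v. \<phi> v - c * l i v)"
    have \<phi>'d: "\<phi>' \<in> dual_space scale"
      using insert.prems(1)[of i] insert.prems(2) unfolding \<phi>'_def dual_space_iff[OF V] by (auto simp: algebra_simps)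
    have "\<phi>' v = 0" if v: "\<forall>j\<in>A. l j v = 0" for v
    proof -
      let ?x = "v - scale (l i v / l i w) w"
      have "\<forall>j\<in>insert i A. l j ?x = 0" using v w insert.prems(1) by (auto simp: lin)
      then have "\<phi> ?x = 0" using insert.prems(3) by blast
      then show ?thesis using lin[OF insert.prems(2)] w(2) unfolding \<phi>'_def c_def by (simp add: field_simps)
    qed
    then obtain a where a: "\<phi>' = (\<lambda>v. \<Sum>j\<in>A. a j * l j v)" using insert.IH[OF _ \<phi>'d] insert.prems(1) by blast
    define a' where "a' j = (if j = i then c else a j)" for j
    have "(\<Sum>j\<in>insert i A. a' j * l j v) = c * l i v + (\<Sum>j\<in>A. a j * l j v)" for v
      using insert.hyps by (auto simp: a'_def intro!: sum.cong)
    moreover have "\<phi> v = c * l i v + (\<Sum>j\<in>A. a j * l j v)" for v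
      using fun_cong[OF a, of v] unfolding \<phi>'_def by (simp add: algebra_simps)
    ultimately show ?thesis by (intro exI[of _ a']) auto
  qed
qed

section \<open>The symmetric algebra of the dual space as a polynomial ring\<close>

context dual_basis
begin

abbreviation W where "W \<equiv> dual_space scale"
abbreviation MW where "MW \<equiv> mpoly_ring (dual_space scale) :: ('v \<Rightarrow> 'k, 'k) mpoly ring"
abbreviation I where "I \<equiv> sym_ideal dual_scale (dual_space scale)"
abbreviation cls where "cls \<equiv> sym_class dual_scale (dual_space scale)"
abbreviation S where "S \<equiv> SymDual scale"

interpretation M: cring MW by (rule cring_mpoly_ring)

definition coord_poly :: "('v \<Rightarrow> 'k) \<Rightarrow> (nat, 'k) mpoly" where
  "coord_poly \<phi> = (\<Sum>i\<le>d. mpoly_const (\<phi> (e i)) * mpoly_var i)"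

definition tau :: "('v \<Rightarrow> 'k, 'k) mpoly \<Rightarrow> (nat, 'k) mpoly" where
  "tau = mpoly_eval mpoly_const coord_poly"

definition rho :: "(nat, 'k) mpoly \<Rightarrow> ('v \<Rightarrow> 'k, 'k) mpoly" where
  "rho = mpoly_eval mpoly_const (\<lambda>i. mpoly_var (co i))"

lemma tau_simps: "tau (p + q) = tau p + tau q" "tau (p * q) = tau p * tau q" "tau (p - q) = tau p - tau q"
  "tau (mpoly_const c) = mpoly_const c" "tau (mpoly_var \<phi>) = coord_poly \<phi>" "tau 0 = 0" "tau 1 = 1"
  unfolding tau_def by (simp_all add: const_hom.eval_add const_hom.eval_mult const_hom.eval_diff
    const_hom.eval_const const_hom.eval_var const_hom.eval_zero const_hom.eval_one)

lemma rho_simps: "rho (p + q) = rho p + rho q" "rho (p * q) = rho p * rho q" "rho (p - q) = rho p - rho q"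
  "rho (mpoly_const c) = mpoly_const c" "rho (mpoly_var i) = mpoly_var (co i)" "rho 0 = 0"
  "rho (\<Sum>i\<in>A. f i) = (\<Sum>i\<in>A. rho (f i))"
  unfolding rho_def by (simp_all add: const_hom.eval_add const_hom.eval_mult const_hom.eval_diff
    const_hom.eval_const const_hom.eval_var const_hom.eval_zero const_hom.eval_sum)

abbreviation rels where "rels \<equiv>
  ({mpoly_var (u + v) - (mpoly_var u + mpoly_var v) | u v. u \<in> W \<and> v \<in> W} \<union>
      {mpoly_var (dual_scale c u) - mpoly_const c * mpoly_var u | c u. u \<in> W}) :: ('v \<Rightarrow> 'k, 'k) mpoly set"

lemma rels_carrier: "rels \<subseteq> carrier MW"
proof -
  note c = dual_space_closed[OF vector_space] mpoly_ring_closed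
  show ?thesis by (auto intro!: c)
qed

lemma ideal_I: "ideal I MW"
  unfolding sym_ideal_def using M.genideal_ideal[OF rels_carrier] .

lemma rels_I: "rels \<subseteq> I"
  unfolding sym_ideal_def using M.genideal_self[OF rels_carrier] .

interpretation I: ideal I MW by (rule ideal_I)

lemma I_closed: "a \<in> I \<Longrightarrow> b \<in> I \<Longrightarrow> a + b \<in> I" "a \<in> I \<Longrightarrow> b \<in> I \<Longrightarrow> a - b \<in> I"
  "a \<in> I \<Longrightarrow> b \<in> carrier MW \<Longrightarrow> a * b \<in> I" "a \<in> I \<Longrightarrow> b \<in> carrier MW \<Longrightarrow> b * a \<in> I" "0 \<in> I"
  "a \<in> I \<Longrightarrow> a \<in> carrier MW"
proof -
  show add: "a + b \<in> I" if "a \<in> I" "b \<in> I" for a b using I.a_closed[OF that] by (simp add: mpoly_ring_simps)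
  show "a * b \<in> I" if "a \<in> I" "b \<in> carrier MW" for a b using I.I_r_closed[OF that] by (simp add: mpoly_ring_simps)
  show mult: "b * a \<in> I" if "a \<in> I" "b \<in> carrier MW" for a b using I.I_l_closed[OF that] by (simp add: mpoly_ring_simps)
  show "0 \<in> I" using I.zero_closed by (simp add: mpoly_ring_simps)
  show "a \<in> carrier MW" if "a \<in> I" for a using that I.a_subset by auto
  show "a - b \<in> I" if "a \<in> I" "b \<in> I"
  proof -
    have "- 1 \<in> carrier MW" by (intro mpoly_ring_closed)
    then show ?thesis using add[OF that(1) mult[OF that(2), of "- 1"]] by simp
  qed
qed

lemma coord_poly_in: "coord_poly \<phi> \<in> carrier (mpoly_ring {..d})"
  unfolding coord_poly_def by (intro mpoly_ring_sum mpoly_ring_closed) auto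

lemma coord_poly_homogeneous: "mpoly_homogeneous 1 (coord_poly \<phi>)"
  unfolding coord_poly_def
  by (intro homogeneous_sum) (use homogeneous_closed(2)[OF homogeneous_closed(3,4)] in fastforce)

lemma coord_poly_co: "i \<le> d \<Longrightarrow> coord_poly (co i) = mpoly_var i"
proof -
  assume i: "i \<le> d"
  have "coord_poly (co i) = (\<Sum>j\<le>d. if j = i then mpoly_var i else 0)"
    unfolding coord_poly_def by (rule sum.cong) (use i in \<open>auto simp: co_e mpoly_const_hom\<close>)
  then show ?thesis using i by simp
qed

lemma coord_poly_linear: "coord_poly (u + v) = coord_poly u + coord_poly v"
  "coord_poly (dual_scale c u) = mpoly_const c * coord_poly u"
  unfolding coord_poly_def dual_scale_def
  by (simp_all add: mpoly_const_hom distrib_right sum.distrib sum_distrib_left mult.assoc)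

lemma tau_I: "p \<in> I \<Longrightarrow> tau p = 0"
proof -
  assume p: "p \<in> I"
  define K where "K = {p \<in> carrier MW. tau p = 0}"
  have "ideal K MW"
  proof (rule idealI)
    show "ring MW" by (rule M.ring_axioms)
    show "subgroup K (add_monoid MW)"
    proof (rule M.add.subgroupI)
      show "K \<subseteq> carrier MW" unfolding K_def by auto
      have "0 \<in> K" unfolding K_def using mpoly_ring_closed(7) by (auto simp: tau_simps)
      then show "K \<noteq> {}" by auto
      show "\<ominus>\<^bsub>MW\<^esub> a \<in> K" if "a \<in> K" for a
      proof -
        have a: "a \<in> carrier MW" "tau a = 0" using that unfolding K_def by auto
        have "\<ominus>\<^bsub>MW\<^esub> a = - a" using a(1) mpoly_ring_closed(3)[OF a(1)] by (intro M.minus_equality) (auto simp: mpoly_ring_simps)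
        then show ?thesis unfolding K_def using a mpoly_ring_closed(3)[OF a(1)] tau_simps(3)[of 0 a] by (simp add: tau_simps(6))
      qed
      show "a \<oplus>\<^bsub>MW\<^esub> b \<in> K" if "a \<in> K" "b \<in> K" for a b
        using that unfolding K_def by (auto simp: mpoly_ring_simps mpoly_ring_closed tau_simps)
    qed
  qed (auto simp: K_def mpoly_ring_simps mpoly_ring_closed tau_simps)
  moreover have "rels \<subseteq> K"
    using rels_carrier unfolding K_def by (auto simp: tau_simps coord_poly_linear)
  ultimately have "I \<subseteq> K" unfolding sym_ideal_def by (rule M.genideal_minimal)
  then show ?thesis using p unfolding K_def by auto
qed

lemma var_expand:
  assumes "finite A" "\<And>i. i \<in> A \<Longrightarrow> \<phi> i \<in> W"
  shows "mpoly_var (\<Sum>i\<in>A. dual_scale (c i) (\<phi> i)) - (\<Sum>i\<in>A. mpoly_const (c i) * mpoly_var (\<phi> i)) \<in> I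
    \<and> (\<Sum>i\<in>A. dual_scale (c i) (\<phi> i)) \<in> W"
  using assms
proof (induction A rule: finite_induct)
  case empty
  have "mpoly_var (dual_scale 0 0) - mpoly_const 0 * mpoly_var 0 \<in> rels"
    using dual_space_closed(3)[OF vector_space] by blast
  moreover have "dual_scale 0 (0 :: 'v \<Rightarrow> 'k) = 0" unfolding dual_scale_def by auto
  ultimately have "mpoly_var 0 - mpoly_const 0 * mpoly_var 0 \<in> I" using rels_I by (metis (no_types, lifting) subsetD)
  then have "mpoly_var 0 \<in> I" unfolding mpoly_const_hom(4) by simp
  then show ?case unfolding sum.empty diff_zero using dual_space_closed(3)[OF vector_space] by blast
next
  case (insert i A)
  let ?u = "dual_scale (c i) (\<phi> i)" and ?v = "\<Sum>i\<in>A. dual_scale (c i) (\<phi> i)"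
  let ?s = "\<Sum>i\<in>A. mpoly_const (c i) * mpoly_var (\<phi> i) :: ('v \<Rightarrow> 'k, 'k) mpoly"
  have u: "?u \<in> W" "\<phi> i \<in> W" using insert.prems dual_space_closed(2)[OF vector_space] by auto
  have v: "?v \<in> W" "mpoly_var ?v - ?s \<in> I" using insert by auto
  have 1: "mpoly_var (?u + ?v) - (mpoly_var ?u + mpoly_var ?v) \<in> I" using rels_I u v by blast
  have 2: "mpoly_var ?u - mpoly_const (c i) * mpoly_var (\<phi> i) \<in> I" using rels_I u by blast
  have "mpoly_var (?u + ?v) - (mpoly_const (c i) * mpoly_var (\<phi> i) + ?s) \<in> I"
    using I_closed(1)[OF I_closed(1)[OF 1 2] v(2)] by (simp add: algebra_simps)
  then show ?case
    unfolding sum.insert[OF insert.hyps] using dual_space_closed(1)[OF vector_space u(1) v(1)] by blast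
qed

lemma vector_space_zero: "scale 0 v = 0"
proof -
  interpret V: vector_space scale by (rule vector_space)
  show ?thesis by simp
qed

lemma dual_expand: "\<phi> \<in> W \<Longrightarrow> \<phi> = (\<Sum>i\<le>d. dual_scale (\<phi> (e i)) (co i))"
proof
  fix v assume \<phi>: "\<phi> \<in> W"
  have lin: "\<phi> (x + y) = \<phi> x + \<phi> y" "\<phi> (scale c x) = c * \<phi> x" for x y c
    using \<phi> unfolding dual_space_iff[OF vector_space] by auto
  have "\<phi> 0 = 0" using lin(2)[of 0 0] vector_space_zero by simp
  then have sum: "\<phi> (sum f A) = (\<Sum>i\<in>A. \<phi> (f i))" for f :: "nat \<Rightarrow> 'v" and A
    by (induction A rule: infinite_finite_induct) (auto simp: lin)
  have sa: "(\<Sum>i\<in>A. f i) v = (\<Sum>i\<in>A. f i v)" for f :: "nat \<Rightarrow> 'v \<Rightarrow> 'k" and A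
    by (induction A rule: infinite_finite_induct) auto
  have "\<phi> v = (\<Sum>i\<le>d. co i v * \<phi> (e i))" by (subst expand[of v]) (simp add: sum lin)
  then show "\<phi> v = (\<Sum>i\<le>d. dual_scale (\<phi> (e i)) (co i)) v" by (simp add: sa dual_scale_def mult.commute)
qed

lemma rho_closed: "a \<in> carrier (mpoly_ring {..d}) \<Longrightarrow> rho a \<in> carrier MW"
  unfolding rho_def by (erule eval_closed) (use co_dual in \<open>auto intro: mpoly_ring_closed\<close>)

lemma tau_closed: "p \<in> carrier MW \<Longrightarrow> tau p \<in> carrier (mpoly_ring {..d})"
  unfolding tau_def by (erule eval_closed) (rule coord_poly_in)

lemma rho_tau: "p \<in> carrier MW \<Longrightarrow> rho (tau p) - p \<in> I"
proof (induction p rule: mpoly_ring_induct)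
  case (const c)
  then show ?case by (simp add: tau_simps rho_simps I_closed)
next
  case (var \<phi>)
  have "mpoly_var \<phi> - (\<Sum>i\<le>d. mpoly_const (\<phi> (e i)) * mpoly_var (co i)) \<in> I"
    using var_expand[of "{..d}" co "\<lambda>i. \<phi> (e i)"] co_dual dual_expand[OF var] by simp
  then have "0 - (mpoly_var \<phi> - (\<Sum>i\<le>d. mpoly_const (\<phi> (e i)) * mpoly_var (co i))) \<in> I"
    using I_closed(2,5) by blast
  then show ?case by (simp add: tau_simps rho_simps coord_poly_def)
next
  case (add p q)
  then show ?case using I_closed(1)[OF add.IH] by (simp add: tau_simps rho_simps algebra_simps)
next
  case (mult p q)
  have "rho (tau (p * q)) - p * q = (rho (tau p) - p) * rho (tau q) + p * (rho (tau q) - q)"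
    by (simp add: tau_simps rho_simps algebra_simps)
  then show ?case using I_closed(1,3,4) mult rho_closed tau_closed by metis
qed

lemma tau_rho: "a \<in> carrier (mpoly_ring {..d}) \<Longrightarrow> tau (rho a) = a"
  by (induction a rule: mpoly_ring_induct) (auto simp: tau_simps rho_simps coord_poly_co)

lemma tau_eq_0_iff: "p \<in> carrier MW \<Longrightarrow> tau p = 0 \<longleftrightarrow> p \<in> I"
proof
  assume p: "p \<in> carrier MW" "tau p = 0"
  then have "0 - (0 - p) \<in> I" using rho_tau[OF p(1)] I_closed(2,5) by (simp add: rho_simps del: diff_0)
  then show "p \<in> I" by simp
qed (rule tau_I)

lemma cls_eq: "cls p = {i + p | i. i \<in> I}"
  unfolding sym_class_def a_r_coset_def' by (auto simp: mpoly_ring_simps)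

definition Tau :: "('v \<Rightarrow> 'k, 'k) mpoly set \<Rightarrow> (nat, 'k) mpoly" where
  "Tau X = the_elem (tau ` X)"

lemma Tau_cls: "Tau (cls p) = tau p"
proof -
  have "tau ` cls p = {tau p}" unfolding cls_eq using I_closed(5) by (auto simp: tau_simps tau_I)
  then show ?thesis unfolding Tau_def by simp
qed

lemma carrier_S: "carrier S = cls ` carrier MW"
  unfolding Sym_def FactRing_def sym_class_def A_RCOSETS_def' by auto

lemma cring_S: "cring S"
  unfolding Sym_def by (rule I.quotient_is_cring[OF cring_mpoly_ring])

lemma S_ops:
  assumes "p \<in> carrier MW" "q \<in> carrier MW"
  shows "cls p \<otimes>\<^bsub>S\<^esub> cls q = cls (p * q)" "cls p \<oplus>\<^bsub>S\<^esub> cls q = cls (p + q)"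
  using I.rcoset_mult_add[OF assms] I.a_rcos_sum[OF assms]
  unfolding Sym_def FactRing_def sym_class_def by (simp_all add: mpoly_ring_simps)

lemma S_one: "\<one>\<^bsub>S\<^esub> = cls 1"
  unfolding Sym_def FactRing_def sym_class_def by (simp add: mpoly_ring_simps)

lemma Tau_hom:
  "x \<in> carrier S \<Longrightarrow> y \<in> carrier S \<Longrightarrow> Tau (x \<otimes>\<^bsub>S\<^esub> y) = Tau x * Tau y"
  "x \<in> carrier S \<Longrightarrow> y \<in> carrier S \<Longrightarrow> Tau (x \<oplus>\<^bsub>S\<^esub> y) = Tau x + Tau y"
  "Tau \<one>\<^bsub>S\<^esub> = 1"
  unfolding carrier_S by (auto simp: S_ops S_one Tau_cls tau_simps)

lemma Tau_inj: "inj_on Tau (carrier S)"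
proof (rule inj_onI)
  fix x y assume "x \<in> carrier S" "y \<in> carrier S" "Tau x = Tau y"
  then obtain p q where pq: "x = cls p" "y = cls q" "p \<in> carrier MW" "q \<in> carrier MW" "tau p = tau q"
    unfolding carrier_S by (auto simp: Tau_cls)
  then have d: "p - q \<in> I" using tau_eq_0_iff[OF mpoly_ring_closed(4)[OF pq(3,4)]] by (simp add: tau_simps)
  have "cls p \<subseteq> cls q"
  proof
    fix z assume "z \<in> cls p"
    then obtain i where "z = i + p" "i \<in> I" unfolding cls_eq by blast
    then have "z = (i + (p - q)) + q" "i + (p - q) \<in> I" using I_closed(1) d by auto
    then show "z \<in> cls q" unfolding cls_eq by blast
  qed
  moreover have "cls q \<subseteq> cls p"
  proof
    fix z assume "z \<in> cls q"
    then obtain i where "z = i + q" "i \<in> I" unfolding cls_eq by blast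
    then have "z = (i - (p - q)) + p" "i - (p - q) \<in> I" using I_closed(2) d by auto
    then show "z \<in> cls p" unfolding cls_eq by blast
  qed
  ultimately show "x = y" using pq by blast
qed

lemma Tau_image: "Tau ` carrier S = carrier (mpoly_ring {..d})"
proof (intro subset_antisym subsetI)
  fix a assume a: "a \<in> carrier (mpoly_ring {..d} :: (nat, 'k) mpoly ring)"
  have "a = Tau (cls (rho a))" using tau_rho[OF a] by (simp add: Tau_cls)
  then show "a \<in> Tau ` carrier S" unfolding carrier_S using rho_closed[OF a] by blast
qed (auto simp: carrier_S Tau_cls tau_closed)

lemma grade_iff:
  "s \<in> SymDual_grade scale k \<longleftrightarrow> s \<in> carrier S \<and> mpoly_homogeneous k (Tau s)"
proof
  assume "s \<in> SymDual_grade scale k"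
  then obtain p where p: "s = cls p" "p \<in> carrier MW" "mpoly_homogeneous k p" unfolding Sym_grade_def by auto
  then have "mpoly_homogeneous k (tau p)" unfolding tau_def by (intro eval_homogeneous coord_poly_homogeneous)
  then show "s \<in> carrier S \<and> mpoly_homogeneous k (Tau s)" using p carrier_S by (auto simp: Tau_cls)
next
  assume s: "s \<in> carrier S \<and> mpoly_homogeneous k (Tau s)"
  let ?p = "rho (Tau s)"
  have T: "Tau s \<in> carrier (mpoly_ring {..d})" using s Tau_image by blast
  have p: "?p \<in> carrier MW" using rho_closed[OF T] .
  have "mpoly_homogeneous k ?p" unfolding rho_def using s T by (intro eval_homogeneous) (auto intro: homogeneous_closed simp del: One_nat_def)
  moreover have "s = cls ?p"
    using inj_onD[OF Tau_inj, of s "cls ?p"] s p T tau_rho carrier_S by (auto simp: Tau_cls)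
  ultimately show "s \<in> SymDual_grade scale k" unfolding Sym_grade_def using p by blast
qed

definition eta :: "('v \<Rightarrow> 'k, 'k) mpoly set \<Rightarrow> (nat, 'k) mpoly fract Polynomial.poly" where
  "eta s = grading_hom (Tau s)"

lemma graded_domain_S: "graded_domain S (SymDual_grade scale) eta"
proof (rule graded_domain.intro, goal_cases)
  case 1 show ?case by (rule cring_S)
next
  case (2 a b) then show ?case unfolding eta_def grading_hom_def by (simp add: Tau_hom grading.eval_mult)
next
  case (3 a b) then show ?case unfolding eta_def grading_hom_def by (simp add: Tau_hom grading.eval_add)
next
  case 4 show ?case unfolding eta_def grading_hom_def by (simp add: Tau_hom grading.eval_one)
next
  case (5 s k) show ?case unfolding grade_iff eta_def homogeneous_iff_grading_hom ..
next
  case (6 s k)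
  have "Tau s \<in> carrier (mpoly_ring {..d})" using 6 Tau_image by blast
  then have "mpoly_component k (Tau s) \<in> carrier (mpoly_ring {..d})"
    unfolding carrier_mpoly_ring keys_component by auto
  then obtain a where a: "a \<in> carrier S" "Tau a = mpoly_component k (Tau s)" using Tau_image by (metis imageE)
  have h: "mpoly_homogeneous k (mpoly_component k (Tau s))" unfolding mpoly_homogeneous_iff keys_component by auto
  then obtain x where x: "grading_hom (mpoly_component k (Tau s)) = Polynomial.monom x k"
    using homogeneous_iff_grading_hom by blast
  then have "x = Fract (mpoly_component k (Tau s)) 1"
    using eval_grading_hom[of "mpoly_component k (Tau s)"] by (simp add: poly_monom)
  then have "eta a = Polynomial.monom (Polynomial.coeff (eta s) k) k"
    unfolding eta_def a(2) x by (simp add: coeff_grading_hom)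
  then show ?case using a h grade_iff by auto
next
  case 7
  then show ?case unfolding eta_def eval_grading_hom using Tau_inj by (auto simp: inj_on_def Fract_hom simp del: eq_fract)
qed

lemma Tau_linear_form: "Tau (linear_form scale \<phi>) = coord_poly \<phi>"
  unfolding linear_form_def Tau_cls by (simp add: tau_simps)

lemma coord_poly_nonzero: "\<phi> \<in> W \<Longrightarrow> \<phi> \<noteq> (\<lambda>_. 0) \<Longrightarrow> coord_poly \<phi> \<noteq> 0"
proof
  assume \<phi>: "\<phi> \<in> W" "\<phi> \<noteq> (\<lambda>_. 0)" and z: "coord_poly \<phi> = 0"
  have "\<phi> (e j) = 0" if j: "j \<le> d" for j
  proof -
    have [simp]: "Poly_Mapping.single i (Suc 0) = Poly_Mapping.single j (Suc 0) \<longleftrightarrow> i = j" for i :: nat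
      by (metis lookup_single_eq lookup_single_not_eq nat.distinct(1))
    have "Poly_Mapping.lookup (coord_poly \<phi>) (Poly_Mapping.single j 1) = (\<Sum>i\<le>d. if i = j then \<phi> (e j) else 0)"
      unfolding coord_poly_def mpoly_const_def mpoly_var_def
      by (auto simp: mult_single Poly_Mapping.lookup_sum lookup_single when_def intro!: sum.cong)
    then show ?thesis using z j by simp
  qed
  then have "\<phi> = (\<Sum>i\<le>d. dual_scale 0 (co i))" using dual_expand[OF \<phi>(1)] by simp
  moreover have "dual_scale 0 (co i) = 0" for i unfolding dual_scale_def by auto
  ultimately have "\<phi> = 0" by simp
  then show False using \<phi>(2) by (simp add: zero_fun_def)
qed

end

context dual_basis
begin

lemma var_prime:
  assumes ab: "a \<in> carrier (mpoly_ring {..d})" "b \<in> carrier (mpoly_ring {..d})" "a * b = mpoly_var 0 * r"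
  shows "(\<exists>a'\<in>carrier (mpoly_ring {..d}). a = mpoly_var 0 * a') \<or>
    (\<exists>b'\<in>carrier (mpoly_ring {..d}). b = mpoly_var 0 * (b' :: (nat, 'k) mpoly))"
proof -
  define z where "z = mpoly_eval mpoly_const (\<lambda>i. if i = 0 then 0 else mpoly_var i :: (nat, 'k) mpoly)"
  have z: "z (p + q) = z p + z q" "z (p * q) = z p * z q" "z (mpoly_const c) = mpoly_const c"
    "z (mpoly_var i) = (if i = 0 then 0 else mpoly_var i)" for p q c i
    unfolding z_def by (simp_all add: const_hom.eval_add const_hom.eval_mult const_hom.eval_const const_hom.eval_var)
  have split: "z p \<in> carrier (mpoly_ring {..d}) \<and> (\<exists>p'\<in>carrier (mpoly_ring {..d}). p = z p + mpoly_var 0 * p')"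
    if "p \<in> carrier (mpoly_ring {..d})" for p
    using that
  proof (induction p rule: mpoly_ring_induct)
    case (const c)
    then show ?case using mpoly_ring_closed(5,7) by (auto simp: z intro!: bexI[of _ 0])
  next
    case (var i)
    show ?case
    proof (cases "i = 0")
      case True
      then show ?thesis using mpoly_ring_closed(7,8) by (auto simp: z intro!: bexI[of _ 1])
    next
      case False
      then show ?thesis using mpoly_ring_closed(6)[OF var] mpoly_ring_closed(7) by (auto simp: z intro!: bexI[of _ 0])
    qed
  next
    case (add p q)
    then obtain p' q' where pq: "p' \<in> carrier (mpoly_ring {..d})" "q' \<in> carrier (mpoly_ring {..d})"
      "p = z p + mpoly_var 0 * p'" "q = z q + mpoly_var 0 * q'" by blast
    have "p + q = (z p + mpoly_var 0 * p') + (z q + mpoly_var 0 * q')" using pq(3,4) by (rule arg_cong2)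
    then have "p + q = z (p + q) + mpoly_var 0 * (p' + q')" unfolding z by (simp add: algebra_simps)
    then show ?case using add.IH pq(1,2) z(1) mpoly_ring_closed(1) by metis
  next
    case (mult p q)
    then obtain p' q' where pq: "p' \<in> carrier (mpoly_ring {..d})" "q' \<in> carrier (mpoly_ring {..d})"
      "p = z p + mpoly_var 0 * p'" "q = z q + mpoly_var 0 * q'" by blast
    let ?r = "p' * q + z p * q'"
    have "p * q = z p * q + mpoly_var 0 * p' * q" using arg_cong[OF pq(3), of "\<lambda>u. u * q"] by (simp add: distrib_right)
    also have "z p * q = z p * (z q + mpoly_var 0 * q')" using pq(4) by (rule arg_cong)
    finally have "p * q = z (p * q) + mpoly_var 0 * ?r" unfolding z by (simp add: algebra_simps)
    moreover have "?r \<in> carrier (mpoly_ring {..d})" by (intro mpoly_ring_closed(1,2)) (use mult pq(1,2) in auto)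
    moreover have "z (p * q) \<in> carrier (mpoly_ring {..d})" using mult.IH z(2) mpoly_ring_closed(2) by metis
    ultimately show ?case by blast
  qed
  have "z a * z b = 0" using arg_cong[OF ab(3), of z] by (simp add: z)
  then have "z a = 0 \<or> z b = 0" by simp
  then show ?thesis
  proof
    assume "z a = 0"
    then show ?thesis using split[OF ab(1)] by auto
  next
    assume "z b = 0"
    then show ?thesis using split[OF ab(2)] by auto
  qed
qed

lemma linear_form_in: "\<phi> \<in> dual_space scale \<Longrightarrow> linear_form scale \<phi> \<in> carrier S"
  unfolding carrier_S linear_form_def by (intro imageI mpoly_ring_closed(6))

lemma co_prime:
  assumes xyz: "x \<in> carrier S" "y \<in> carrier S" "z \<in> carrier S" "x \<otimes>\<^bsub>S\<^esub> y = linear_form scale (co 0) \<otimes>\<^bsub>S\<^esub> z"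
  shows "(\<exists>x'\<in>carrier S. x = linear_form scale (co 0) \<otimes>\<^bsub>S\<^esub> x') \<or> (\<exists>y'\<in>carrier S. y = linear_form scale (co 0) \<otimes>\<^bsub>S\<^esub> y')"
proof -
  have lf: "linear_form scale (co 0) \<in> carrier S" using linear_form_in co_dual by simp
  have T: "Tau (linear_form scale (co 0)) = mpoly_var 0" unfolding Tau_linear_form by (simp add: coord_poly_co)
  have "Tau x * Tau y = mpoly_var 0 * Tau z"
    using arg_cong[OF xyz(4), of Tau] unfolding Tau_hom(1)[OF xyz(1,2)] Tau_hom(1)[OF lf xyz(3)] T .
  moreover have "Tau x \<in> carrier (mpoly_ring {..d})" "Tau y \<in> carrier (mpoly_ring {..d})" using xyz Tau_image by auto
  ultimately have *: "(\<exists>a'\<in>carrier (mpoly_ring {..d}). Tau x = mpoly_var 0 * a') \<or>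
    (\<exists>b'\<in>carrier (mpoly_ring {..d}). Tau y = mpoly_var 0 * b')" using var_prime by blast
  have lift: "\<exists>w'\<in>carrier S. w = linear_form scale (co 0) \<otimes>\<^bsub>S\<^esub> w'"
    if w: "w \<in> carrier S" and a: "a' \<in> carrier (mpoly_ring {..d})" "Tau w = mpoly_var 0 * a'" for w a'
  proof -
    obtain w' where w': "w' \<in> carrier S" "a' = Tau w'" using Tau_image a(1) by blast
    interpret S: cring S by (rule cring_S)
    have "Tau w = Tau (linear_form scale (co 0) \<otimes>\<^bsub>S\<^esub> w')" using Tau_hom(1)[OF lf w'(1)] T a w' by simp
    then show ?thesis using inj_onD[OF Tau_inj] w w' lf S.m_closed by blast
  qed
  show ?thesis using * lift xyz by blast
qed

end

section \<open>The complement of a hyperplane arrangement\<close>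

locale based_arrangement = dual_basis scale d e co
  for scale :: "'k::field \<Rightarrow> 'v::ab_group_add \<Rightarrow> 'v" and d and e and co +
  fixes n :: nat and H :: "nat \<Rightarrow> 'v set" and l :: "nat \<Rightarrow> 'v \<Rightarrow> 'k"
  assumes dimension: "vector_space.dim scale (UNIV :: 'v set) = d + 1"
    and arrangement: "arrangement scale n H"
    and essential: "essential n H"
    and forms: "i \<le> n \<Longrightarrow> l i \<in> dual_space scale \<and> H i = {v. l i v = 0}"
begin

lemma l_dual: "i \<le> n \<Longrightarrow> l i \<in> dual_space scale"
  using forms by blast

lemma l_nonzero: "i \<le> n \<Longrightarrow> l i \<noteq> (\<lambda>_. 0)"
proof
  assume i: "i \<le> n" "l i = (\<lambda>_. 0)"
  then have "H i = UNIV" using forms[of i] by simp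
  moreover have "hyperplane scale (H i)" using arrangement i(1) unfolding arrangement_def by simp
  ultimately show False unfolding hyperplane_def by (auto simp: fun_eq_iff set_eq_iff)
qed

sublocale G: graded_arrangement "SymDual scale" "SymDual_grade scale" eta n "\<lambda>i. linear_form scale (l i)"
proof (rule graded_arrangement.intro[OF graded_domain_S], unfold_locales)
  fix i assume i: "i \<le> n"
  show "linear_form scale (l i) \<in> SymDual_grade scale 1"
    unfolding grade_iff Tau_linear_form using linear_form_in[OF l_dual[OF i]] coord_poly_homogeneous by blast
  show "linear_form scale (l i) \<noteq> \<zero>\<^bsub>SymDual scale\<^esub>"
  proof
    interpret S: cring "SymDual scale" by (rule cring_S)
    assume "linear_form scale (l i) = \<zero>\<^bsub>SymDual scale\<^esub>"
    then have "coord_poly (l i) = Tau \<zero>\<^bsub>SymDual scale\<^esub>" using Tau_linear_form by metis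
    moreover have "Tau \<zero>\<^bsub>SymDual scale\<^esub> = 0"
    proof -
      have "Tau \<zero>\<^bsub>S\<^esub> + Tau \<zero>\<^bsub>S\<^esub> = Tau \<zero>\<^bsub>S\<^esub> + 0"
        using Tau_hom(2)[OF S.zero_closed S.zero_closed] by simp
      then show ?thesis by (rule add_left_imp_eq)
    qed
    ultimately show False using coord_poly_nonzero[OF l_dual[OF i] l_nonzero[OF i]] by simp
  qed
qed

abbreviation lf where "lf i \<equiv> linear_form scale (l i)"

definition K :: "'k \<Rightarrow> (nat, 'k) mpoly fract" where "K c = Fract (mpoly_const c) 1"

lemma \<iota>_eq: "G.\<iota> s = Fract (Tau s) 1"
  unfolding G.\<iota>_def eta_def eval_grading_hom ..

lemma cls_const_in: "cls (mpoly_const c) \<in> SymDual_grade scale 0"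
  unfolding grade_iff Tau_cls tau_simps carrier_S using mpoly_ring_closed(5) homogeneous_closed(3) by blast

lemma \<iota>_const: "G.\<iota> (cls (mpoly_const c)) = K c"
  unfolding \<iota>_eq Tau_cls tau_simps K_def ..

lemma K_hom: "K (a * b) = K a * K b" "K (a + b) = K a + K b" "K 1 = 1" "K 0 = 0"
  unfolding K_def mpoly_const_hom Fract_hom by simp_all

lemma K_inverse: "inverse (K c) = K (inverse c)"
proof (cases "c = 0")
  case False
  then have "K (inverse c) * K c = 1" using K_hom(1)[of "inverse c" c] by (simp add: K_hom)
  then show ?thesis by (metis inverse_unique mult.commute)
qed (simp add: K_hom)

lemma lf_prime:
  assumes i: "i \<le> n" and xyz: "x \<in> carrier S" "y \<in> carrier S" "z \<in> carrier S" "x \<otimes>\<^bsub>S\<^esub> y = lf i \<otimes>\<^bsub>S\<^esub> z"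
  shows "(\<exists>x'\<in>carrier S. x = lf i \<otimes>\<^bsub>S\<^esub> x') \<or> (\<exists>y'\<in>carrier S. y = lf i \<otimes>\<^bsub>S\<^esub> y')"
proof -
  obtain e' co' where b: "dual_basis scale d e' co'" "co' 0 = l i"
    using dual_basis_exists[OF vector_space dimension l_dual[OF i] l_nonzero[OF i]] by blast
  interpret B: dual_basis scale d e' co' by (rule b(1))
  show ?thesis using B.co_prime[OF xyz(1-3)] xyz(4) unfolding b(2) by blast
qed

lemma unit_constant:
  assumes ab: "a \<in> carrier S" "b \<in> carrier S" "a \<otimes>\<^bsub>S\<^esub> b = \<one>\<^bsub>S\<^esub>"
  shows "\<exists>c. a = cls (mpoly_const c)"
proof -
  have "eta a * eta b = 1" using G.\<eta>_mult[OF ab(1,2)] ab(3) G.\<eta>_one by simp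
  then have "eta a dvd 1" by (metis dvd_triv_left)
  then obtain x where "eta a = [:x:]" using is_unit_poly_iff by blast
  then have "eta a = Polynomial.monom x 0" by (simp add: monom_0)
  then have "a \<in> SymDual_grade scale 0" using G.gr_iff ab(1) by blast
  then have "mpoly_homogeneous 0 (Tau a)" using grade_iff by blast
  then have "Tau a = mpoly_const (Poly_Mapping.lookup (Tau a) 0)"
    unfolding mpoly_homogeneous_iff mdeg_eq_0_iff mpoly_const_def
    by (intro poly_mapping_eqI) (auto simp: lookup_single when_def in_keys_iff)
  then have "Tau a = Tau (cls (mpoly_const (Poly_Mapping.lookup (Tau a) 0)))" by (simp add: Tau_cls tau_simps)
  then have "a = cls (mpoly_const (Poly_Mapping.lookup (Tau a) 0))"
    using inj_onD[OF Tau_inj _ ab(1)] G.gr_carrier[OF cls_const_in] by blast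
  then show ?thesis by blast
qed

lemma lmon_factor:
  assumes "set ks \<subseteq> {..n}" "a \<in> carrier S" "b \<in> carrier S" "a \<otimes>\<^bsub>S\<^esub> b = G.lmon ks"
  shows "\<exists>c js. set js \<subseteq> {..n} \<and> a = cls (mpoly_const c) \<otimes>\<^bsub>S\<^esub> G.lmon js"
  using assms
proof (induction ks arbitrary: a b)
  case Nil
  have "\<exists>c. a = cls (mpoly_const c)" using unit_constant[OF Nil(2,3)] Nil(4) by simp
  then obtain c where "a = cls (mpoly_const c)" by blast
  then show ?case using Nil by (intro exI[of _ c] exI[of _ "[]"]) auto
next
  case (Cons k ks)
  have k: "k \<le> n" and ks: "set ks \<subseteq> {..n}" using Cons.prems by auto
  have lk: "lf k \<in> carrier S" "lf k \<noteq> \<zero>\<^bsub>S\<^esub>" using G.l_gr[OF k] G.gr_carrier G.l_nonzero[OF k] by auto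
  note mc = G.lmon_carrier[OF ks]
  have cancel: "x = y" if xy: "x \<in> carrier S" "y \<in> carrier S" "lf k \<otimes>\<^bsub>S\<^esub> x = lf k \<otimes>\<^bsub>S\<^esub> y" for x y
  proof -
    have "G.\<iota> (lf k) * G.\<iota> x = G.\<iota> (lf k) * G.\<iota> y"
      using arg_cong[OF xy(3), of G.\<iota>] unfolding G.\<iota>_hom(1)[OF lk(1) xy(1)] G.\<iota>_hom(1)[OF lk(1) xy(2)] .
    then have "G.\<iota> x = G.\<iota> y" using G.\<iota>_l[OF k] by simp
    then show ?thesis using inj_onD[OF G.\<iota>_inj] xy by blast
  qed
  have eq: "a \<otimes>\<^bsub>S\<^esub> b = lf k \<otimes>\<^bsub>S\<^esub> G.lmon ks" using Cons.prems(4) by simp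
  from lf_prime[OF k Cons.prems(2,3) mc eq] show ?case
  proof
    assume "\<exists>x'\<in>carrier S. a = lf k \<otimes>\<^bsub>S\<^esub> x'"
    then obtain a' where a': "a' \<in> carrier S" "a = lf k \<otimes>\<^bsub>S\<^esub> a'" by blast
    have "lf k \<otimes>\<^bsub>S\<^esub> (a' \<otimes>\<^bsub>S\<^esub> b) = lf k \<otimes>\<^bsub>S\<^esub> G.lmon ks"
      using eq a' Cons.prems(3) lk(1) by (simp add: G.m_assoc)
    then have "a' \<otimes>\<^bsub>S\<^esub> b = G.lmon ks" using cancel[OF G.m_closed[OF a'(1) Cons.prems(3)] mc] by blast
    then obtain c js where c: "set js \<subseteq> {..n}" "a' = cls (mpoly_const c) \<otimes>\<^bsub>S\<^esub> G.lmon js"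
      using Cons.IH[OF ks a'(1) Cons.prems(3)] by blast
    have "a = cls (mpoly_const c) \<otimes>\<^bsub>S\<^esub> G.lmon (k # js)"
      using a'(2) c(2) lk(1) G.lmon_carrier[OF c(1)] G.gr_carrier[OF cls_const_in] by (simp add: G.m_lcomm)
    then show ?thesis using c(1) k by (intro exI[of _ c] exI[of _ "k # js"]) auto
  next
    assume "\<exists>y'\<in>carrier S. b = lf k \<otimes>\<^bsub>S\<^esub> y'"
    then obtain b' where b': "b' \<in> carrier S" "b = lf k \<otimes>\<^bsub>S\<^esub> b'" by blast
    have "lf k \<otimes>\<^bsub>S\<^esub> (a \<otimes>\<^bsub>S\<^esub> b') = lf k \<otimes>\<^bsub>S\<^esub> G.lmon ks"
      using eq b' Cons.prems(2) lk(1) by (simp add: G.m_lcomm)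
    then have "a \<otimes>\<^bsub>S\<^esub> b' = G.lmon ks" using cancel[OF G.m_closed[OF Cons.prems(2) b'(1)] mc] by blast
    then show ?thesis using Cons.IH[OF ks Cons.prems(2) b'(1)] by blast
  qed
qed

definition u :: "nat \<Rightarrow> (nat, 'k) mpoly fract" where "u i = G.\<iota> (lf i) / G.t"

lemma u_nonzero: "i \<le> n \<Longrightarrow> u i \<noteq> 0"
  unfolding u_def using G.\<iota>_l G.t_nonzero by simp

lemma lmon_u: "set is \<subseteq> {..n} \<Longrightarrow> G.\<iota> (G.lmon is) = G.t ^ length is * (\<Prod>i\<le>n. u i ^ count_list is i)"
proof (induction "is")
  case Nil
  then show ?case by (simp add: G.\<iota>_hom)
next
  case (Cons i "is")
  have i: "i \<le> n" and s: "set is \<subseteq> {..n}" using Cons.prems by auto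
  have "(\<Prod>j\<le>n. u j ^ count_list (i # is) j) = (\<Prod>j\<le>n. (if j = i then u i else 1) * u j ^ count_list is j)"
    by (rule prod.cong) auto
  also have "\<dots> = u i * (\<Prod>j\<le>n. u j ^ count_list is j)" using i by (simp add: prod.distrib)
  finally have "(\<Prod>j\<le>n. u j ^ count_list (i # is) j) = u i * (\<Prod>j\<le>n. u j ^ count_list is j)" .
  moreover have "G.\<iota> (G.lmon (i # is)) = G.\<iota> (lf i) * G.\<iota> (G.lmon is)"
    using G.\<iota>_hom(1)[OF G.gr_carrier[OF G.l_gr[OF i]] G.lmon_carrier[OF s]] by simp
  ultimately show ?case using Cons.IH[OF s] G.t_nonzero by (simp add: u_def)
qed

lemma lmon_ratio:
  assumes "set js \<subseteq> {..n}" "set is \<subseteq> {..n}" "length js = length is"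
  shows "G.\<iota> (G.lmon js) / G.\<iota> (G.lmon is) = (\<Prod>i\<le>n. u i powi (int (count_list js i) - int (count_list is i)))"
proof -
  have "G.\<iota> (G.lmon js) / G.\<iota> (G.lmon is) = (\<Prod>i\<le>n. u i ^ count_list js i / u i ^ count_list is i)"
    unfolding lmon_u[OF assms(1)] lmon_u[OF assms(2)] assms(3) using G.t_nonzero by (simp add: prod_dividef)
  also have "\<dots> = (\<Prod>i\<le>n. u i powi (int (count_list js i) - int (count_list is i)))"
    by (rule prod.cong) (auto simp: power_int_diff u_nonzero)
  finally show ?thesis .
qed

lemma Reg_units:
  assumes x: "x \<in> G.Reg" "x \<noteq> 0" "inverse x \<in> G.Reg"
  shows "\<exists>c e. c \<in> range K \<and> x = c * (\<Prod>i\<le>n. u i powi e i)"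
proof -
  obtain a "is" where a: "x = G.\<iota> a / G.\<iota> (G.lmon is)" "set is \<subseteq> {..n}" "a \<in> SymDual_grade scale (length is)"
    using x(1) unfolding G.Reg_def by blast
  obtain b js where b: "inverse x = G.\<iota> b / G.\<iota> (G.lmon js)" "set js \<subseteq> {..n}" "b \<in> SymDual_grade scale (length js)"
    using x(3) unfolding G.Reg_def by blast
  note cc = G.gr_carrier[OF a(3)] G.gr_carrier[OF b(3)]
  note nz = G.\<iota>_lmon_nonzero[OF a(2)] G.\<iota>_lmon_nonzero[OF b(2)]
  have sij: "set (is @ js) \<subseteq> {..n}" using a b by auto
  have "x * inverse x = 1" using x(2) by simp
  then have "G.\<iota> a * G.\<iota> b = G.\<iota> (G.lmon is) * G.\<iota> (G.lmon js)" unfolding b(1) unfolding a(1) using nz by (simp add: field_simps)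
  also have "\<dots> = G.\<iota> (G.lmon (is @ js))" using a(2) b(2) sij by (simp add: G.\<iota>_lmon)
  finally have "G.\<iota> (a \<otimes>\<^bsub>S\<^esub> b) = G.\<iota> (G.lmon (is @ js))" using cc by (simp add: G.\<iota>_hom)
  then have "a \<otimes>\<^bsub>S\<^esub> b = G.lmon (is @ js)"
    using inj_onD[OF G.\<iota>_inj] G.m_closed[OF cc] G.lmon_carrier[OF sij] by blast
  then obtain c ks where c: "set ks \<subseteq> {..n}" "a = cls (mpoly_const c) \<otimes>\<^bsub>S\<^esub> G.lmon ks"
    using lmon_factor[OF sij cc] by blast
  have "a \<in> SymDual_grade scale (length ks)"
    using G.gr_mult[OF cls_const_in G.lmon_gr[OF c(1)]] c(2) by simp
  then have "Polynomial.monom (G.\<iota> a) (length ks) = Polynomial.monom (G.\<iota> a) (length is)"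
    using G.\<eta>_gr a(3) by metis
  moreover have "G.\<iota> a \<noteq> 0" using x(2) a(1) by auto
  ultimately have len: "length ks = length is" by (metis degree_monom_eq)
  have "x = K c * (G.\<iota> (G.lmon ks) / G.\<iota> (G.lmon is))"
    unfolding a(1) c(2) using G.\<iota>_hom(1)[OF G.gr_carrier[OF cls_const_in] G.lmon_carrier[OF c(1)]] \<iota>_const by simp
  then show ?thesis unfolding lmon_ratio[OF c(1) a(2) len]
    by (intro exI[of _ "K c"] exI[of _ "\<lambda>i. int (count_list ks i) - int (count_list is i)"]) auto
qed

inductive_set LS :: "nat \<Rightarrow> (nat, 'k) mpoly fract set" for N where
  LS_zero: "0 \<in> LS N"
| LS_mon: "set js \<subseteq> {..n} \<Longrightarrow> length js = N \<Longrightarrow> K c * G.\<iota> (G.lmon js) \<in> LS N"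
| LS_add: "x \<in> LS N \<Longrightarrow> y \<in> LS N \<Longrightarrow> x + y \<in> LS N"

lemma LS_mult: "x \<in> LS j \<Longrightarrow> y \<in> LS k \<Longrightarrow> x * y \<in> LS (j + k)"
proof (induction rule: LS.induct)
  case (LS_mon js c)
  note js = LS_mon(1,2)
  from LS_mon(3) show ?case
  proof (induction rule: LS.induct)
    case (LS_mon ks c')
    have s: "set (js @ ks) \<subseteq> {..n}" "length (js @ ks) = j + k" using js LS_mon by auto
    have "K c * G.\<iota> (G.lmon js) * (K c' * G.\<iota> (G.lmon ks)) = K (c * c') * G.\<iota> (G.lmon (js @ ks))"
      using js(1) LS_mon(1) s(1) by (simp add: K_hom G.\<iota>_lmon)
    then show ?case using LS.LS_mon[OF s] by simp
  qed (auto simp: distrib_left intro: LS.intros)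
qed (auto simp: distrib_right intro: LS.intros)

lemma LS_const: "K c \<in> LS 0"
  using LS_mon[of "[]" 0 c] by (simp add: G.\<iota>_hom)

lemma LS_sum: "(\<And>i. i \<in> A \<Longrightarrow> f i \<in> LS N) \<Longrightarrow> (\<Sum>i\<in>A. f i) \<in> LS N"
  by (induction A rule: infinite_finite_induct) (auto intro: LS.intros)

lemma LS_power: "x \<in> LS 1 \<Longrightarrow> x ^ k \<in> LS k"
  using LS_const[of 1] LS_mult[of x 1] by (induction k) (auto simp: K_hom)

lemma LS_prod: "(\<And>i. i \<in> A \<Longrightarrow> f i \<in> LS (k i)) \<Longrightarrow> (\<Prod>i\<in>A. f i) \<in> LS (\<Sum>i\<in>A. k i)"
  using LS_const[of 1] by (induction A rule: infinite_finite_induct) (auto simp: K_hom LS_mult)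

lemma LS_coord:
  assumes \<phi>: "\<phi> \<in> dual_space scale" shows "Fract (coord_poly \<phi>) 1 \<in> LS 1"
proof -
  have "\<exists>a. \<phi> = (\<lambda>v. \<Sum>i\<in>{..n}. a i * l i v)"
  proof (rule functional_in_span[OF vector_space])
    fix v assume "\<forall>i\<in>{..n}. l i v = 0"
    then have "v \<in> (\<Inter>i\<le>n. H i)" using forms by auto
    then have "v = 0" using essential unfolding essential_def by simp
    then show "\<phi> v = 0"
      using \<phi> vector_space_zero[of 0] unfolding dual_space_iff[OF vector_space] by (metis mult_zero_left)
  qed (use \<phi> l_dual in auto)
  then obtain a where a: "\<phi> = (\<lambda>v. \<Sum>i\<le>n. a i * l i v)" by auto
  have const_sum: "mpoly_const (\<Sum>i\<in>A. f i) = (\<Sum>i\<in>A. mpoly_const (f i) :: (nat, 'k) mpoly)" for f :: "nat \<Rightarrow> 'k" and A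
    by (induction A rule: infinite_finite_induct) (auto simp: mpoly_const_hom)
  have "coord_poly \<phi> = (\<Sum>j\<le>d. \<Sum>i\<le>n. mpoly_const (a i) * (mpoly_const (l i (e j)) * mpoly_var j))"
    unfolding coord_poly_def a by (simp add: const_sum mpoly_const_hom sum_distrib_right mult.assoc)
  also have "\<dots> = (\<Sum>i\<le>n. mpoly_const (a i) * coord_poly (l i))"
    unfolding coord_poly_def sum_distrib_left by (rule sum.swap)
  finally have "Fract (coord_poly \<phi>) 1 = (\<Sum>i\<le>n. K (a i) * Fract (coord_poly (l i)) 1)"
    by (simp only: Fract_sum Fract_hom K_def)
  also have "\<dots> \<in> LS 1"
  proof (rule LS_sum)
    fix i assume i: "i \<in> {..n}"
    have "G.\<iota> (G.lmon [i]) = Fract (coord_poly (l i)) 1"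
      using G.gr_carrier[OF G.l_gr] i by (simp add: \<iota>_eq Tau_linear_form)
    then show "K (a i) * Fract (coord_poly (l i)) 1 \<in> LS 1" using LS_mon[of "[i]" 1 "a i"] i by simp
  qed
  finally show ?thesis .
qed

lemma grade_LS: "a \<in> SymDual_grade scale k \<Longrightarrow> G.\<iota> a \<in> LS k"
proof -
  assume "a \<in> SymDual_grade scale k"
  then obtain p where p: "a = cls p" "p \<in> carrier (mpoly_ring (dual_space scale))" "mpoly_homogeneous k p"
    unfolding Sym_grade_def by auto
  have "G.\<iota> a = (\<Sum>m\<in>Poly_Mapping.keys p. K (Poly_Mapping.lookup p m) * (\<Prod>w\<in>Poly_Mapping.keys m. Fract (coord_poly w) 1 ^ Poly_Mapping.lookup m w))"
    unfolding \<iota>_eq p(1) Tau_cls tau_def mpoly_eval_def monomial_eval_def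
    by (simp only: Fract_sum Fract_hom Fract_prod Fract_power K_def)
  also have "\<dots> \<in> LS k"
  proof (rule LS_sum)
    fix m assume m: "m \<in> Poly_Mapping.keys p"
    have "(\<Prod>w\<in>Poly_Mapping.keys m. Fract (coord_poly w) 1 ^ Poly_Mapping.lookup m w) \<in> LS (mdeg m)"
      unfolding mdeg_def by (intro LS_prod LS_power LS_coord) (use m p(2) in \<open>auto simp: carrier_mpoly_ring\<close>)
    moreover have "mdeg m = k" using m p(3) unfolding mpoly_homogeneous_iff by blast
    ultimately show "K (Poly_Mapping.lookup p m) * (\<Prod>w\<in>Poly_Mapping.keys m. Fract (coord_poly w) 1 ^ Poly_Mapping.lookup m w) \<in> LS k"
      using LS_mult[OF LS_const] by fastforce
  qed
  finally show ?thesis .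
qed

lemma Reg_generated:
  assumes "0 \<in> Q" and add: "\<And>x y. x \<in> Q \<Longrightarrow> y \<in> Q \<Longrightarrow> x + y \<in> Q"
    and mon: "\<And>c e. c \<in> range K \<Longrightarrow> c * (\<Prod>i\<le>n. u i powi e i) \<in> Q"
  shows "G.Reg \<subseteq> Q"
proof
  fix x assume "x \<in> G.Reg"
  then obtain a "is" where a: "x = G.\<iota> a / G.\<iota> (G.lmon is)" "set is \<subseteq> {..n}" "a \<in> SymDual_grade scale (length is)"
    unfolding G.Reg_def by blast
  have "y / G.\<iota> (G.lmon is) \<in> Q" if "y \<in> LS (length is)" for y
    using that
  proof (induction rule: LS.induct)
    case (LS_mon js c)
    have "K c * G.\<iota> (G.lmon js) / G.\<iota> (G.lmon is) = K c * (\<Prod>i\<le>n. u i powi (int (count_list js i) - int (count_list is i)))"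
      using lmon_ratio[OF LS_mon(1) a(2) LS_mon(2)] by (simp flip: times_divide_eq_right)
    then show ?case using mon[of "K c"] by simp
  qed (auto simp: assms(1) add_divide_distrib intro: add)
  then show "x \<in> Q" unfolding a(1) using grade_LS[OF a(3)] by blast
qed

lemma K_Reg: "K c \<in> G.Reg"
  unfolding G.Reg_def using cls_const_in[of c] \<iota>_const[of c]
  by (intro CollectI exI[of _ "cls (mpoly_const c)"] exI[of _ "[]"]) (auto simp: G.\<iota>_hom)

lemma u_Reg: "i \<le> n \<Longrightarrow> u i \<in> G.Reg \<and> u i \<noteq> 0 \<and> inverse (u i) \<in> G.Reg"
  using G.Reg_dehom[OF G.l_gr, of i] G.Reg_inverse[of i] u_nonzero unfolding u_def by (simp add: inverse_divide)

lemma unit_generated: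
  assumes "\<And>x. x \<in> G.Reg \<Longrightarrow> \<psi> x \<in> G.Reg"
    and "\<And>x y. x \<in> G.Reg \<Longrightarrow> y \<in> G.Reg \<Longrightarrow> \<psi> (x + y) = \<psi> x + \<psi> y"
    and "\<And>x y. x \<in> G.Reg \<Longrightarrow> y \<in> G.Reg \<Longrightarrow> \<psi> (x * y) = \<psi> x * \<psi> y"
    and "\<And>c. \<psi> (K c) = K c" and "\<And>x. x \<in> G.Reg \<Longrightarrow> \<psi> x = 0 \<Longrightarrow> x = 0"
  shows "unit_generated_ring G.Reg (range K) n u \<psi>"
proof (rule unit_generated_ring.intro, goal_cases)
  case 1 show ?case by (rule G.field_subring_Reg)
next
  case (7 Q) then show ?case using Reg_generated[of Q] by blast
next
  case (8 x) then show ?case using Reg_units[of x] by blast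
qed (use assms K_Reg u_Reg in \<open>auto simp: K_inverse K_hom(1)[symmetric] K_hom(3)[symmetric] simp del: K_hom\<close>)

end

lemma (in subring_copy) e_finsum:
  assumes "finite A" "A \<subseteq> R" "\<And>b. b \<in> A \<Longrightarrow> \<gamma> b \<in> R" "\<And>b. b \<in> A \<Longrightarrow> F (e b) = e (\<gamma> b)"
  shows "(\<Oplus>s\<in>e ` A. F s) = e (\<Sum>b\<in>A. \<gamma> b)"
proof -
  have "(\<Sum>b\<in>A. \<gamma> b) \<in> R \<and> (\<Oplus>s\<in>e ` A. F s) = e (\<Sum>b\<in>A. \<gamma> b)"
    using assms
  proof (induction A rule: finite_induct)
    case empty
    then show ?case using Rs(1) e_zero by simp
  next
    case (insert b A)
    have IH: "(\<Sum>b\<in>A. \<gamma> b) \<in> R" "(\<Oplus>s\<in>e ` A. F s) = e (\<Sum>b\<in>A. \<gamma> b)" using insert by auto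
    have "e b \<notin> e ` A" using e_in[of A b] insert.hyps insert.prems by auto
    then have "(\<Oplus>s\<in>e ` insert b A. F s) = F (e b) \<oplus> (\<Oplus>s\<in>e ` A. F s)"
      using insert.hyps insert.prems carrier_B by (subst image_insert, subst finsum_insert) auto
    also have "\<dots> = e (\<gamma> b + (\<Sum>b\<in>A. \<gamma> b))" using IH insert.prems e_add by auto
    finally show ?case using insert.hyps insert.prems IH Rs(4) by auto
  qed
  then show ?thesis by blast
qed

lemma Spec_field_fraction_space:
  "fraction_space (ring_of_type_algebra :: 'k::field ring) {carrier (ring_of_type_algebra :: 'k ring)}
     {Q. primeideal Q (ring_of_type_algebra :: 'k ring)} (\<lambda>c. c)"
proof -
  interpret subring_copy "ring_of_type_algebra :: 'k ring" UNIV "\<lambda>c. c"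
    by unfold_locales (auto simp: field_subring_def ring_of_type_algebra_def)
  have "inv_into UNIV (\<lambda>c. c) = (\<lambda>c::'k. c)" using inv_id unfolding id_def .
  then show ?thesis using Spec_fraction_space by simp
qed

context based_arrangement
begin

abbreviation PP where "PP \<equiv> Proj_points (SymDual scale) (SymDual_grade scale)"
abbreviation PS where "PS \<equiv> Proj (SymDual scale) (SymDual_grade scale)"

lemma points_proj_space: "points (proj_space scale) = PP"
  unfolding proj_space_def Proj_def prime_space_def using G.topspace_zariski by simp

lemma compl_points_eq: "compl_points scale n H = G.\<Omega>"
proof -
  have "p \<in> proj_subspace scale (H i) \<longleftrightarrow> lf i \<in> p" if p: "p \<in> PP" and i: "i \<le> n" for p i
  proof
    assume "p \<in> proj_subspace scale (H i)"
    then show "lf i \<in> p" using forms[OF i] unfolding proj_subspace_def by auto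
  next
    assume lp: "lf i \<in> p"
    interpret P: primeideal p "SymDual scale" by (rule G.prime[OF p])
    have "linear_form scale \<phi> \<in> p" if \<phi>: "\<phi> \<in> dual_space scale" "\<forall>v\<in>H i. \<phi> v = 0" for \<phi>
    proof -
      have "\<exists>a. \<phi> = (\<lambda>v. \<Sum>j\<in>{i}. a j * l j v)"
        by (rule functional_in_span[OF vector_space]) (use \<phi> forms[OF i] in auto)
      then obtain a where "\<phi> = (\<lambda>v. a i * l i v)" by auto
      then have "\<phi> = dual_scale (a i) (l i)" unfolding dual_scale_def by simp
      then have "Tau (linear_form scale \<phi>) = Tau (cls (mpoly_const (a i)) \<otimes>\<^bsub>S\<^esub> lf i)"
        using Tau_hom(1)[OF G.gr_carrier[OF cls_const_in] linear_form_in[OF l_dual[OF i]]]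
        by (simp add: Tau_linear_form coord_poly_linear Tau_cls tau_simps)
      then have "linear_form scale \<phi> = cls (mpoly_const (a i)) \<otimes>\<^bsub>S\<^esub> lf i"
        using inj_onD[OF Tau_inj] linear_form_in[OF \<phi>(1)] linear_form_in[OF l_dual[OF i]]
          G.gr_carrier[OF cls_const_in] G.m_closed by blast
      then show ?thesis using P.I_l_closed[OF lp G.gr_carrier[OF cls_const_in]] by simp
    qed
    then show "p \<in> proj_subspace scale (H i)" using p points_proj_space unfolding proj_subspace_def by auto
  qed
  then show ?thesis unfolding compl_points_def points_proj_space G.\<Omega>_def by auto
qed

abbreviation X where "X \<equiv> arr_compl scale n H"

lemma X_eq: "X = open_subspace PS G.\<Omega>"
  unfolding arr_compl_def compl_points_eq proj_space_def ..

lemma sheaf_X: "sheaf X = sheaf PS"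
  unfolding X_eq open_subspace_def by simp

lemma X_rational: "rational_space X G.locring G.sec"
  unfolding X_eq Proj_def by (rule G.open_subspace_rational) (simp add: prime_space_def G.openin_\<Omega>)

lemma points_X: "points X = G.\<Omega>"
  unfolding X_eq open_subspace_def Proj_def prime_space_def
  using G.\<Omega>_points by (auto simp: topspace_subtopology G.topspace_zariski)

lemma open_subspace_X: "open_subspace X G.\<Omega> = X"
  unfolding X_eq open_subspace_def by (simp add: subtopology_subtopology)

lemma structure_section:
  obtains V s where "openin (space_of (Spec_field TYPE('k))) V" "s \<in> carrier (sheaf (Spec_field TYPE('k)) V)"
    "preim X (arr_compl_struct scale n H) V = G.\<Omega>"
    "snd (arr_compl_struct scale n H) V s = G.sec G.\<Omega> (K c)"
proof -
  define kr where "kr = (ring_of_type_algebra :: 'k ring)"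
  define V where "V = {Q. primeideal Q kr}"
  interpret F: fraction_space kr "{carrier kr}" V "\<lambda>c. c"
    unfolding kr_def V_def by (rule Spec_field_fraction_space)
  have kr: "carrier kr = UNIV" unfolding kr_def ring_of_type_algebra_def by simp
  have kr_ops: "a \<otimes>\<^bsub>kr\<^esub> b = a * b" "a \<oplus>\<^bsub>kr\<^esub> b = a + b" "\<one>\<^bsub>kr\<^esub> = 1" "\<zero>\<^bsub>kr\<^esub> = 0" for a b
    unfolding kr_def ring_of_type_algebra_def by simp_all
  define h where "h c = cls (mpoly_const c)" for c
  have Sp: "Spec_field TYPE('k) = prime_space kr {carrier kr} V" unfolding Spec_field_def Spec_def kr_def V_def ..
  have oV: "openin (space_of (Spec_field TYPE('k))) V"
    unfolding Sp using F.topspace_zariski openin_topspace[of "zariski {carrier kr} V"] by (simp add: prime_space_def)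
  have cq: "(c, 1) \<in> F.fr q c" if "q \<in> V" for q
    unfolding F.fr_def fractions_def using kr F.primeideal_one_notin that unfolding V_def by (auto simp: kr_ops)
  have "c \<in> (\<Inter>q\<in>V. F.locring q)" using cq unfolding F.locring_def by blast
  then have s: "F.sec V c \<in> carrier (sheaf (Spec_field TYPE('k)) V)"
    using F.carrier_sheaf[OF oV[unfolded Sp]] unfolding Sp by blast
  define \<pi> where "\<pi> p = {c. h c \<in> p}" for p
  have \<pi>V: "\<pi> p \<in> V" if p: "p \<in> PP" for p
  proof -
    interpret P: primeideal p "SymDual scale" by (rule G.prime[OF p])
    have hc: "h a \<in> carrier S" for a unfolding h_def by (rule G.gr_carrier[OF cls_const_in])
    have one: "h 1 \<notin> p"
      unfolding h_def mpoly_const_hom using G.primeideal_one_notin[OF G.prime[OF p]] S_one by simp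
    have "\<pi> p = {0}"
    proof (intro subset_antisym subsetI)
      fix a assume a: "a \<in> \<pi> p"
      show "a \<in> {0}"
      proof (rule ccontr)
        assume "a \<notin> {0}"
        then have "a \<noteq> 0" by simp
        have "h (inverse a) \<otimes>\<^bsub>S\<^esub> h a = h (inverse a * a)"
          unfolding h_def mpoly_const_hom by (rule S_ops(1)) (rule mpoly_ring_closed(5))+
        then have "h (inverse a) \<otimes>\<^bsub>S\<^esub> h a = h 1" using \<open>a \<noteq> 0\<close> by simp
        moreover have "h (inverse a) \<otimes>\<^bsub>S\<^esub> h a \<in> p" using a P.I_l_closed hc unfolding \<pi>_def by simp
        ultimately show False using one by simp
      qed
    next
      fix a :: 'k assume "a \<in> {0}"
      then have "G.\<iota> (h a) = 0" unfolding h_def \<iota>_const by (simp add: K_hom)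
      then have "h a = \<zero>\<^bsub>S\<^esub>" using G.\<iota>_eq_0[OF hc] by simp
      then show "a \<in> \<pi> p" unfolding \<pi>_def using P.zero_closed by simp
    qed
    then show ?thesis using F.generic by (simp add: kr_ops)
  qed
  have st: "fst (arr_compl_struct scale n H) p = \<pi> p" for p
    unfolding arr_compl_struct_def restrict_mor_def proj_space_struct_def Proj_struct_def Let_def \<pi>_def h_def
    using kr[unfolded kr_def] by simp
  have fst_ps: "fst (proj_space_struct scale) p = \<pi> p" for p
    unfolding proj_space_struct_def Proj_struct_def Let_def \<pi>_def h_def using kr[unfolded kr_def] by simp
  have pre: "preim X (arr_compl_struct scale n H) V = G.\<Omega>"
    unfolding preim_def points_X st using \<pi>V G.\<Omega>_points by auto
  have prePS: "preim (proj_space scale) (proj_space_struct scale) V = PP"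
    unfolding preim_def points_proj_space fst_ps using \<pi>V by auto
  have val: "(\<Union>(a, b)\<in>F.sec V c (\<pi> p). loc_frac S (range (SymDual_grade scale)) p (h a) (h b)) = G.fr p (K c)"
    if p: "p \<in> PP" for p
  proof -
    have "loc_frac S (range (SymDual_grade scale)) p (h a) (h b) = G.fr p (K c)" if ab: "(a, b) \<in> F.fr (\<pi> p) c" for a b
    proof -
      have "a = c * b" "b \<notin> \<pi> p" using ab unfolding F.fr_def fractions_def by auto
      then have "h b \<notin> p" unfolding \<pi>_def by simp
      then have fr: "(h a, h b) \<in> fractions (range (SymDual_grade scale)) p"
        unfolding h_def fractions_def using cls_const_in by blast
      have "G.\<iota> (h b) \<noteq> 0" using G.fractionsD(4)[OF p fr] .
      then have "G.\<iota> (h a) / G.\<iota> (h b) = K c" unfolding h_def \<iota>_const \<open>a = c * b\<close> by (simp add: K_hom)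
      then show ?thesis using G.loc_frac_eq[OF p fr] by simp
    qed
    then have "(\<Union>(a, b)\<in>F.fr (\<pi> p) c. loc_frac S (range (SymDual_grade scale)) p (h a) (h b)) =
       (\<Union>(a, b)\<in>F.fr (\<pi> p) c. G.fr p (K c))" by (intro SUP_cong refl) auto
    also have "\<dots> = G.fr p (K c)" using cq[OF \<pi>V[OF p]] by auto
    finally show ?thesis using \<pi>V[OF p] unfolding F.sec_def by simp
  qed
  have "snd (proj_space_struct scale) V (F.sec V c) =
      (\<lambda>p\<in>PP. \<Union>(a, b)\<in>F.sec V c (\<pi> p). loc_frac S (range (SymDual_grade scale)) p (h a) (h b))"
  proof -
    have "{p \<in> PP. \<pi> p \<in> V} = PP" using \<pi>V by auto
    moreover have "{c \<in> carrier (ring_of_type_algebra :: 'k ring). cls (mpoly_const c) \<in> p} = \<pi> p" for p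
      unfolding \<pi>_def h_def using kr[unfolded kr_def] by simp
    ultimately show ?thesis
      unfolding proj_space_struct_def Proj_struct_def Let_def snd_conv by (simp add: h_def)
  qed
  then have "snd (arr_compl_struct scale n H) V (F.sec V c) = G.sec G.\<Omega> (K c)"
    unfolding arr_compl_struct_def restrict_mor_def snd_conv prePS compl_points_eq G.sec_def
    using val G.\<Omega>_points by (auto simp: proj_space_def Proj_def prime_space_def fun_eq_iff restrict_def)
  then show ?thesis using that[OF oV s pre] by blast
qed

theorem dominant_finite:
  assumes mor: "morphism_over (Spec_field TYPE('k)) X (arr_compl_struct scale n H) X (arr_compl_struct scale n H) f"
    and dom: "dominant X X f"
  shows "finite_morphism X X f"
proof -
  interpret X: rational_space X G.locring G.sec by (rule X_rational)
  define e where "e = G.sec G.\<Omega>"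
  interpret C: subring_copy "sheaf X G.\<Omega>" G.Reg e unfolding sheaf_X e_def by (rule G.sections_copy)
  have rsm: "ringed_space_morphism X X f" using mor unfolding morphism_over_def local_morphism_def by blast
  have cont: "continuous_map (space_of X) (space_of X) (fst f)" using rsm unfolding ringed_space_morphism_def by blast
  have hom: "snd f V \<in> ring_hom (sheaf X V) (sheaf X (preim X f V))" if "openin (space_of X) V" for V
    using rsm that unfolding ringed_space_morphism_def by blast
  have res: "snd f W (restr X V W s) = restr X (preim X f V) (preim X f W) (snd f V s)"
    if "openin (space_of X) V" "openin (space_of X) W" "W \<subseteq> V" "s \<in> carrier (sheaf X V)" for V W s
    using rsm that unfolding ringed_space_morphism_def by blast
  have preop: "openin (space_of X) (preim X f V)" if "openin (space_of X) V" for V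
    unfolding preim_def using cont that by (simp add: continuous_map_def)
  have o: "openin (space_of X) G.\<Omega>" using openin_topspace[of "space_of X"] points_X by simp
  have pre: "preim X f G.\<Omega> = G.\<Omega>"
    unfolding preim_def points_X using cont points_X unfolding continuous_map_def by auto
  define \<Psi> where "\<Psi> = snd f G.\<Omega>"
  have \<Psi>hom: "\<Psi> \<in> ring_hom (sheaf X G.\<Omega>) (sheaf X G.\<Omega>)" unfolding \<Psi>_def using hom[OF o] pre by simp
  define \<psi> where "\<psi> x = inv_into G.Reg e (\<Psi> (e x))" for x
  have ein: "e x \<in> carrier (sheaf X G.\<Omega>)" if "x \<in> G.Reg" for x using that C.carrier_B by simp
  have \<psi>: "\<psi> x \<in> G.Reg" "e (\<psi> x) = \<Psi> (e x)" if x: "x \<in> G.Reg" for x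
  proof -
    have "\<Psi> (e x) \<in> e ` G.Reg" using ring_hom_closed[OF \<Psi>hom ein[OF x]] C.carrier_B by simp
    then show "\<psi> x \<in> G.Reg" "e (\<psi> x) = \<Psi> (e x)" unfolding \<psi>_def by (auto intro: inv_into_into f_inv_into_f)
  qed
  have eD: "x = y" if "e x = e y" "x \<in> G.Reg" "y \<in> G.Reg" for x y using inj_onD[OF C.e_inj] that by blast
  have \<psi>_add: "\<psi> (x + y) = \<psi> x + \<psi> y" if x: "x \<in> G.Reg" and y: "y \<in> G.Reg" for x y
  proof (rule eD)
    have "e (\<psi> (x + y)) = \<Psi> (e x \<oplus>\<^bsub>sheaf X G.\<Omega>\<^esub> e y)" using \<psi>(2)[OF C.Rs(4)[OF x y]] C.e_add[OF x y] by simp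
    also have "\<dots> = e (\<psi> x + \<psi> y)"
      unfolding ring_hom_add[OF \<Psi>hom ein[OF x] ein[OF y]] \<psi>(2)[OF x, symmetric] \<psi>(2)[OF y, symmetric]
      by (rule C.e_add[OF \<psi>(1)[OF x] \<psi>(1)[OF y]])
    finally show "e (\<psi> (x + y)) = e (\<psi> x + \<psi> y)" .
  qed (use \<psi>(1) x y C.Rs(4) in auto)
  have \<psi>_mult: "\<psi> (x * y) = \<psi> x * \<psi> y" if x: "x \<in> G.Reg" and y: "y \<in> G.Reg" for x y
  proof (rule eD)
    have "e (\<psi> (x * y)) = \<Psi> (e x \<otimes>\<^bsub>sheaf X G.\<Omega>\<^esub> e y)" using \<psi>(2)[OF C.Rs(5)[OF x y]] C.e_mult[OF x y] by simp
    also have "\<dots> = e (\<psi> x * \<psi> y)"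
      unfolding ring_hom_mult[OF \<Psi>hom ein[OF x] ein[OF y]] \<psi>(2)[OF x, symmetric] \<psi>(2)[OF y, symmetric]
      by (rule C.e_mult[OF \<psi>(1)[OF x] \<psi>(1)[OF y]])
    finally show "e (\<psi> (x * y)) = e (\<psi> x * \<psi> y)" .
  qed (use \<psi>(1) x y C.Rs(5) in auto)
  have \<psi>_const: "\<psi> (K c) = K c" for c
  proof -
    obtain V s where V: "openin (space_of (Spec_field TYPE('k))) V" "s \<in> carrier (sheaf (Spec_field TYPE('k)) V)"
      "preim X (arr_compl_struct scale n H) V = G.\<Omega>" "snd (arr_compl_struct scale n H) V s = G.sec G.\<Omega> (K c)"
      using structure_section by metis
    have "same_mor X (Spec_field TYPE('k)) (comp_mor X (arr_compl_struct scale n H) f) (arr_compl_struct scale n H)"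
      using mor unfolding morphism_over_def by blast
    then have "snd (comp_mor X (arr_compl_struct scale n H) f) V s = snd (arr_compl_struct scale n H) V s"
      using V(1,2) unfolding same_mor_def by blast
    then have "\<Psi> (e (K c)) = e (K c)" unfolding comp_mor_def snd_conv comp_def V(3,4) \<Psi>_def e_def .
    then show ?thesis using eD[OF _ \<psi>(1)[OF K_Reg] K_Reg] \<psi>(2)[OF K_Reg] by simp
  qed
  have \<psi>_inj: "x = 0" if x: "x \<in> G.Reg" and z: "\<psi> x = 0" for x
  proof (rule ccontr)
    assume nz: "x \<noteq> 0"
    have g: "{\<zero>\<^bsub>S\<^esub>} \<in> G.\<Omega>" by (rule G.generic_in_\<Omega>)
    obtain a b k where ab: "x = G.\<iota> a / G.\<iota> b" "a \<in> SymDual_grade scale k" "b \<in> SymDual_grade scale k" "G.\<iota> b \<noteq> 0"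
      using G.Reg_fraction[OF x] by metis
    have "a \<notin> {\<zero>\<^bsub>S\<^esub>}" using nz ab(1) G.\<iota>_zero by auto
    then have "(b, a) \<in> fractions (range (SymDual_grade scale)) {\<zero>\<^bsub>S\<^esub>}" using ab G.fractions_gr by blast
    moreover have "inverse x = G.\<iota> b / G.\<iota> a" using ab(1) by simp
    ultimately have "inverse x \<in> G.locring {\<zero>\<^bsub>S\<^esub>}" using G.locring_iff[OF G.generic] by blast
    moreover have gX: "{\<zero>\<^bsub>S\<^esub>} \<in> points X" using g points_X by simp
    ultimately obtain W where W: "openin (space_of X) W" "{\<zero>\<^bsub>S\<^esub>} \<in> W" "inverse x \<in> (\<Inter>q\<in>W. G.locring q)"
      using X.spread by blast
    have "{\<zero>\<^bsub>S\<^esub>} \<in> space_of X closure_of (fst f ` points X)" using dom gX unfolding dominant_def by simp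
    then obtain p where p: "p \<in> points X" "fst f p \<in> W" using W(1,2) unfolding in_closure_of by blast
    define Z where "Z = preim X f W"
    have Z: "openin (space_of X) Z" "Z \<noteq> {}" unfolding Z_def using preop[OF W(1)] p unfolding preim_def by auto
    have W\<Omega>: "W \<subseteq> G.\<Omega>" and Z\<Omega>: "Z \<subseteq> G.\<Omega>" using openin_subset[OF W(1)] openin_subset[OF Z(1)] points_X by auto
    have xO: "x \<in> (\<Inter>q\<in>G.\<Omega>. G.locring q)" and xW: "x \<in> (\<Inter>q\<in>W. G.locring q)"
      using x W\<Omega> G.Reg_locring by auto
    have zO: "0 \<in> (\<Inter>q\<in>G.\<Omega>. G.locring q)" "0 \<in> (\<Inter>q\<in>Z. G.locring q)" "1 \<in> (\<Inter>q\<in>Z. G.locring q)"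
      using X.\<O>_zero X.\<O>_one points_X Z\<Omega> by auto
    have hW: "snd f W \<in> ring_hom (sheaf X W) (sheaf X Z)" unfolding Z_def by (rule hom[OF W(1)])
    have sx: "G.sec W x \<in> carrier (sheaf X W)" "G.sec W (inverse x) \<in> carrier (sheaf X W)"
      using X.carrier_sheaf[OF W(1)] xW W(3) by auto
    have "\<Psi> (e x) = e 0" using \<psi>(2)[OF x] z by simp
    then have fx: "snd f W (G.sec W x) = G.sec Z 0"
      using res[OF o W(1) W\<Omega> ein[OF x]] X.restr_sec[OF o W(1) W\<Omega> xO] X.restr_sec[OF o Z(1) Z\<Omega> zO(1)]
      unfolding pre Z_def[symmetric] \<Psi>_def e_def by simp
    have "snd f W (G.sec W (inverse x)) \<in> carrier (sheaf X Z)" by (rule ring_hom_closed[OF hW sx(2)])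
    then obtain y where y: "snd f W (G.sec W (inverse x)) = G.sec Z y" "y \<in> (\<Inter>q\<in>Z. G.locring q)"
      using X.carrier_sheaf[OF Z(1)] by blast
    have "G.sec Z 1 = snd f W (G.sec W 1)"
      using ring_hom_one[OF hW] X.sec_one[OF W(1)] X.sec_one[OF Z(1)] by simp
    also have "G.sec W 1 = G.sec W x \<otimes>\<^bsub>sheaf X W\<^esub> G.sec W (inverse x)"
      using X.sec_mult[OF W(1) xW W(3)] nz by simp
    also have "snd f W \<dots> = G.sec Z 0 \<otimes>\<^bsub>sheaf X Z\<^esub> G.sec Z y"
      unfolding ring_hom_mult[OF hW sx] fx y(1) ..
    also have "\<dots> = G.sec Z 0" using X.sec_mult[OF Z(1) zO(2) y(2)] by simp
    finally have "1 = (0 :: (nat, 'k) mpoly fract)" using X.sec_inj[OF Z(1,2) zO(3,2)] by blast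
    then show False by simp
  qed
  interpret U: unit_generated_ring G.Reg "range K" n u \<psi>
    by (rule unit_generated) (use \<psi>(1) \<psi>_add \<psi>_mult \<psi>_const \<psi>_inj in auto)
  obtain B where B: "finite B" "B \<subseteq> G.Reg"
    and span: "\<And>x. x \<in> G.Reg \<Longrightarrow> \<exists>w\<in>B \<rightarrow> G.Reg. x = (\<Sum>b\<in>B. \<psi> (w b) * b)"
    using U.finite_over_image by blast
  have "finite_ring_hom (sheaf X G.\<Omega>) (sheaf X G.\<Omega>) \<Psi>"
    unfolding finite_ring_hom_def
  proof (intro exI conjI ballI)
    show "finite (e ` B)" using B by simp
    show "e ` B \<subseteq> carrier (sheaf X G.\<Omega>)" using B C.carrier_B by auto
    fix s assume "s \<in> carrier (sheaf X G.\<Omega>)"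
    then obtain x where x: "s = e x" "x \<in> G.Reg" using C.carrier_B by auto
    obtain w where w: "w \<in> B \<rightarrow> G.Reg" "x = (\<Sum>b\<in>B. \<psi> (w b) * b)" using span[OF x(2)] by blast
    define c where "c s = e (w (inv_into G.Reg e s))" for s
    have wb: "w b \<in> G.Reg" "b \<in> G.Reg" if "b \<in> B" for b using that w(1) B(2) by auto
    have ceb: "c (e b) = e (w b)" if "b \<in> B" for b using wb(2)[OF that] C.e_inj unfolding c_def by simp
    have "(\<Oplus>\<^bsub>sheaf X G.\<Omega>\<^esub>s\<in>e ` B. \<Psi> (c s) \<otimes>\<^bsub>sheaf X G.\<Omega>\<^esub> s) = e (\<Sum>b\<in>B. \<psi> (w b) * b)"
    proof (rule C.e_finsum[OF B])
      fix b assume b: "b \<in> B"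
      show "\<psi> (w b) * b \<in> G.Reg" using \<psi>(1) wb[OF b] C.Rs(5) by blast
      show "\<Psi> (c (e b)) \<otimes>\<^bsub>sheaf X G.\<Omega>\<^esub> e b = e (\<psi> (w b) * b)"
        unfolding ceb[OF b] \<psi>(2)[OF wb(1)[OF b], symmetric] using C.e_mult \<psi>(1) wb[OF b] by blast
    qed
    then have "s = (\<Oplus>\<^bsub>sheaf X G.\<Omega>\<^esub>s\<in>e ` B. \<Psi> (c s) \<otimes>\<^bsub>sheaf X G.\<Omega>\<^esub> s)" unfolding x(1) w(2) by simp
    moreover have "c \<in> e ` B \<rightarrow> carrier (sheaf X G.\<Omega>)" using ceb wb(1) ein by auto
    ultimately show "\<exists>c\<in>e ` B \<rightarrow> carrier (sheaf X G.\<Omega>).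
        s = (\<Oplus>\<^bsub>sheaf X G.\<Omega>\<^esub>s\<in>e ` B. \<Psi> (c s) \<otimes>\<^bsub>sheaf X G.\<Omega>\<^esub> s)" by blast
  qed
  moreover have "affine_scheme X" unfolding X_eq by (rule G.affine_\<Omega>)
  ultimately show ?thesis
    unfolding finite_morphism_def using o pre points_X
    by (intro exI[of _ "{G.\<Omega>}"]) (simp add: open_subspace_X \<Psi>_def)
qed

end

theorem corollary5p2:
  fixes scale :: "'k::field \<Rightarrow> 'v::ab_group_add \<Rightarrow> 'v"
    and d n :: nat
    and H :: "nat \<Rightarrow> 'v set"
    and l :: "nat \<Rightarrow> 'v \<Rightarrow> 'k"
  assumes "vector_space scale"
    and "vector_space.dim scale (UNIV :: 'v set) = d + 1"
    and "arrangement scale n H"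
    and "essential n H"
    and "\<And>i. i \<le> n \<Longrightarrow> l i \<in> dual_space scale \<and> H i = {v. l i v = 0}"
    and "connected_matroid {..n} (matroid_indep n l)"
    and "morphism_over (Spec_field TYPE('k))
           (arr_compl scale n H) (arr_compl_struct scale n H)
           (arr_compl scale n H) (arr_compl_struct scale n H) f"
    and "dominant (arr_compl scale n H) (arr_compl scale n H) f"
  shows "finite_morphism (arr_compl scale n H) (arr_compl scale n H) f"
proof -
  have "hyperplane scale (H 0)" using assms(3) unfolding arrangement_def by simp
  then obtain \<phi> where \<phi>: "\<phi> \<in> dual_space scale" "\<phi> \<noteq> (\<lambda>_. 0)" unfolding hyperplane_def by auto
  obtain e co where "dual_basis scale d e co" using dual_basis_exists[OF assms(1,2) \<phi>] by blast
  then interpret based_arrangement scale d e co n H l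
    by (rule based_arrangement.intro) (unfold_locales, use assms(2-5) in auto)
  show ?thesis by (rule dominant_finite[OF assms(7,8)])
qed

end
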